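(* For every integer $n\ge 0$, the true polyanalytic Bergman transform of order $n$, $\mathrm{Ber}^{n}:L^{2}(\mathbb{R}^{+})\to \mathcal{A}^{n}(\mathbf{U})$, is unitary.
   Context: $\mathbf{U}=\{z=x+is\in\mathbb{C}: s>0\}$ is the upper half plane, $\frac{d}{dz}=\frac12\left(\frac{\partial}{\partial x}-i\frac{\partial}{\partial s}\right)$, $\frac{d}{d\overline z}=\frac12\left(\frac{\partial}{\partial x}+i\frac{\partial}{\partial s}\right)$. For $n\ge 1$, the polyanalytic Bergman space $\mathbf{A}^{n}(\mathbf{U})$ consists of the functions $F:\mathbf{U}\to\mathbb{C}$ with $\left(\frac{d}{d\overline z}\right)^{n}F=0$ and $\|F\|^2=\int_{\mathbf U}|F(z)|^{2}\,dx\,ds<\infty$, so that $\mathbf A^1(\mathbf U)$ is the usual Bergman space; set $\mathbf{A}^{0}(\mathbf{U})=\{0\}$. The true polyanalytic Bergman space is $\mathcal{A}^{n}(\mathbf{U})=\mathbf{A}^{n+1}(\mathbf{U})\ominus\mathbf{A}^{n}(\mathbf{U})$ (orthogonal complement), $n\ge 0$, with the same norm. For $f\in L^{2}(\mathbb{R}^{+})$, the Bergman transform is $\mathrm{Ber}f(z)=\int_{0}^{\infty}t^{1/2}f(t)e^{izt}\,dt$, and the true polyanalytic Bergman transform of order $n$ is $\mathrm{Ber}^{n}f(z)=\frac{1}{(2i)^{n}n!}\left(\frac{d}{dz}\right)^{n}\left[s^{n}\,\mathrm{Ber}f(z)\right]$, $z=x+is$.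
   Formalization: With the constants as given, Ber^n is not isometric, since the squared norm of Ber^n f is (pi/16^n) times that of f; the formal theorem states that (4^n/sqrt(pi)) Ber^n is unitary onto the true polyanalytic Bergman space. *)

theory Defs
  imports "HOL-Analysis.Analysis"
begin

definition upper_half_plane :: "complex set" (\<open>\<bbbU>\<close>)
  where "\<bbbU> = {z. Im z > 0}"

text \<open>Square-integrable functions are kept as functions, not as classes modulo null sets.\<close>

definition L2 :: "'a measure \<Rightarrow> ('a \<Rightarrow> complex) set"
  where "L2 M = {f \<in> borel_measurable M. integrable M (\<lambda>x. (cmod (f x))\<^sup>2)}"

definition l2_inner :: "'a measure \<Rightarrow> ('a \<Rightarrow> complex) \<Rightarrow> ('a \<Rightarrow> complex) \<Rightarrow> complex"
  where "l2_inner M f g = (LINT x|M. f x * cnj (g x))"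

text \<open>
  \<open>unitary_L2 M N K T\<close>: the map \<open>T\<close> induces a unitary operator (a surjective linear map preserving
  inner products) from the Hilbert space \<open>L\<^sup>2(M)\<close> onto the space \<open>K\<close> of functions on \<open>space N\<close>,
  which carries the inner product of \<open>L\<^sup>2(N)\<close>. Elements of \<open>L\<^sup>2(M)\<close> are identified when they agree
  almost everywhere; elements of \<open>K\<close> are identified only when they agree at every point of
  \<open>space N\<close> (their values elsewhere are irrelevant).
\<close>

definition unitary_L2 ::
  "'a measure \<Rightarrow> 'b measure \<Rightarrow> ('b \<Rightarrow> complex) set \<Rightarrow> (('a \<Rightarrow> complex) \<Rightarrow> 'b \<Rightarrow> complex) \<Rightarrow> bool"
  where "unitary_L2 M N K T \<longleftrightarrow>
    (\<forall>f\<in>L2 M. T f \<in> K) \<and>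
    (\<forall>f\<in>L2 M. \<forall>g\<in>L2 M. (AE x in M. f x = g x) \<longrightarrow> (\<forall>z\<in>space N. T f z = T g z)) \<and>
    (\<forall>f\<in>L2 M. \<forall>g\<in>L2 M. \<forall>a b. \<forall>z\<in>space N.
       T (\<lambda>x. a * f x + b * g x) z = a * T f z + b * T g z) \<and>
    (\<forall>f\<in>L2 M. \<forall>g\<in>L2 M. l2_inner N (T f) (T g) = l2_inner M f g) \<and>
    (\<forall>F\<in>K. \<exists>f\<in>L2 M. \<forall>z\<in>space N. T f z = F z)"

definition partial_x :: "(complex \<Rightarrow> complex) \<Rightarrow> complex \<Rightarrow> complex"
  where "partial_x F z = vector_derivative (\<lambda>x. F (Complex x (Im z))) (at (Re z))"

definition partial_s :: "(complex \<Rightarrow> complex) \<Rightarrow> complex \<Rightarrow> complex"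
  where "partial_s F z = vector_derivative (\<lambda>s. F (Complex (Re z) s)) (at (Im z))"

definition d_dz :: "(complex \<Rightarrow> complex) \<Rightarrow> complex \<Rightarrow> complex"
  where "d_dz F z = (partial_x F z - \<i> * partial_s F z) / 2"

definition d_dzbar :: "(complex \<Rightarrow> complex) \<Rightarrow> complex \<Rightarrow> complex"
  where "d_dzbar F z = (partial_x F z + \<i> * partial_s F z) / 2"

text \<open>
  \<open>C_diff k S F\<close>: on the open set \<open>S\<close>, the function \<open>F\<close> is \<open>k\<close> times continuously differentiable in
  the real sense. It is needed because \<open>vector_derivative\<close> has an unspecified value where the
  derivative does not exist.
\<close>

primrec C_diff :: "nat \<Rightarrow> complex set \<Rightarrow> (complex \<Rightarrow> complex) \<Rightarrow> bool" where
  "C_diff 0 S F \<longleftrightarrow> continuous_on S F"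
| "C_diff (Suc k) S F \<longleftrightarrow>
     F differentiable_on S \<and> C_diff k S (partial_x F) \<and> C_diff k S (partial_s F)"

text \<open>
  Lebesgue measure on \<open>complex\<close> is the area measure \<open>dx ds\<close>. For \<open>n = 0\<close> the condition on the
  iterated derivative says that \<open>F\<close> vanishes on \<open>\<bbbU>\<close>, so this is the zero space.
\<close>

definition poly_bergman :: "nat \<Rightarrow> (complex \<Rightarrow> complex) set"
  where "poly_bergman n =
    {F \<in> L2 (lebesgue_on \<bbbU>). C_diff n \<bbbU> F \<and> (\<forall>z\<in>\<bbbU>. (d_dzbar ^^ n) F z = 0)}"

definition true_poly_bergman :: "nat \<Rightarrow> (complex \<Rightarrow> complex) set"
  where "true_poly_bergman n =
    {F \<in> poly_bergman (n + 1). \<forall>G\<in>poly_bergman n. l2_inner (lebesgue_on \<bbbU>) F G = 0}"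

definition Ber :: "(real \<Rightarrow> complex) \<Rightarrow> complex \<Rightarrow> complex"
  where "Ber f z =
    (LINT t|lebesgue_on {0<..}. of_real (t powr (1/2)) * f t * exp (\<i> * z * of_real t))"

definition true_Ber :: "nat \<Rightarrow> (real \<Rightarrow> complex) \<Rightarrow> complex \<Rightarrow> complex"
  where "true_Ber n f z =
    1 / ((2 * \<i>) ^ n * fact n) * (d_dz ^^ n) (\<lambda>w. of_real (Im w) ^ n * Ber f w) z"

text \<open>
  With \<open>L\<^sub>n\<close> the Laguerre polynomial and \<open>s = Im z\<close>,
  \<open>(d/dz)\<^sup>n [s\<^sup>n exp (i z t)] = n! / (2 i)\<^sup>n * L\<^sub>n (2 s t) * exp (i z t)\<close>,
  and Plancherel gives \<open>\<parallel>true_Ber n f\<parallel>\<^sup>2 = pi / 16\<^sup>n * \<parallel>f\<parallel>\<^sup>2\<close>. With respect to \<open>dt\<close> on the half-line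
  and \<open>dx ds\<close> on the half-plane, \<open>true_Ber n\<close> is thus isometric only up to the factor
  \<open>sqrt pi / 4\<^sup>n\<close>, which the following normalisation removes.
\<close>

definition normalized_true_Ber :: "nat \<Rightarrow> (real \<Rightarrow> complex) \<Rightarrow> complex \<Rightarrow> complex"
  where "normalized_true_Ber n f z = of_real (4 ^ n / sqrt pi) * true_Ber n f z"

end

theory Submission
  imports Defs "HOL-Complex_Analysis.Complex_Analysis" "HOL-Probability.Probability"
begin

text \<open>
  Applied to an exponential \<open>exp (i z t)\<close>, the differential operator in the transform of order \<open>n\<close>
  produces a Laguerre polynomial: with \<open>s = Im z\<close>, the normalised transform of \<open>f\<close> at \<open>z\<close> is
  \<open>(-1)\<^sup>n / sqrt pi\<close> times the integral of \<open>t\<^sup>1\<^sup>/\<^sup>2 L\<^sub>n (2 s t) exp (i z t) f t\<close> over \<open>t > 0\<close>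
  (\<open>normalized_true_Ber_eq\<close>). On each horizontal line this is a Fourier transform, so
  Plancherel's theorem (\<open>plancherel_inner\<close>) turns the inner product of two transforms over the line
  into an integral over \<open>t\<close>. The integration over \<open>s\<close> then only sees the Laguerre polynomials, which
  are orthonormal for the weight \<open>exp (- y)\<close>. Hence every transform is isometric, and
  transforms of different orders have orthogonal ranges (\<open>laguerre_transform_orthonormal\<close>).

  It remains to see that the transforms of orders \<open>0, ..., n\<close> together fill the polyanalytic Bergman
  space of order \<open>n + 1\<close> (\<open>poly_bergman_decomposition\<close>); the true space of order \<open>n\<close> is then
  the range of order \<open>n\<close>. Ranges of isometries are closed, so a function can be projected onto each
  of them (\<open>isometry_projection\<close>), and the claim is that a remainder \<open>G\<close> orthogonal to all of
  them vanishes. Members of the space are the sums \<open>\<Sum>k\<le>n. s\<^sup>k \<phi>\<^sub>k z\<close> with holomorphic \<open>\<phi>\<^sub>k\<close>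
  (\<open>poly_bergman_iff\<close>). The functions \<open>s\<^sup>a (z - cnj w) powi (- m)\<close> with \<open>a \<le> n\<close> and \<open>m \<ge> a + 2\<close> are
  combinations of transforms of explicit functions, so \<open>G\<close> is orthogonal to them
  (\<open>orthogonal_to_test\<close>). Fix \<open>w\<close> and map the unit disc to the half-plane so that \<open>0\<close> goes to
  \<open>w\<close>. The integral of \<open>G\<close>, with a suitable weight, over the circle of radius \<open>r\<close> is a polynomial \<open>q\<close> in \<open>r\<^sup>2\<close> of degree
  at most \<open>n\<close> with \<open>q 0 = 2 pi G w\<close>. Orthogonality to \<open>n + 1\<close> test functions says that \<open>q\<close> is
  orthogonal to all polynomials of degree at most \<open>n\<close> in \<open>r\<^sup>2\<close>, hence to itself; so \<open>q = 0\<close> and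
  \<open>G w = 0\<close> (\<open>bergman_uniqueness\<close>).
\<close>

section \<open>Area integrals over the complex plane\<close>

lemma distr_Complex_lborel: "distr (lborel \<Otimes>\<^sub>M lborel) borel (\<lambda>(x,y). Complex x y) = lborel"
proof (rule lborel_eqI[symmetric])
  have meas: "(\<lambda>(x,y). Complex x y) \<in> borel_measurable (lborel \<Otimes>\<^sub>M lborel)"
    unfolding lborel_prod case_prod_beta complex_eq_iff[symmetric]
    by (auto simp: Complex_eq intro!: borel_measurable_continuous_onI continuous_intros)
  show "sets (distr (lborel \<Otimes>\<^sub>M lborel) borel (\<lambda>(x,y). Complex x y)) = sets borel" by simp
  fix l u :: complex assume le: "\<And>b. b \<in> Basis \<Longrightarrow> l \<bullet> b \<le> u \<bullet> b"
  have le': "Re l \<le> Re u" "Im l \<le> Im u" using le[of 1] le[of \<i>] by (auto simp: Basis_complex_def)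
  have "(\<lambda>(x,y). Complex x y) -` box l u \<inter> space (lborel \<Otimes>\<^sub>M lborel) = {Re l<..<Re u} \<times> {Im l<..<Im u}"
    by (auto simp: box_def Basis_complex_def space_pair_measure)
  then have "emeasure (distr (lborel \<Otimes>\<^sub>M lborel) borel (\<lambda>(x,y). Complex x y)) (box l u)
     = emeasure (lborel \<Otimes>\<^sub>M lborel) ({Re l<..<Re u} \<times> {Im l<..<Im u})"
    using meas by (subst emeasure_distr) auto
  also have "\<dots> = ennreal (Re u - Re l) * ennreal (Im u - Im l)"
    using le' by (subst lborel.emeasure_pair_measure_Times) auto
  also have "\<dots> = (\<Prod>b\<in>Basis. (u - l) \<bullet> b)"
    using le' by (simp add: Basis_complex_def ennreal_mult)
  finally show "emeasure (distr (lborel \<Otimes>\<^sub>M lborel) borel (\<lambda>(x,y). Complex x y)) (box l u) = (\<Prod>b\<in>Basis. (u - l) \<bullet> b)" .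
qed

lemma distr_vec2_lborel: "distr lborel borel (\<lambda>x::real^2. Complex (vec_nth x 1) (vec_nth x 2)) = lborel"
proof (rule lborel_eqI[symmetric])
  have meas: "(\<lambda>x::real^2. Complex (vec_nth x 1) (vec_nth x 2)) \<in> borel_measurable lborel"
    by (auto simp: Complex_eq intro!: borel_measurable_continuous_onI continuous_intros)
  show "sets (distr lborel borel (\<lambda>x::real^2. Complex (vec_nth x 1) (vec_nth x 2))) = sets borel" by simp
  fix l u :: complex assume le: "\<And>b. b \<in> Basis \<Longrightarrow> l \<bullet> b \<le> u \<bullet> b"
  have le': "Re l \<le> Re u" "Im l \<le> Im u" using le[of 1] le[of \<i>] by (auto simp: Basis_complex_def)
  have eq: "(\<lambda>x::real^2. Complex (vec_nth x 1) (vec_nth x 2)) -` box l u = box (vector [Re l, Im l]) (vector [Re u, Im u])"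
    by (auto simp: box_def Basis_complex_def Basis_vec_def UNIV_2 inner_axis vector_2)
  have "emeasure (distr lborel borel (\<lambda>x::real^2. Complex (vec_nth x 1) (vec_nth x 2))) (box l u)
     = emeasure lborel (box (vector [Re l, Im l]) (vector [Re u, Im u]) :: (real^2) set)"
    using meas by (subst emeasure_distr) (auto simp: eq)
  also have "\<dots> = (\<Prod>b\<in>Basis. (u - l) \<bullet> b)"
    using le' by (subst emeasure_lborel_box)
      (auto simp: Basis_complex_def Basis_vec_def UNIV_2 inner_axis axis_eq_axis vector_2 inner_diff_left ennreal_mult mult.commute)
  finally show "emeasure (distr lborel borel (\<lambda>x::real^2. Complex (vec_nth x 1) (vec_nth x 2))) (box l u) = (\<Prod>b\<in>Basis. (u - l) \<bullet> b)" .
qed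

lemma borel_measurable_Complex: "(\<lambda>p. Complex (fst p) (snd p)) \<in> borel_measurable (borel :: (real\<times>real) measure)"
  by (auto simp: Complex_eq intro!: borel_measurable_continuous_onI continuous_intros)

lemma borel_measurable_vec2: "(\<lambda>x::real^2. Complex (vec_nth x 1) (vec_nth x 2)) \<in> borel_measurable borel"
  by (auto simp: Complex_eq intro!: borel_measurable_continuous_onI continuous_intros)

lemma nn_integral_complex_iterated:
  fixes f :: "complex \<Rightarrow> ennreal"
  assumes [measurable]: "f \<in> borel_measurable borel"
  shows "(\<integral>\<^sup>+z. f z \<partial>lborel) = (\<integral>\<^sup>+y. (\<integral>\<^sup>+x. f (Complex x y) \<partial>lborel) \<partial>lborel)"
proof -
  note [measurable] = borel_measurable_Complex
  have m: "(\<lambda>(x,y). Complex x y) \<in> borel_measurable (lborel \<Otimes>\<^sub>M lborel)"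
    by (simp add: lborel_prod case_prod_beta)
  have m2: "(\<lambda>(x,y). f (Complex x y)) \<in> borel_measurable (lborel \<Otimes>\<^sub>M lborel)"
    by (simp add: lborel_prod case_prod_beta)
  have "(\<integral>\<^sup>+z. f z \<partial>lborel) = (\<integral>\<^sup>+p. f (case p of (x,y) \<Rightarrow> Complex x y) \<partial>(lborel \<Otimes>\<^sub>M lborel))"
    by (subst distr_Complex_lborel[symmetric], subst nn_integral_distr[OF m]) auto
  also have "\<dots> = (\<integral>\<^sup>+y. (\<integral>\<^sup>+x. f (Complex x y) \<partial>lborel) \<partial>lborel)"
    using lborel_pair.nn_integral_snd[of "\<lambda>(x,y). f (Complex x y)"] m2 by (simp add: case_prod_unfold)
  finally show ?thesis .
qed

lemma
  fixes f :: "complex \<Rightarrow> 'a::{banach, second_countable_topology}"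
  assumes f: "integrable lborel f"
  shows integral_complex_iterated: "(\<integral>z. f z \<partial>lborel) = (\<integral>y. (\<integral>x. f (Complex x y) \<partial>lborel) \<partial>lborel)"
    and integral_complex_iterated': "(\<integral>z. f z \<partial>lborel) = (\<integral>x. (\<integral>y. f (Complex x y) \<partial>lborel) \<partial>lborel)"
    and integrable_complex_iterated': "integrable lborel (\<lambda>x. (\<integral>y. f (Complex x y) \<partial>lborel))"
proof -
  have m: "(\<lambda>(x,y). Complex x y) \<in> borel_measurable (lborel \<Otimes>\<^sub>M lborel)"
    using borel_measurable_Complex by (simp add: lborel_prod case_prod_beta)
  have [measurable]: "f \<in> borel_measurable borel" using f by auto
  have int: "integrable (lborel \<Otimes>\<^sub>M lborel) (\<lambda>(x,y). f (Complex x y))"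
    using f by (subst (asm) distr_Complex_lborel[symmetric], subst (asm) integrable_distr_eq[OF m])
       (auto simp: case_prod_unfold)
  have eq: "(\<integral>z. f z \<partial>lborel) = (\<integral>p. (\<lambda>(x,y). f (Complex x y)) p \<partial>(lborel \<Otimes>\<^sub>M lborel))"
    by (subst distr_Complex_lborel[symmetric], subst integral_distr[OF m]) (auto simp: case_prod_unfold)
  show "(\<integral>z. f z \<partial>lborel) = (\<integral>y. (\<integral>x. f (Complex x y) \<partial>lborel) \<partial>lborel)"
    using lborel_pair.integral_snd[OF int] eq by simp
  show "(\<integral>z. f z \<partial>lborel) = (\<integral>x. (\<integral>y. f (Complex x y) \<partial>lborel) \<partial>lborel)"
    using lborel_pair.integral_fst'[OF int] eq by simp
  show "integrable lborel (\<lambda>x. (\<integral>y. f (Complex x y) \<partial>lborel))"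
    using lborel_pair.integrable_fst'[OF int] by simp
qed

text \<open>
  The Jacobian determinant of a holomorphic map is the square of the modulus of its derivative. The
  general theorem is about \<open>real^2\<close>; the measure-preserving identification of \<open>real^2\<close> with the plane
  carries it over.
\<close>

lemma holomorphic_change_of_variables:
  fixes f g g' :: "complex \<Rightarrow> complex"
  assumes S: "S \<in> sets borel" and T: "g ` S \<in> sets borel"
    and der: "\<And>x. x \<in> S \<Longrightarrow> (g has_field_derivative g' x) (at x within S)"
    and inj: "inj_on g S"
    and gm: "set_borel_measurable borel S (\<lambda>x. of_real ((cmod (g' x))\<^sup>2) * f (g x))"
    and f: "set_integrable lborel (g ` S) f"
  shows "set_integrable lborel S (\<lambda>x. of_real ((cmod (g' x))\<^sup>2) * f (g x))"
    and "(LINT x:S|lborel. of_real ((cmod (g' x))\<^sup>2) * f (g x)) = (LINT x:g ` S|lborel. f x)"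
proof -
  define R where "R = (\<lambda>x::real^2. Complex (vec_nth x 1) (vec_nth x 2))"
  define V where "V = (\<lambda>z. vector [Re z, Im z] :: real^2)"
  have RV[simp]: "R (V z) = z" for z by (simp add: R_def V_def)
  have VR[simp]: "V (R x) = x" for x by (simp add: R_def V_def vec_eq_iff forall_2)
  have Rm[measurable]: "R \<in> borel_measurable borel" unfolding R_def by (rule borel_measurable_vec2)
  have linV: "bounded_linear V" 
    by (rule bounded_linear_intro[of _ 1]) (auto simp: V_def vec_eq_iff forall_2 norm_vec_def L2_set_def UNIV_2 cmod_def)
  have linR: "bounded_linear R" 
    by (rule bounded_linear_intro[of _ 1]) (auto simp: R_def complex_eq_iff norm_vec_def L2_set_def UNIV_2 cmod_def)
  have Vimg: "V ` A = R -` A" for A by (auto simp: image_iff) (metis VR)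
  have Vb: "V ` A \<in> sets borel" if "A \<in> sets borel" for A
    using measurable_sets[OF Rm that] by (simp add: Vimg)
  have trans: "(V \<circ> k \<circ> R) absolutely_integrable_on (V ` A) \<longleftrightarrow> set_integrable lborel A k"
     "set_integrable lborel A k \<Longrightarrow> integral (V ` A) (V \<circ> k \<circ> R) = V (LINT x:A|lborel. k x)"
    if A: "A \<in> sets borel" and k: "set_borel_measurable borel A k" for A k
  proof -
    have km: "(\<lambda>x. indicator A x *\<^sub>R k x) \<in> borel_measurable borel" using k by (simp add: set_borel_measurable_def)
    have Vm[measurable]: "V \<in> borel_measurable borel"
      using linV by (simp add: borel_measurable_continuous_onI linear_continuous_on)
    have ind: "indicator (V ` A) x *\<^sub>R (V \<circ> k \<circ> R) x = V (indicator A (R x) *\<^sub>R k (R x))" for x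
      using linear_scale[OF bounded_linear.linear[OF linV]] by (auto simp: indicator_def Vimg linear_0[OF bounded_linear.linear[OF linV]])
    have m: "(\<lambda>x. V (indicator A (R x) *\<^sub>R k (R x))) \<in> borel_measurable borel"
      using measurable_compose[OF measurable_compose[OF Rm km] Vm] by simp
    have "(V \<circ> k \<circ> R) absolutely_integrable_on (V ` A) \<longleftrightarrow> integrable lborel (\<lambda>x. V (indicator A (R x) *\<^sub>R k (R x)))"
      unfolding set_integrable_def ind by (subst integrable_completion) (use m in auto)
    also have "\<dots> \<longleftrightarrow> integrable lborel (\<lambda>x. indicator A (R x) *\<^sub>R k (R x))"
      using integrable_bounded_linear[OF linV] integrable_bounded_linear[OF linR, of lborel "\<lambda>x. V (indicator A (R x) *\<^sub>R k (R x))"] by auto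
    also have "\<dots> \<longleftrightarrow> set_integrable lborel A k"
      unfolding set_integrable_def by (subst distr_vec2_lborel[symmetric], fold R_def, subst integrable_distr_eq) (use km in auto)
    finally show *: "(V \<circ> k \<circ> R) absolutely_integrable_on (V ` A) \<longleftrightarrow> set_integrable lborel A k" .
    assume a: "set_integrable lborel A k"
    then have "(V \<circ> k \<circ> R) absolutely_integrable_on (V ` A)" using * by simp
    then have "integral (V ` A) (V \<circ> k \<circ> R) = (LINT x:V ` A|lebesgue. (V \<circ> k \<circ> R) x)"
      by (rule set_lebesgue_integral_eq_integral(2)[symmetric])
    also have "\<dots> = (LINT x|lborel. V (indicator A (R x) *\<^sub>R k (R x)))"
      unfolding set_lebesgue_integral_def ind by (subst integral_completion) (use m in auto)
    also have "\<dots> = V (LINT x|lborel. indicator A (R x) *\<^sub>R k (R x))"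
    proof (rule integral_bounded_linear[OF linV])
      show "integrable lborel (\<lambda>x. indicator A (R x) *\<^sub>R k (R x))"
        using a unfolding set_integrable_def by (subst (asm) distr_vec2_lborel[symmetric], fold R_def, subst (asm) integrable_distr_eq) (use km in auto)
    qed
    also have "(LINT x|lborel. indicator A (R x) *\<^sub>R k (R x)) = (LINT x:A|lborel. k x)"
      unfolding set_lebesgue_integral_def
      using integral_distr[of R lborel borel, OF _ km] distr_vec2_lborel[folded R_def] by simp
    finally show "integral (V ` A) (V \<circ> k \<circ> R) = V (LINT x:A|lborel. k x)" .
  qed
  define G where "G = V \<circ> g \<circ> R"
  define G' where "G' = (\<lambda>x h. V (g' (R x) * R h))"
  have GS: "G ` (V ` S) = V ` (g ` S)" by (auto simp: G_def image_iff)
  have injG: "inj_on G (V ` S)"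
    using inj by (auto simp: inj_on_def G_def) (metis RV)
  have derG: "(G has_derivative G' x) (at x within V ` S)" if "x \<in> V ` S" for x
  proof -
    obtain z where z: "z \<in> S" "x = V z" using \<open>x \<in> V ` S\<close> by blast
    have d: "(g has_derivative (*) (g' z)) (at (R x) within R ` V ` S)"
      using der[OF z(1)] z(2) by (simp add: has_field_derivative_def image_image)
    have dr: "(R has_derivative R) (at x within V ` S)"
      using linR by (rule bounded_linear_imp_has_derivative)
    have dv: "(V has_derivative V) (at (g (R x)))"
      using linV by (rule bounded_linear_imp_has_derivative)
    show ?thesis
      using diff_chain_within[OF diff_chain_within[OF dr d, unfolded o_def] has_derivative_at_withinI[OF dv], unfolded o_def]
      by (simp add: G_def G'_def z(2) o_def)
  qed
  have detG: "\<bar>det (matrix (G' x))\<bar> = (cmod (g' (R x)))\<^sup>2" for x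
  proof -
    have "det (matrix (G' x)) = Re (g' (R x)) * Re (g' (R x)) + Im (g' (R x)) * Im (g' (R x))"
      by (simp add: det_2 matrix_def G'_def V_def R_def axis_def)
    then show ?thesis by (simp add: cmod_power2 power2_eq_square[symmetric])
  qed
  have fm: "set_borel_measurable borel (g ` S) f"
    using f by (simp add: set_borel_measurable_def set_integrable_def integrable_iff_bounded)
  define k where "k = (\<lambda>x. of_real ((cmod (g' x))\<^sup>2) * f (g x))"
  have km: "set_borel_measurable borel S k" using gm by (simp add: k_def)
  have Vsc: "V (of_real r * z) = r *\<^sub>R V z" for r z
    using linear_scale[OF bounded_linear.linear[OF linV], of r z] by (simp add: scaleR_conv_of_real)
  have keq: "(\<lambda>x. \<bar>det (matrix (G' x))\<bar> *\<^sub>R (V \<circ> f \<circ> R) (G x)) = V \<circ> k \<circ> R"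
    unfolding detG k_def G_def o_def RV Vsc by (rule refl)
  have "(V \<circ> f \<circ> R) absolutely_integrable_on (G ` V ` S) \<and> integral (G ` V ` S) (V \<circ> f \<circ> R) = V (LINT x:g ` S|lborel. f x)"
    unfolding GS using trans[OF T fm] f by auto
  then have "(V \<circ> k \<circ> R) absolutely_integrable_on (V ` S) \<and> integral (V ` S) (V \<circ> k \<circ> R) = V (LINT x:g ` S|lborel. f x)"
    using has_absolute_integral_change_of_variables[OF _ derG injG, where f="V \<circ> f \<circ> R" and b = "V (LINT x:g ` S|lborel. f x)"] Vb[OF S] keq by auto
  then have "set_integrable lborel S k" "V (LINT x:S|lborel. k x) = V (LINT x:g ` S|lborel. f x)"
    using trans[OF S km] by auto
  then show "set_integrable lborel S (\<lambda>x. of_real ((cmod (g' x))\<^sup>2) * f (g x))"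
    and "(LINT x:S|lborel. of_real ((cmod (g' x))\<^sup>2) * f (g x)) = (LINT x:g ` S|lborel. f x)"
    unfolding k_def by (auto dest: arg_cong[where f=R])
qed

section \<open>Square-integrable functions\<close>

definition l2_sq :: "'a measure \<Rightarrow> ('a \<Rightarrow> complex) \<Rightarrow> real"
  where "l2_sq M f = (LINT x|M. (cmod (f x))\<^sup>2)"

lemma L2_square_integrable: "f \<in> L2 M \<Longrightarrow> integrable M (\<lambda>x. (cmod (f x))\<^sup>2)"
  by (simp add: L2_def)

lemma cnj_borel_measurable [measurable]: "cnj \<in> borel_measurable borel"
  by (intro borel_measurable_continuous_onI continuous_intros)

lemma l2_sq_nonneg [simp]: "l2_sq M f \<ge> 0"
  by (simp add: l2_sq_def)

lemma norm_add_sq_le: "(cmod (a + b))\<^sup>2 \<le> 2 * (cmod a)\<^sup>2 + 2 * (cmod b)\<^sup>2"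
proof -
  have "(cmod (a + b))\<^sup>2 \<le> (cmod a + cmod b)\<^sup>2" by (intro power_mono norm_triangle_ineq) auto
  also have "\<dots> \<le> 2 * (cmod a)\<^sup>2 + 2 * (cmod b)\<^sup>2"
    using sum_squares_bound[of "cmod a" "cmod b"] by (simp add: power2_sum)
  finally show ?thesis .
qed

lemma L2_add:
  assumes "f \<in> L2 M" "g \<in> L2 M"
  shows "(\<lambda>x. f x + g x) \<in> L2 M"
proof -
  have [measurable]: "f \<in> borel_measurable M" "g \<in> borel_measurable M" using assms by (auto simp: L2_def)
  have "integrable M (\<lambda>x. 2 * (cmod (f x))\<^sup>2 + 2 * (cmod (g x))\<^sup>2)"
    using assms by (auto simp: L2_def)
  then have "integrable M (\<lambda>x. (cmod (f x + g x))\<^sup>2)"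
    by (rule Bochner_Integration.integrable_bound) (use norm_add_sq_le in auto)
  then show ?thesis by (simp add: L2_def)
qed

lemma L2_scale: "f \<in> L2 M \<Longrightarrow> (\<lambda>x. c * f x) \<in> L2 M"
  by (auto simp: L2_def norm_mult power_mult_distrib)

lemma L2_diff:
  assumes "f \<in> L2 M" "g \<in> L2 M"
  shows "(\<lambda>x. f x - g x) \<in> L2 M"
  using L2_add[OF assms(1) L2_scale[OF assms(2), of "-1"]] by simp

lemma L2_zero: "(\<lambda>x. 0) \<in> L2 M"
  by (simp add: L2_def)

lemma L2_sum: "(\<And>i. i \<in> I \<Longrightarrow> f i \<in> L2 M) \<Longrightarrow> (\<lambda>x. \<Sum>i\<in>I. f i x) \<in> L2 M"
  by (induction I rule: infinite_finite_induct) (auto simp: L2_zero intro!: L2_add)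

lemma L2_inner_integrable:
  assumes "f \<in> L2 M" "g \<in> L2 M"
  shows "integrable M (\<lambda>x. f x * cnj (g x))"
proof -
  have [measurable]: "f \<in> borel_measurable M" "g \<in> borel_measurable M" using assms by (auto simp: L2_def)
  have "integrable M (\<lambda>x. (cmod (f x))\<^sup>2 + (cmod (g x))\<^sup>2)"
    using assms by (auto simp: L2_def)
  then show ?thesis
  proof (rule Bochner_Integration.integrable_bound, goal_cases)
    case 2
    have "cmod a * cmod b \<le> (cmod a)\<^sup>2 + (cmod b)\<^sup>2" for a b
      using sum_squares_bound[of "cmod a" "cmod b"]
      using mult_nonneg_nonneg[OF norm_ge_zero norm_ge_zero, of a b] by linarith
    then show ?case by (auto simp: norm_mult)
  qed auto
qed

lemma L2_mult_integrable:
  assumes "f \<in> L2 M" "g \<in> L2 M"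
  shows "integrable M (\<lambda>x. f x * g x)"
proof -
  have [measurable]: "g \<in> borel_measurable M" using assms by (simp add: L2_def)
  have "(\<lambda>x. cnj (g x)) \<in> borel_measurable M" by measurable
  then have "(\<lambda>x. cnj (g x)) \<in> L2 M" using assms by (simp add: L2_def)
  from L2_inner_integrable[OF assms(1) this] show ?thesis by simp
qed

lemma l2_inner_commute: "l2_inner M g f = cnj (l2_inner M f g)"
proof -
  have "(\<lambda>x. g x * cnj (f x)) = (\<lambda>x. cnj (f x * cnj (g x)))" by (simp add: mult.commute)
  then show ?thesis unfolding l2_inner_def by (simp only: Bochner_Integration.integral_cnj)
qed

lemma l2_inner_self: "l2_inner M f f = of_real (l2_sq M f)"
  unfolding l2_inner_def l2_sq_def integral_complex_of_real[symmetric] complex_norm_square[symmetric]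
  by simp

lemma l2_inner_lin_left:
  assumes "f \<in> L2 M" "g \<in> L2 M" "h \<in> L2 M"
  shows "l2_inner M (\<lambda>x. a * f x + b * g x) h = a * l2_inner M f h + b * l2_inner M g h"
proof -
  have "l2_inner M (\<lambda>x. a * f x + b * g x) h = (LINT x|M. a * (f x * cnj (h x)) + b * (g x * cnj (h x)))"
    unfolding l2_inner_def by (intro Bochner_Integration.integral_cong) (auto simp: algebra_simps)
  then show ?thesis
    using L2_inner_integrable[OF assms(1,3)] L2_inner_integrable[OF assms(2,3)]
    by (simp add: l2_inner_def)
qed

lemma l2_inner_diff_left:
  assumes "f \<in> L2 M" "g \<in> L2 M" "h \<in> L2 M"
  shows "l2_inner M (\<lambda>x. f x - g x) h = l2_inner M f h - l2_inner M g h"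
  using l2_inner_lin_left[OF assms, of 1 "-1"] by simp

lemma l2_inner_sum_left:
  assumes "\<And>i. i \<in> I \<Longrightarrow> f i \<in> L2 M" "h \<in> L2 M"
  shows "l2_inner M (\<lambda>x. \<Sum>i\<in>I. f i x) h = (\<Sum>i\<in>I. l2_inner M (f i) h)"
proof -
  have "l2_inner M (\<lambda>x. \<Sum>i\<in>I. f i x) h = (LINT x|M. (\<Sum>i\<in>I. f i x * cnj (h x)))"
    unfolding l2_inner_def by (simp add: sum_distrib_right)
  then show ?thesis
    using L2_inner_integrable[OF assms] by (subst (asm) Bochner_Integration.integral_sum) (auto simp: l2_inner_def)
qed

lemma l2_inner_scale_left: "l2_inner M (\<lambda>x. c * f x) h = c * l2_inner M f h"
  by (simp add: l2_inner_def mult.assoc)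

lemma l2_inner_cong:
  assumes "\<And>x. x \<in> space M \<Longrightarrow> f x = f' x" "\<And>x. x \<in> space M \<Longrightarrow> g x = g' x"
  shows "l2_inner M f g = l2_inner M f' g'"
  unfolding l2_inner_def by (intro Bochner_Integration.integral_cong) (auto simp: assms)

lemma L2_cong:
  assumes "\<And>x. x \<in> space M \<Longrightarrow> f x = f' x"
  shows "f \<in> L2 M \<longleftrightarrow> f' \<in> L2 M"
proof -
  have "integrable M (\<lambda>x. (cmod (f x))\<^sup>2) \<longleftrightarrow> integrable M (\<lambda>x. (cmod (f' x))\<^sup>2)"
    by (rule Bochner_Integration.integrable_cong) (auto simp: assms)
  moreover have "f \<in> borel_measurable M \<longleftrightarrow> f' \<in> borel_measurable M"
    by (rule measurable_cong) (auto simp: assms)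
  ultimately show ?thesis by (simp add: L2_def)
qed

lemma l2_sq_add:
  assumes "f \<in> L2 M" "g \<in> L2 M"
  shows "l2_sq M (\<lambda>x. f x + c * g x) = l2_sq M f + 2 * Re (cnj c * l2_inner M f g) + (cmod c)\<^sup>2 * l2_sq M g"
proof -
  have eq: "(cmod (a + c * b))\<^sup>2 = (cmod a)\<^sup>2 + 2 * Re (cnj c * (a * cnj b)) + (cmod c)\<^sup>2 * (cmod b)\<^sup>2" for a b
    unfolding cmod_power2 by (simp add: power2_eq_square algebra_simps)
  note [simp] = L2_square_integrable[OF assms(1)] L2_square_integrable[OF assms(2)] L2_inner_integrable[OF assms]
  have 1: "integrable M (\<lambda>x. Re (cnj c * (f x * cnj (g x))))"
    by (intro integrable_Re integrable_mult_right) simp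
  have "l2_sq M (\<lambda>x. f x + c * g x) = l2_sq M f + 2 * (LINT x|M. Re (cnj c * (f x * cnj (g x)))) + (cmod c)\<^sup>2 * l2_sq M g"
    unfolding l2_sq_def eq using 1 by (simp del: times_complex.sel complex_cnj_mult)
  also have "(LINT x|M. Re (cnj c * (f x * cnj (g x)))) = Re (cnj c * l2_inner M f g)"
    unfolding l2_inner_def by (subst integral_Re) (auto simp del: times_complex.sel complex_cnj_mult)
  finally show ?thesis .
qed

lemma l2_polarization:
  assumes "f \<in> L2 M" "g \<in> L2 M"
  shows "4 * l2_inner M f g =
    of_real (l2_sq M (\<lambda>x. f x + 1 * g x) - l2_sq M (\<lambda>x. f x + (-1) * g x))
    + \<i> * of_real (l2_sq M (\<lambda>x. f x + \<i> * g x) - l2_sq M (\<lambda>x. f x + (-\<i>) * g x))"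
  unfolding l2_sq_add[OF assms] by (simp add: complex_eq_iff)

lemma l2_sq_add_le:
  assumes "f \<in> L2 M" "g \<in> L2 M" "\<delta> > 0"
  shows "l2_sq M (\<lambda>x. f x + g x) \<le> (1 + \<delta>) * l2_sq M f + (1 + 1/\<delta>) * l2_sq M g"
proof -
  have "(cmod (a + b))\<^sup>2 \<le> (1 + \<delta>) * (cmod a)\<^sup>2 + (1 + 1/\<delta>) * (cmod b)\<^sup>2" for a b
  proof -
    have "(cmod (a + b))\<^sup>2 \<le> (cmod a + cmod b)\<^sup>2" by (intro power_mono norm_triangle_ineq) auto
    also have "\<dots> = (1 + \<delta>) * (cmod a)\<^sup>2 + (1 + 1/\<delta>) * (cmod b)\<^sup>2 - (sqrt \<delta> * cmod a - cmod b / sqrt \<delta>)\<^sup>2"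
    proof -
      have "(sqrt \<delta> * cmod a - cmod b / sqrt \<delta>)\<^sup>2 = \<delta> * (cmod a)\<^sup>2 + (cmod b)\<^sup>2 / \<delta> - 2 * cmod a * cmod b"
        using assms(3) by (simp add: power2_diff power_mult_distrib power_divide)
      then show ?thesis by (simp add: power2_sum algebra_simps)
    qed
    finally show ?thesis using zero_le_power2[of "sqrt \<delta> * cmod a - cmod b / sqrt \<delta>"] by linarith
  qed
  then have "l2_sq M (\<lambda>x. f x + g x) \<le> (LINT x|M. (1 + \<delta>) * (cmod (f x))\<^sup>2 + (1 + 1/\<delta>) * (cmod (g x))\<^sup>2)"
    unfolding l2_sq_def using assms L2_add[OF assms(1,2)]
    by (intro integral_mono) (auto intro!: L2_square_integrable Bochner_Integration.integrable_add integrable_mult_right)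
  also have "\<dots> = (1 + \<delta>) * l2_sq M f + (1 + 1/\<delta>) * l2_sq M g"
    unfolding l2_sq_def using assms by (simp add: L2_square_integrable)
  finally show ?thesis .
qed

text \<open>
  A form of the Cauchy-Schwarz inequality without square roots: a small \<open>\<delta>\<close> gives continuity of
  the inner product in its first argument.
\<close>

lemma l2_inner_norm_le:
  assumes "f \<in> L2 M" "g \<in> L2 M" "\<delta> > 0"
  shows "cmod (l2_inner M f g) \<le> \<delta> * l2_sq M g + l2_sq M f / \<delta>"
proof -
  have *: "cmod (a * cnj b) \<le> \<delta> * (cmod b)\<^sup>2 + (cmod a)\<^sup>2 / \<delta>" for a b
  proof -
    have "0 \<le> (sqrt \<delta> * cmod b - cmod a / sqrt \<delta>)\<^sup>2" by simp
    also have "\<dots> = \<delta> * (cmod b)\<^sup>2 + (cmod a)\<^sup>2 / \<delta> - 2 * (cmod a * cmod b)"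
      using assms(3) by (simp add: power2_diff power_mult_distrib power_divide)
    finally show ?thesis using mult_nonneg_nonneg[OF norm_ge_zero norm_ge_zero, of a b] 
      unfolding norm_mult complex_mod_cnj by linarith
  qed
  have "cmod (l2_inner M f g) \<le> (LINT x|M. cmod (f x * cnj (g x)))"
    unfolding l2_inner_def by (rule integral_norm_bound)
  also have "\<dots> \<le> (LINT x|M. \<delta> * (cmod (g x))\<^sup>2 + (cmod (f x))\<^sup>2 / \<delta>)"
    using L2_inner_integrable[OF assms(1,2)] L2_square_integrable[OF assms(1)] L2_square_integrable[OF assms(2)] *
    by (intro integral_mono) auto
  also have "\<dots> = \<delta> * l2_sq M g + l2_sq M f / \<delta>"
    using L2_square_integrable[OF assms(1)] L2_square_integrable[OF assms(2)] by (simp add: l2_sq_def)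
  finally show ?thesis .
qed

text \<open>
  A subsequence whose consecutive differences have squared norms below \<open>8\<^sup>-\<^sup>i\<close> converges almost
  everywhere, because the sum of \<open>2\<^sup>i\<close> times these squared differences is integrable; by Fatou's lemma its limit is also the limit in norm.
\<close>

lemma L2_complete:
  fixes f :: "nat \<Rightarrow> 'a \<Rightarrow> complex"
  assumes f: "\<And>k. f k \<in> L2 M"
    and Cauchy: "\<And>e. e > 0 \<Longrightarrow> \<exists>K. \<forall>m\<ge>K. \<forall>n\<ge>K. l2_sq M (\<lambda>x. f m x - f n x) < e"
  obtains g where "g \<in> L2 M" "(\<lambda>k. l2_sq M (\<lambda>x. f k x - g x)) \<longlonglongrightarrow> 0"
proof -
  have [measurable]: "f k \<in> borel_measurable M" for k using f by (auto simp: L2_def)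
  have "\<exists>K. \<forall>i. K i < K (Suc i) \<and> (\<forall>m\<ge>K i. \<forall>n\<ge>K i. l2_sq M (\<lambda>x. f m x - f n x) < (1/8)^i)"
  proof -
    have "\<exists>K::nat \<Rightarrow> nat. \<forall>i. (\<forall>m\<ge>K i. \<forall>n\<ge>K i. l2_sq M (\<lambda>x. f m x - f n x) < (1/8)^i) \<and> K i < K (Suc i)"
    proof (rule dependent_nat_choice)
      show "\<exists>k. \<forall>m\<ge>k. \<forall>n\<ge>k. l2_sq M (\<lambda>x. f m x - f n x) < (1/8)^0" using Cauchy[of "(1/8)^0"] by simp
    next
      fix k i :: nat
      obtain K where K: "\<forall>m\<ge>K. \<forall>n\<ge>K. l2_sq M (\<lambda>x. f m x - f n x) < (1/8)^(Suc i)"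
        using Cauchy[of "(1/8)^Suc i"] by auto
      show "\<exists>y. (\<forall>m\<ge>y. \<forall>n\<ge>y. l2_sq M (\<lambda>x. f m x - f n x) < (1/8)^Suc i) \<and> k < y"
        using K by (intro exI[of _ "max K (Suc k)"]) auto
    qed
    then show ?thesis by blast
  qed
  then obtain K where K1: "\<And>i. K i < K (Suc i)"
    and K2: "\<And>i m n. m \<ge> K i \<Longrightarrow> n \<ge> K i \<Longrightarrow> l2_sq M (\<lambda>x. f m x - f n x) < (1/8)^i" by blast
  have smK: "strict_mono K" using K1 by (simp add: strict_mono_Suc_iff)
  define \<Delta> where "\<Delta> i x = f (K (Suc i)) x - f (K i) x" for i x
  have \<Delta>L: "\<Delta> i \<in> L2 M" for i unfolding \<Delta>_def using f by (intro L2_diff)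
  have [measurable]: "\<Delta> i \<in> borel_measurable M" for i using \<Delta>L by (auto simp: L2_def)
  have \<Delta>b: "(\<integral>\<^sup>+x. ennreal (2^i * (cmod (\<Delta> i x))\<^sup>2) \<partial>M) \<le> ennreal ((1/4)^i)" for i
  proof -
    have "(\<integral>\<^sup>+x. ennreal (2^i * (cmod (\<Delta> i x))\<^sup>2) \<partial>M) = ennreal (2^i * l2_sq M (\<Delta> i))"
      unfolding l2_sq_def using L2_square_integrable[OF \<Delta>L, of i]
      by (subst nn_integral_eq_integral) auto
    also have "\<dots> \<le> ennreal (2^i * (1/8)^i)"
      using K2[where m="K (Suc i)" and n="K i" and i=i] K1[of i] unfolding \<Delta>_def[symmetric]
      by (intro ennreal_leI mult_left_mono) auto
    also have "2^i * (1/8)^i = (1/4::real)^i" by (simp flip: power_mult_distrib)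
    finally show ?thesis .
  qed
  have "(\<integral>\<^sup>+x. (\<Sum>i. ennreal (2^i * (cmod (\<Delta> i x))\<^sup>2)) \<partial>M) = (\<Sum>i. \<integral>\<^sup>+x. ennreal (2^i * (cmod (\<Delta> i x))\<^sup>2) \<partial>M)"
    by (rule nn_integral_suminf) auto
  also have "\<dots> \<le> (\<Sum>i. ennreal ((1/4)^i))" by (intro suminf_le \<Delta>b) auto
  also have "\<dots> < \<infinity>" by (subst suminf_ennreal2) auto
  finally have fin: "(\<integral>\<^sup>+x. (\<Sum>i. ennreal (2^i * (cmod (\<Delta> i x))\<^sup>2)) \<partial>M) \<noteq> \<infinity>" by simp
  have conv: "AE x in M. convergent (\<lambda>i. f (K i) x)"
  proof -
    have "AE x in M. (\<Sum>i. ennreal (2^i * (cmod (\<Delta> i x))\<^sup>2)) \<noteq> \<infinity>"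
      by (rule nn_integral_PInf_AE[OF _ fin]) measurable
    then show ?thesis
  proof (rule AE_mp, intro AE_I2 impI, goal_cases)
    case (1 x)
    then have "summable (\<lambda>i. 2^i * (cmod (\<Delta> i x))\<^sup>2)"
      by (intro summable_suminf_not_top) auto
    then have "Bseq (\<lambda>i. 2^i * (cmod (\<Delta> i x))\<^sup>2)"
      using summable_LIMSEQ_zero convergent_imp_Bseq convergentI by blast
    then obtain C where C: "C > 0" "\<And>i. 2^i * (cmod (\<Delta> i x))\<^sup>2 \<le> C" 
      by (auto simp: Bseq_def)
    have b: "cmod (\<Delta> i x) \<le> sqrt C * (sqrt (1/2))^i" for i
    proof -
      have "(cmod (\<Delta> i x))\<^sup>2 \<le> C * (1/2)^i" using C(2)[of i] by (simp add: field_simps)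
      then have "sqrt ((cmod (\<Delta> i x))\<^sup>2) \<le> sqrt (C * (1/2)^i)" by (rule real_sqrt_le_mono)
      then show ?thesis by (simp add: real_sqrt_mult real_sqrt_power)
    qed
    have "summable (\<lambda>i. sqrt C * (sqrt (1/2))^i)"
      by (intro summable_mult summable_geometric) (auto simp: real_sqrt_divide)
    then have "summable (\<lambda>i. \<Delta> i x)"
      by (rule summable_comparison_test'[where N=0]) (use b in auto)
    then have "convergent (\<lambda>n. \<Sum>i<n. \<Delta> i x)" by (simp add: summable_iff_convergent)
    moreover have "(\<Sum>i<n. \<Delta> i x) = f (K n) x - f (K 0) x" for n
      unfolding \<Delta>_def by (rule sum_lessThan_telescope)
    ultimately have "convergent (\<lambda>n. f (K n) x - f (K 0) x)" by simp
    from convergent_add[OF this convergent_const[of "f (K 0) x"]] show ?case by simp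
  qed
  qed
  define g where "g x = lim (\<lambda>i. f (K i) x)" for x
  have [measurable]: "g \<in> borel_measurable M" unfolding g_def by measurable
  have gl: "AE x in M. (\<lambda>i. f (K i) x) \<longlonglongrightarrow> g x"
    using conv by eventually_elim (simp add: g_def convergent_LIMSEQ_iff)
  have fatou: "(\<integral>\<^sup>+x. ennreal ((cmod (f m x - g x))\<^sup>2) \<partial>M) \<le> ennreal ((1/8)^i)" if "m \<ge> K i" for m i
  proof -
    have "(\<integral>\<^sup>+x. ennreal ((cmod (f m x - g x))\<^sup>2) \<partial>M) = (\<integral>\<^sup>+x. liminf (\<lambda>n. ennreal ((cmod (f m x - f (K n) x))\<^sup>2)) \<partial>M)"
    proof (rule nn_integral_cong_AE, use gl in eventually_elim)
      case (elim x)
      have "(\<lambda>n. ennreal ((cmod (f m x - f (K n) x))\<^sup>2)) \<longlonglongrightarrow> ennreal ((cmod (f m x - g x))\<^sup>2)"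
        by (intro tendsto_ennrealI tendsto_intros elim)
      then show ?case by (intro lim_imp_Liminf[symmetric]) auto
    qed
    also have "\<dots> \<le> liminf (\<lambda>n. \<integral>\<^sup>+x. ennreal ((cmod (f m x - f (K n) x))\<^sup>2) \<partial>M)"
      by (rule nn_integral_liminf) auto
    also have "\<dots> \<le> limsup (\<lambda>n. \<integral>\<^sup>+x. ennreal ((cmod (f m x - f (K n) x))\<^sup>2) \<partial>M)"
      by (rule Liminf_le_Limsup) auto
    also have "\<dots> \<le> ennreal ((1/8)^i)"
    proof (rule Limsup_bounded)
      have "(\<integral>\<^sup>+x. ennreal ((cmod (f m x - f (K n) x))\<^sup>2) \<partial>M) \<le> ennreal ((1/8)^i)" if n: "n \<ge> i" for n
      proof -
        have "(\<integral>\<^sup>+x. ennreal ((cmod (f m x - f (K n) x))\<^sup>2) \<partial>M) = ennreal (l2_sq M (\<lambda>x. f m x - f (K n) x))"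
          unfolding l2_sq_def using L2_square_integrable[OF L2_diff[OF f f], of m "K n"]
          by (subst nn_integral_eq_integral) auto
        also have "\<dots> \<le> ennreal ((1/8)^i)"
          using K2[of i m "K n"] \<open>m \<ge> K i\<close> n smK by (intro ennreal_leI) (simp add: strict_mono_less_eq)
        finally show ?thesis .
      qed
      then show "\<forall>\<^sub>F n in sequentially. (\<integral>\<^sup>+x. ennreal ((cmod (f m x - f (K n) x))\<^sup>2) \<partial>M) \<le> ennreal ((1/8)^i)"
        using eventually_sequentially by blast
    qed
    finally show ?thesis .
  qed
  have L: "(\<lambda>x. f m x - g x) \<in> L2 M" if "m \<ge> K i" for m i
    using fatou[OF that] unfolding L2_def integrable_iff_bounded
    by (auto intro: le_less_trans)
  have "(\<lambda>x. f (K 0) x - (f (K 0) x - g x)) \<in> L2 M"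
    by (rule L2_diff[OF f L[OF order_refl]])
  then have gL: "g \<in> L2 M" by simp
  have bd: "l2_sq M (\<lambda>x. f m x - g x) \<le> (1/8)^i" if "m \<ge> K i" for m i
    using fatou[OF that] L2_square_integrable[OF L[OF that]] unfolding l2_sq_def
    by (subst (asm) nn_integral_eq_integral) auto
  have "(\<lambda>k. l2_sq M (\<lambda>x. f k x - g x)) \<longlonglongrightarrow> 0"
  proof (rule LIMSEQ_I)
    fix r :: real assume "r > 0"
    then obtain i where i: "(1/8)^i < r" using real_arch_pow_inv[of r "1/8"] by auto
    show "\<exists>no. \<forall>n\<ge>no. norm (l2_sq M (\<lambda>x. f n x - g x) - 0) < r"
      using bd i by (intro exI[of _ "K i"]) (auto intro: le_less_trans)
  qed
  with gL show ?thesis by (rule that)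
qed

text \<open>
  The orthogonal projection of \<open>F\<close> onto the range of \<open>T\<close>. By the parallelogram law, a sequence
  \<open>f\<^sub>k\<close> for which the distance of \<open>T f\<^sub>k\<close> to \<open>F\<close> tends to its infimum is mapped to a Cauchy sequence,
  so it is itself Cauchy; its limit attains the infimum, and a minimiser leaves an orthogonal remainder.
\<close>

lemma isometry_projection:
  fixes T :: "('a \<Rightarrow> complex) \<Rightarrow> 'b \<Rightarrow> complex"
  assumes TL: "\<And>f. f \<in> L2 M \<Longrightarrow> T f \<in> L2 N"
    and lin: "\<And>f g a b z. f \<in> L2 M \<Longrightarrow> g \<in> L2 M \<Longrightarrow> z \<in> space N \<Longrightarrow>
                T (\<lambda>x. a * f x + b * g x) z = a * T f z + b * T g z"
    and iso: "\<And>f. f \<in> L2 M \<Longrightarrow> l2_sq N (T f) = l2_sq M f"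
    and F: "F \<in> L2 N"
  obtains f where "f \<in> L2 M" "\<And>g. g \<in> L2 M \<Longrightarrow> l2_inner N (\<lambda>z. F z - T f z) (T g) = 0"
proof -
  define D where "D f = l2_sq N (\<lambda>z. F z - T f z)" for f
  have Dl: "D (\<lambda>x. f x + c * g x) = l2_sq N (\<lambda>z. (F z - T f z) + (- c) * T g z)"
    if "f \<in> L2 M" "g \<in> L2 M" for f g c
    unfolding D_def l2_sq_def using lin[OF that, of _ 1 c]
    by (intro Bochner_Integration.integral_cong) (auto simp: algebra_simps)
  have Td: "l2_sq N (\<lambda>z. T f z - T g z) = l2_sq M (\<lambda>x. f x - g x)" if "f \<in> L2 M" "g \<in> L2 M" for f g
  proof -
    have "l2_sq N (\<lambda>z. T f z - T g z) = l2_sq N (T (\<lambda>x. f x - g x))"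
      unfolding l2_sq_def using lin[OF that, of _ 1 "-1"]
      by (intro Bochner_Integration.integral_cong) auto
    then show ?thesis using iso[OF L2_diff[OF that]] by simp
  qed
  define d where "d = Inf (D ` L2 M)"
  have bdd: "bdd_below (D ` L2 M)" by (intro bdd_belowI[of _ 0]) (auto simp: D_def)
  have dle: "d \<le> D f" if "f \<in> L2 M" for f
    unfolding d_def using bdd that by (intro cInf_lower) auto
  have ne: "D ` L2 M \<noteq> {}" using L2_zero by blast
  have "\<exists>f\<in>L2 M. D f < d + 1 / real (Suc k)" for k
    using cInf_lessD[OF ne, of "d + 1 / real (Suc k)"] unfolding d_def[symmetric] by fastforce
  then obtain f where f: "\<And>k. f k \<in> L2 M" and fd: "\<And>k. D (f k) < d + 1 / real (Suc k)" by metis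
  have par: "l2_sq M (\<lambda>x. f m x - f n x) \<le> 2 / real (Suc m) + 2 / real (Suc n)" for m n
  proof -
    define a where "a z = F z - T (f m) z" for z
    define b where "b z = F z - T (f n) z" for z
    have aL: "a \<in> L2 N" and bL: "b \<in> L2 N" unfolding a_def b_def using F TL f by (auto intro!: L2_diff)
    have mid: "(\<lambda>x. (1/2) * f m x + (1/2) * f n x) \<in> L2 M" 
      using L2_add[OF L2_scale[OF f[of m]] L2_scale[OF f[of n]]] .
    have half: "T (\<lambda>x. (1/2) * f m x + (1/2) * f n x) z = (1/2) * T (f m) z + (1/2) * T (f n) z"
      if "z \<in> space N" for z by (rule lin[OF f f that])
    have "D (\<lambda>x. (1/2) * f m x + (1/2) * f n x) = l2_sq N (\<lambda>z. (1/2) * (a z + 1 * b z))"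
      unfolding D_def l2_sq_def 
      by (intro Bochner_Integration.integral_cong refl arg_cong[where f="\<lambda>z. (cmod z)\<^sup>2"])
        (simp only: half, simp add: a_def b_def field_simps)
    also have "\<dots> = (1/4) * l2_sq N (\<lambda>z. a z + 1 * b z)"
      unfolding l2_sq_def by (simp add: norm_divide power_divide)
    finally have 1: "4 * d \<le> l2_sq N (\<lambda>z. a z + 1 * b z)" using dle[OF mid] by simp
    have "l2_sq M (\<lambda>x. f m x - f n x) = l2_sq N (\<lambda>z. T (f m) z - T (f n) z)" using Td[OF f f] by simp
    also have "\<dots> = l2_sq N (\<lambda>z. a z + (-1) * b z)"
      unfolding l2_sq_def a_def b_def
      by (intro Bochner_Integration.integral_cong refl) (simp add: norm_minus_commute)
    also have "\<dots> = 2 * l2_sq N a + 2 * l2_sq N b - l2_sq N (\<lambda>z. a z + 1 * b z)"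
      unfolding l2_sq_add[OF aL bL] by simp
    also have "\<dots> \<le> 2 * l2_sq N a + 2 * l2_sq N b - 4 * d" using 1 by simp
    also have "l2_sq N a = D (f m)" by (simp add: D_def a_def[abs_def])
    also have "l2_sq N b = D (f n)" by (simp add: D_def b_def[abs_def])
    finally show ?thesis using fd[of m] fd[of n] by simp
  qed
  obtain g where g: "g \<in> L2 M" and lim: "(\<lambda>k. l2_sq M (\<lambda>x. f k x - g x)) \<longlonglongrightarrow> 0"
  proof (rule L2_complete[of f M, OF f])
    fix e :: real assume "e > 0"
    then obtain K where K: "inverse (real (Suc K)) < e/4" using reals_Archimedean[of "e/4"] by auto
    have "l2_sq M (\<lambda>x. f m x - f n x) < e" if "m \<ge> K" "n \<ge> K" for m n
    proof -
      have "2 / real (Suc m) \<le> 2 / real (Suc K)" "2 / real (Suc n) \<le> 2 / real (Suc K)"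
        using that by (auto intro!: divide_left_mono)
      moreover have "2 / real (Suc K) < e/2" using K by (simp add: field_simps)
      ultimately show ?thesis using par[of m n] by linarith
    qed
    then show "\<exists>K. \<forall>m\<ge>K. \<forall>n\<ge>K. l2_sq M (\<lambda>x. f m x - f n x) < e" by blast
  qed
  have Dg: "D g = d"
  proof -
    have up: "D g \<le> (1 + \<delta>) * d" if "\<delta> > 0" for \<delta>
    proof (rule LIMSEQ_le_const)
      show "(\<lambda>k. (1 + \<delta>) * (d + 1 / real (Suc k)) + (1 + 1/\<delta>) * l2_sq M (\<lambda>x. f k x - g x)) \<longlonglongrightarrow> (1 + \<delta>) * d"
        using tendsto_add[OF tendsto_mult_left[OF tendsto_add[OF tendsto_const LIMSEQ_inverse_real_of_nat], of "1+\<delta>" d] tendsto_mult_left[OF lim, of "1 + 1/\<delta>"]]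
        by (simp add: inverse_eq_divide)
      have "D g \<le> (1 + \<delta>) * (d + 1 / real (Suc k)) + (1 + 1/\<delta>) * l2_sq M (\<lambda>x. f k x - g x)" for k
      proof -
        have "D g = l2_sq N (\<lambda>z. (F z - T (f k) z) + (T (f k) z - T g z))" by (simp add: D_def)
        also have "\<dots> \<le> (1 + \<delta>) * l2_sq N (\<lambda>z. F z - T (f k) z) + (1 + 1/\<delta>) * l2_sq N (\<lambda>z. T (f k) z - T g z)"
          using F TL f g \<open>\<delta> > 0\<close> by (intro l2_sq_add_le L2_diff) auto
        also have "l2_sq N (\<lambda>z. F z - T (f k) z) = D (f k)" by (simp add: D_def)
        also have "l2_sq N (\<lambda>z. T (f k) z - T g z) = l2_sq M (\<lambda>x. f k x - g x)" by (rule Td[OF f g])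
        finally have 1: "D g \<le> (1 + \<delta>) * D (f k) + (1 + 1/\<delta>) * l2_sq M (\<lambda>x. f k x - g x)" .
        have "(1 + \<delta>) * D (f k) \<le> (1 + \<delta>) * (d + 1 / real (Suc k))"
          using fd[of k] \<open>\<delta> > 0\<close> by (intro mult_left_mono) auto
        with 1 show ?thesis by linarith
      qed
      then show "\<exists>N. \<forall>n\<ge>N. D g \<le> (1 + \<delta>) * (d + 1 / real (Suc n)) + (1 + 1/\<delta>) * l2_sq M (\<lambda>x. f n x - g x)" by blast
    qed
    have "d \<ge> 0" using ne unfolding d_def by (intro cInf_greatest) (auto simp: D_def)
    have "D g \<le> d + e" if "e > 0" for e
    proof -
      have "D g \<le> (1 + e / (d + 1)) * d" using up[of "e/(d+1)"] \<open>d \<ge> 0\<close> that by simp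
      also have "\<dots> \<le> d + e" using \<open>d \<ge> 0\<close> that by (simp add: field_simps)
      finally show ?thesis .
    qed
    then have "D g \<le> d" by (rule field_le_epsilon)
    with dle[OF g] show ?thesis by simp
  qed
  have "l2_inner N (\<lambda>z. F z - T g z) (T h) = 0" if h: "h \<in> L2 M" for h
  proof (rule ccontr)
    define I where "I = l2_inner N (\<lambda>z. F z - T g z) (T h)"
    define C where "C = l2_sq N (T h)"
    assume "l2_inner N (\<lambda>z. F z - T g z) (T h) \<noteq> 0"
    then have I0: "(cmod I)\<^sup>2 > 0" by (simp add: I_def)
    have C0: "C \<ge> 0" by (simp add: C_def)
    \<comment> \<open>A step small enough that the linear gain beats the quadratic loss \<open>t\<^sup>2 C\<close>.\<close>
    define t where "t = 1 / (C + 1)"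
    have t: "t > 0" "t * C < 1" using C0 by (auto simp: t_def)
    define c where "c = of_real t * I"
    have hc: "(\<lambda>x. g x + c * h x) \<in> L2 M" using L2_add[OF g L2_scale[OF h]] .
    have "d \<le> D (\<lambda>x. g x + c * h x)" by (rule dle[OF hc])
    also have "\<dots> = l2_sq N (\<lambda>z. F z - T g z) + 2 * Re (cnj (-c) * I) + (cmod (-c))\<^sup>2 * C"
      unfolding Dl[OF g h] I_def C_def using F TL g h by (intro l2_sq_add L2_diff) auto
    also have "l2_sq N (\<lambda>z. F z - T g z) = d" using Dg by (simp add: D_def)
    also have "Re (cnj (-c) * I) = - t * (cmod I)\<^sup>2"
      unfolding c_def cmod_power2 by (simp add: power2_eq_square algebra_simps)
    also have "(cmod (-c))\<^sup>2 = t\<^sup>2 * (cmod I)\<^sup>2" by (simp add: c_def norm_mult power_mult_distrib)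
    finally have "0 \<le> t * (cmod I)\<^sup>2 * (t * C - 2)" by (simp add: power2_eq_square algebra_simps)
    moreover have "t * (cmod I)\<^sup>2 * (t * C - 2) < 0" using t I0 by (intro mult_pos_neg) auto
    ultimately show False by simp
  qed
  with g show ?thesis by (rule that)
qed

section \<open>Plancherel's theorem\<close>

lemma lborel_shift:
  fixes f :: "real \<Rightarrow> 'a::{banach, second_countable_topology}"
  shows lborel_integrable_shift: "integrable lborel f \<Longrightarrow> integrable lborel (\<lambda>u. f (u + v))"
    and lborel_integral_shift: "(LINT u|lborel. f (u + v)) = (LINT u|lborel. f u)"
  using lborel_integrable_real_affine[of f 1 v] lborel_integral_real_affine[of 1 f v]
  by (simp_all add: add.commute)

text \<open>
  For the indicator of an open set of finite measure, the part lost by a small translation tends to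
  zero by dominated convergence, and as much is gained as is lost. Sets of finite
  measure are approximated by open sets from outside, integrable functions by simple ones.
\<close>

lemma L1_translation_continuous:
  fixes f :: "real \<Rightarrow> real"
  assumes "integrable lborel f" and v: "v \<longlonglongrightarrow> (0::real)"
  shows "(\<lambda>n. LINT u|lborel. \<bar>f (u + v n) - f u\<bar>) \<longlonglongrightarrow> 0"
  using assms(1)
proof (induction rule: integrable_induct)
  case (base A c)
  then have A: "A \<in> sets borel" "emeasure lborel A < \<infinity>" by auto
  \<comment> \<open>Pointwise, only losses matter: a point of an open set stays in it under small translations.\<close>
  have open_case: "(\<lambda>n. LINT u|lborel. \<bar>indicator T (u + v n) - indicator T u\<bar>) \<longlonglongrightarrow> (0::real)"
    if T: "open T" "emeasure lborel T < \<infinity>" for T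
  proof -
    have iT: "integrable lborel (indicator T :: real \<Rightarrow> real)" using T by (simp add: integrable_real_indicator)
    note iTs = lborel_integrable_shift[OF iT]
    have eq: "(LINT u|lborel. \<bar>indicator T (u + v n) - indicator T u\<bar>) =
        2 * (LINT u|lborel. max 0 (indicator T u - indicator T (u + v n)) :: real)" for n
    proof -
      have "(LINT u|lborel. \<bar>indicator T (u + v n) - indicator T u\<bar>) =
        (LINT u|lborel. 2 * max 0 (indicator T u - indicator T (u + v n)) + (indicator T (u + v n) - indicator T u :: real))"
        by (intro Bochner_Integration.integral_cong) (auto simp: indicator_def)
      also have "\<dots> = 2 * (LINT u|lborel. max 0 (indicator T u - indicator T (u + v n)) :: real)"
        using iT iTs[of "v n"] lborel_integral_shift[of "indicator T :: real \<Rightarrow> real" "v n"]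
        by (subst Bochner_Integration.integral_add) (auto intro!: integrable_max)
      finally show ?thesis .
    qed
    have "(\<lambda>n. LINT u|lborel. max 0 (indicator T u - indicator T (u + v n)) :: real) \<longlonglongrightarrow> (LINT (u::real)|lborel. (0::real))"
    proof (rule integral_dominated_convergence[where w="indicator T :: real \<Rightarrow> real"])
      show "AE u in lborel. (\<lambda>n. max 0 (indicator T u - indicator T (u + v n)) :: real) \<longlonglongrightarrow> 0"
      proof (intro AE_I2)
        fix u :: real
        show "(\<lambda>n. max 0 (indicator T u - indicator T (u + v n)) :: real) \<longlonglongrightarrow> 0"
        proof (cases "u \<in> T")
          case True
          have "(\<lambda>n. u + v n) \<longlonglongrightarrow> u + 0" by (intro tendsto_intros v)
          then have "\<forall>\<^sub>F n in sequentially. u + v n \<in> T"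
            using T(1) True by (simp add: topological_tendstoD)
          then show ?thesis
            by (intro tendsto_eventually) (auto elim!: eventually_mono simp: True)
        qed (auto simp: indicator_def)
      qed
      show "(\<lambda>u. max 0 (indicator T u - indicator T (u + v n)) :: real) \<in> borel_measurable lborel" for n
        using iT iTs[of "v n"] by (intro borel_measurable_max borel_measurable_diff) auto
      show "AE u in lborel. norm (max 0 (indicator T u - indicator T (u + v n)) :: real) \<le> indicator T u" for n
        by (auto simp: indicator_def)
    qed (use iT in auto)
    then show ?thesis unfolding eq using tendsto_mult_left[of _ 0 sequentially 2] by fastforce
  qed
  have ind: "(\<lambda>n. LINT u|lborel. \<bar>indicator A (u + v n) - indicator A u\<bar>) \<longlonglongrightarrow> (0::real)"
  proof (rule LIMSEQ_I)
    fix r :: real assume r: "r > 0"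
    obtain T where T: "open T" "A \<subseteq> T" "T - A \<in> lmeasurable" "emeasure lebesgue (T - A) < ennreal (r/4)"
      using sets_lebesgue_outer_open[of A "r/4"] A r by auto
    have TA: "T - A \<in> sets borel" using T A by auto
    then have TAm: "emeasure lborel (T - A) < ennreal (r/4)" using T(4) by simp
    have "emeasure lborel T = emeasure lborel A + emeasure lborel (T - A)"
      using T A by (subst plus_emeasure) (auto intro!: arg_cong[where f="emeasure lborel"])
    then have Tfin: "emeasure lborel T < \<infinity>" using A TAm by (simp add: less_top[symmetric]) (metis ennreal_neq_top infinity_ennreal_def leD less_imp_le neq_top_trans)
    have iT: "integrable lborel (indicator T :: real \<Rightarrow> real)" using T Tfin by (simp add: integrable_real_indicator)
    have iA: "integrable lborel (indicator A :: real \<Rightarrow> real)" using A by (simp add: integrable_real_indicator)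
    have iTA: "integrable lborel (indicator (T - A) :: real \<Rightarrow> real)" using TA TAm
      by (intro integrable_real_indicator) (auto intro: less_trans)
    have mTA: "(LINT u|lborel. indicator (T - A) u :: real) < r/4"
    proof -
      have "(LINT u|lborel. indicator (T - A) u :: real) = measure lborel (T - A)" using TA by simp
      also have "\<dots> < r/4" using TAm r unfolding measure_def by (subst enn2real_less_iff) (auto intro: less_trans)
      finally show ?thesis .
    qed
    obtain N where N: "\<And>n. n \<ge> N \<Longrightarrow> norm ((LINT u|lborel. \<bar>indicator T (u + v n) - indicator T u\<bar>) - (0::real)) < r/4"
      using LIMSEQ_D[OF open_case[OF T(1) Tfin], of "r/4"] r by auto
    show "\<exists>no. \<forall>n\<ge>no. norm ((LINT u|lborel. \<bar>indicator A (u + v n) - indicator A u\<bar>) - (0::real)) < r"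
    proof (intro exI allI impI)
      fix n assume n: "n \<ge> N"
      note iTs = lborel_integrable_shift[OF iT, of "v n"] and iAs = lborel_integrable_shift[OF iA, of "v n"]
        and iTAs = lborel_integrable_shift[OF iTA, of "v n"]
      have "(LINT u|lborel. \<bar>indicator A (u + v n) - indicator A u :: real\<bar>) \<le>
        (LINT u|lborel. \<bar>indicator T (u + v n) - indicator T u\<bar> + (indicator (T - A) (u + v n) + indicator (T - A) u :: real))"
      proof (intro integral_mono integrable_abs Bochner_Integration.integrable_diff Bochner_Integration.integrable_add iAs iA iT iTs iTA iTAs)
        fix u show "\<bar>indicator A (u + v n) - indicator A u :: real\<bar> \<le> \<bar>indicator T (u + v n) - indicator T u\<bar> + (indicator (T - A) (u + v n) + indicator (T - A) u)"
          using T(2) by (auto simp: indicator_def)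
      qed
      also have "\<dots> = (LINT u|lborel. \<bar>indicator T (u + v n) - indicator T u\<bar>) + ((LINT u|lborel. indicator (T - A) u) + (LINT u|lborel. indicator (T - A) u :: real))"
        using iT iTs iTA iTAs lborel_integral_shift[of "indicator (T - A) :: real \<Rightarrow> real" "v n"]
        by (simp del: Bochner_Integration.integral_indicator)
      also have "\<dots> < r" using N[OF n] mTA r by (simp del: Bochner_Integration.integral_indicator)
      finally show "norm ((LINT u|lborel. \<bar>indicator A (u + v n) - indicator A u\<bar>) - (0::real)) < r" by simp
    qed
  qed
  have "(LINT u|lborel. \<bar>indicator A (u + v n) *\<^sub>R c - indicator A u *\<^sub>R c\<bar>) = \<bar>c\<bar> * (LINT u|lborel. \<bar>indicator A (u + v n) - indicator A u\<bar>)" for n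
  proof -
    have "\<bar>a *\<^sub>R c - b *\<^sub>R c\<bar> = \<bar>c\<bar> * \<bar>a - b\<bar>" for a b :: real
      by (simp add: abs_mult[symmetric] algebra_simps)
    then show ?thesis by simp
  qed
  with tendsto_mult_left[OF ind, of "\<bar>c\<bar>"] show ?case by simp
next
  case (add f g)
  show ?case
  proof (rule tendsto_sandwich[OF _ _ tendsto_const])
    show "(\<lambda>n. (LINT u|lborel. \<bar>f (u + v n) - f u\<bar>) + (LINT u|lborel. \<bar>g (u + v n) - g u\<bar>)) \<longlonglongrightarrow> 0"
      using tendsto_add[OF add.IH] by simp
    show "\<forall>\<^sub>F n in sequentially. (LINT u|lborel. \<bar>(f (u + v n) + g (u + v n)) - (f u + g u)\<bar>)
        \<le> (LINT u|lborel. \<bar>f (u + v n) - f u\<bar>) + (LINT u|lborel. \<bar>g (u + v n) - g u\<bar>)"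
    proof (intro always_eventually allI)
      fix n
      have "(LINT u|lborel. \<bar>(f (u + v n) + g (u + v n)) - (f u + g u)\<bar>)
        \<le> (LINT u|lborel. \<bar>f (u + v n) - f u\<bar> + \<bar>g (u + v n) - g u\<bar>)"
        using add.hyps lborel_integrable_shift[OF add.hyps(1), of "v n"] lborel_integrable_shift[OF add.hyps(2), of "v n"]
        by (intro integral_mono) auto
      then show "(LINT u|lborel. \<bar>(f (u + v n) + g (u + v n)) - (f u + g u)\<bar>)
        \<le> (LINT u|lborel. \<bar>f (u + v n) - f u\<bar>) + (LINT u|lborel. \<bar>g (u + v n) - g u\<bar>)"
        using add.hyps lborel_integrable_shift[OF add.hyps(1), of "v n"] lborel_integrable_shift[OF add.hyps(2), of "v n"]
        by simp
    qed
  qed (auto intro!: always_eventually)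
next
  case (lim f s)
  have s1: "(\<lambda>i. LINT u|lborel. \<bar>s i u - f u\<bar>) \<longlonglongrightarrow> (LINT (u::real)|lborel. \<bar>0::real\<bar>)"
  proof (rule integral_dominated_convergence[where w="\<lambda>u. 3 * \<bar>f u\<bar>"])
    show "AE u in lborel. (\<lambda>i. \<bar>s i u - f u\<bar>) \<longlonglongrightarrow> \<bar>0\<bar>"
      using lim.hyps(2) by (intro AE_I2 tendsto_rabs) (simp add: LIM_zero)
    show "AE u in lborel. norm \<bar>s i u - f u\<bar> \<le> 3 * \<bar>f u\<bar>" for i
    proof (intro AE_I2)
      fix u :: real
      show "norm \<bar>s i u - f u\<bar> \<le> 3 * \<bar>f u\<bar>"
        using lim.hyps(3)[of u i] by simp
    qed
  qed (use lim.hyps in auto)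
  show ?case
  proof (rule LIMSEQ_I)
    fix r :: real assume r: "r > 0"
    obtain i where i: "(LINT u|lborel. \<bar>s i u - f u\<bar>) < r/3"
      using LIMSEQ_D[OF s1, of "r/3"] r by auto
    obtain N where N: "\<And>n. n \<ge> N \<Longrightarrow> (LINT u|lborel. \<bar>s i (u + v n) - s i u\<bar>) < r/3"
      using LIMSEQ_D[OF lim.IH[of i], of "r/3"] r by auto
    show "\<exists>no. \<forall>n\<ge>no. norm ((LINT u|lborel. \<bar>f (u + v n) - f u\<bar>) - 0) < r"
    proof (intro exI allI impI)
      fix n assume n: "n \<ge> N"
      note fs = lborel_integrable_shift[OF lim.hyps(4), of "v n"] and ss = lborel_integrable_shift[OF lim.hyps(1), of i "v n"]
      have e: "(LINT u|lborel. \<bar>s i (u + v n) - f (u + v n)\<bar>) = (LINT u|lborel. \<bar>s i u - f u\<bar>)"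
        by (rule lborel_integral_shift[of "\<lambda>u. \<bar>s i u - f u\<bar>"])
      have "(LINT u|lborel. \<bar>f (u + v n) - f u\<bar>) \<le>
        (LINT u|lborel. \<bar>s i (u + v n) - s i u\<bar> + (\<bar>s i (u + v n) - f (u + v n)\<bar> + \<bar>s i u - f u\<bar>))"
        using fs ss lim.hyps(1)[of i] lim.hyps(4)
        by (intro integral_mono integrable_abs Bochner_Integration.integrable_diff Bochner_Integration.integrable_add) auto
      also have "\<dots> = (LINT u|lborel. \<bar>s i (u + v n) - s i u\<bar>) + ((LINT u|lborel. \<bar>s i (u + v n) - f (u + v n)\<bar>) + (LINT u|lborel. \<bar>s i u - f u\<bar>))"
        using fs ss lim.hyps(1)[of i] lim.hyps(4) by simp
      also have "\<dots> < r" unfolding e using i N[OF n] by simp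
      finally show "norm ((LINT u|lborel. \<bar>f (u + v n) - f u\<bar>) - 0) < r" by simp
    qed
  qed
qed

text \<open>
  This turns continuity of translation for the integrable function \<open>h\<^sup>2\<close> into continuity in
  square mean for \<open>h \<ge> 0\<close>.
\<close>

lemma nonneg_diff_sq_le: "a \<ge> 0 \<Longrightarrow> b \<ge> 0 \<Longrightarrow> (a - b)\<^sup>2 \<le> \<bar>a\<^sup>2 - b\<^sup>2\<bar>" for a b :: real
proof -
  assume "a \<ge> 0" "b \<ge> 0"
  have "(a - b)\<^sup>2 = \<bar>a - b\<bar> * \<bar>a - b\<bar>" by (simp add: power2_eq_square)
  also have "\<dots> \<le> \<bar>a - b\<bar> * \<bar>a + b\<bar>" using \<open>a \<ge> 0\<close> \<open>b \<ge> 0\<close> by (intro mult_left_mono) auto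
  also have "\<dots> = \<bar>a\<^sup>2 - b\<^sup>2\<bar>" by (simp add: abs_mult[symmetric] power2_eq_square algebra_simps)
  finally show ?thesis .
qed

lemma L2_translation_continuous:
  fixes h :: "real \<Rightarrow> complex"
  assumes h: "h \<in> L2 lborel" and v: "v \<longlonglongrightarrow> (0::real)"
  shows "(\<lambda>n. l2_sq lborel (\<lambda>u. h (u + v n) - h u)) \<longlonglongrightarrow> 0"
proof -
  have [measurable]: "h \<in> borel_measurable borel" using h by (simp add: L2_def)
  \<comment> \<open>The positive and negative parts of the real and imaginary parts.\<close>
  define p where "p j z = (if j = 0 then max 0 (Re z) else if j = 1 then max 0 (- Re z) else if j = 2 then max 0 (Im z) else max 0 (- Im z))"
    for j :: nat and z
  have p0: "p j z \<ge> 0" and pn: "(p j z)\<^sup>2 \<le> (cmod z)\<^sup>2" for j z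
    unfolding p_def cmod_power2 by (auto simp: max_def)
  have pm: "(\<lambda>u. p j (h u)) \<in> borel_measurable borel" for j unfolding p_def by (cases "j = 0"; cases "j = 1"; cases "j = 2") auto
  have pint: "integrable lborel (\<lambda>u. (p j (h u))\<^sup>2)" for j
    by (rule Bochner_Integration.integrable_bound[OF L2_square_integrable[OF h]]) (use pn pm in \<open>auto intro!: borel_measurable_power\<close>)
  have le: "(cmod (a - b))\<^sup>2 \<le> 2 * (\<Sum>j<4. \<bar>(p j a)\<^sup>2 - (p j b)\<^sup>2\<bar>)" for a b
  proof -
    have pc: "Re z = p 0 z - p 1 z" "Im z = p 2 z - p 3 z" for z by (auto simp: p_def)
    have sq: "(x - y - (z - w))\<^sup>2 \<le> 2 * (x - z)\<^sup>2 + 2 * (y - w)\<^sup>2" for x y z w :: real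
      using zero_le_power2[of "(x - z) + (y - w)"] by (simp add: power2_eq_square algebra_simps)
    have "(cmod (a - b))\<^sup>2 \<le> 2 * (\<Sum>j<4. (p j a - p j b)\<^sup>2)"
      using sq[of "p 0 a" "p 1 a" "p 0 b" "p 1 b"] sq[of "p 2 a" "p 3 a" "p 2 b" "p 3 b"]
      unfolding cmod_power2 minus_complex.sel pc[of a] pc[of b] by (simp add: eval_nat_numeral)
    also have "\<dots> \<le> 2 * (\<Sum>j<4. \<bar>(p j a)\<^sup>2 - (p j b)\<^sup>2\<bar>)"
      by (intro mult_left_mono sum_mono nonneg_diff_sq_le p0) auto
    finally show ?thesis .
  qed
  have pi2: "integrable lborel (\<lambda>u. \<bar>(p j (h (u + w)))\<^sup>2 - (p j (h u))\<^sup>2\<bar>)" for j w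
    using pint[of j] lborel_integrable_shift[OF pint[of j], of w] by auto
  have [measurable]: "(\<lambda>u. h (u + w)) \<in> borel_measurable borel" for w by measurable
  show ?thesis
  proof (rule tendsto_sandwich[OF _ _ tendsto_const])
    show "(\<lambda>n. 2 * (\<Sum>j<4. LINT u|lborel. \<bar>(p j (h (u + v n)))\<^sup>2 - (p j (h u))\<^sup>2\<bar>)) \<longlonglongrightarrow> 0"
      by (intro tendsto_mult_right_zero tendsto_null_sum L1_translation_continuous pint v)
    have "l2_sq lborel (\<lambda>u. h (u + w) - h u) \<le> 2 * (\<Sum>j<4. LINT u|lborel. \<bar>(p j (h (u + w)))\<^sup>2 - (p j (h u))\<^sup>2\<bar>)" for w
    proof -
      have "l2_sq lborel (\<lambda>u. h (u + w) - h u) \<le> (LINT u|lborel. 2 * (\<Sum>j<4. \<bar>(p j (h (u + w)))\<^sup>2 - (p j (h u))\<^sup>2\<bar>))"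
        unfolding l2_sq_def
      proof (rule integral_mono)
        have "(\<lambda>u. h (u + w)) \<in> L2 lborel"
          using lborel_integrable_shift[OF L2_square_integrable[OF h]] by (simp add: L2_def)
        from L2_square_integrable[OF L2_diff[OF this h]]
        show "integrable lborel (\<lambda>x. (cmod (h (x + w) - h x))\<^sup>2)" .
      qed (use pi2 le in auto)
      also have "\<dots> = 2 * (\<Sum>j<4. LINT u|lborel. \<bar>(p j (h (u + w)))\<^sup>2 - (p j (h u))\<^sup>2\<bar>)"
        using pi2 by (simp add: Bochner_Integration.integral_sum)
      finally show ?thesis .
    qed
    then show "\<forall>\<^sub>F n in sequentially. l2_sq lborel (\<lambda>u. h (u + v n) - h u) \<le> 2 * (\<Sum>j<4. LINT u|lborel. \<bar>(p j (h (u + v n)))\<^sup>2 - (p j (h u))\<^sup>2\<bar>)"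
      by auto
  qed auto
qed

lemma L2_shift: "h \<in> L2 lborel \<Longrightarrow> (\<lambda>u. h (u + w)) \<in> L2 lborel" for h :: "real \<Rightarrow> complex"
  using lborel_integrable_shift[of "\<lambda>u. (cmod (h u))\<^sup>2" w] by (auto simp: L2_def)

lemma autocorrelation_continuous:
  fixes h :: "real \<Rightarrow> complex"
  assumes h: "h \<in> L2 lborel" and v: "v \<longlonglongrightarrow> (0::real)"
  shows "(\<lambda>n. LINT u|lborel. h (u + v n) * cnj (h u)) \<longlonglongrightarrow> of_real (l2_sq lborel h)"
proof -
  have eq: "(LINT u|lborel. h (u + v n) * cnj (h u)) - of_real (l2_sq lborel h) = l2_inner lborel (\<lambda>u. h (u + v n) - h u) h" for n
    unfolding l2_inner_diff_left[OF L2_shift[OF h] h h] by (simp add: l2_inner_self) (simp add: l2_inner_def)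
  have "(\<lambda>n. l2_inner lborel (\<lambda>u. h (u + v n) - h u) h) \<longlonglongrightarrow> 0"
  proof (rule LIMSEQ_I)
    fix r :: real assume r: "r > 0"
    \<comment> \<open>Makes the first term of the bound smaller than \<open>r / 2\<close>; the added \<open>1\<close> covers \<open>h = 0\<close>.\<close>
    define \<delta> where "\<delta> = r / (2 * (l2_sq lborel h + 1))"
    have s0: "l2_sq lborel h \<ge> 0" by simp
    have \<delta>0: "\<delta> > 0" unfolding \<delta>_def using r s0 by (intro divide_pos_pos mult_pos_pos) linarith+
    have "\<delta> * l2_sq lborel h < \<delta> * (l2_sq lborel h + 1)" using \<delta>0 by simp
    also have "\<dots> = r/2" using s0 unfolding \<delta>_def by (simp add: field_simps add_nonneg_eq_0_iff)
    finally have \<delta>: "\<delta> > 0" "\<delta> * l2_sq lborel h < r/2" using \<delta>0 by auto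
    obtain N where N: "\<And>n. n \<ge> N \<Longrightarrow> norm (l2_sq lborel (\<lambda>u. h (u + v n) - h u) - 0) < \<delta> * r/2"
      using LIMSEQ_D[OF L2_translation_continuous[OF h v], of "\<delta> * r/2"] r \<delta> by auto
    show "\<exists>no. \<forall>n\<ge>no. norm (l2_inner lborel (\<lambda>u. h (u + v n) - h u) h - 0) < r"
    proof (intro exI allI impI)
      fix n assume n: "n \<ge> N"
      have "l2_sq lborel (\<lambda>u. h (u + v n) - h u) / \<delta> < r/2"
        using N[OF n] \<delta> by (simp add: field_simps)
      then have "cmod (l2_inner lborel (\<lambda>u. h (u + v n) - h u) h) < r"
        using l2_inner_norm_le[OF L2_diff[OF L2_shift[OF h] h] h \<delta>(1), of "v n"] \<delta>(2) by linarith
      then show "norm (l2_inner lborel (\<lambda>u. h (u + v n) - h u) h - 0) < r" by simp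
    qed
  qed
  then show ?thesis using eq by (metis (no_types, lifting) LIM_zero_iff ext)
qed

text \<open>
  The sign in the exponent is that of the Bergman transform, and no factor normalises the integral.
\<close>

definition fourier :: "(real \<Rightarrow> complex) \<Rightarrow> real \<Rightarrow> complex"
  where "fourier h x = (LINT t|lborel. h t * exp (\<i> * of_real (x * t)))"

lemma fourier_integrable:
  assumes "integrable lborel h"
  shows "integrable lborel (\<lambda>t. h t * exp (\<i> * of_real (x * t)))"
proof (rule Bochner_Integration.integrable_bound[OF assms])
  have [measurable]: "h \<in> borel_measurable borel" using assms by auto
  show "(\<lambda>t. h t * exp (\<i> * of_real (x * t))) \<in> borel_measurable lborel" by measurable
qed (auto simp: norm_mult simp del: of_real_mult)

lemma fourier_measurable [measurable]:
  assumes [measurable]: "h \<in> borel_measurable borel"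
  shows "fourier h \<in> borel_measurable borel"
  unfolding fourier_def[abs_def] by (intro lborel.borel_measurable_lebesgue_integral) measurable

lemma fourier_add:
  assumes "integrable lborel f" "integrable lborel g"
  shows "fourier (\<lambda>t. f t + c * g t) x = fourier f x + c * fourier g x"
  using fourier_integrable[OF assms(1), of x] fourier_integrable[OF assms(2), of x]
  unfolding fourier_def by (simp add: algebra_simps)

text \<open>
  The characteristic function of the standard normal distribution, rescaled.
\<close>

lemma integral_gaussian_iexp:
  assumes e: "\<epsilon> > 0"
  shows "integrable lborel (\<lambda>x. exp (- (\<epsilon> * x)\<^sup>2 / 2))"
    and "(LINT x|lborel. exp (\<i> * of_real (x * v)) * of_real (exp (- (\<epsilon> * x)\<^sup>2 / 2)))
       = of_real (sqrt (2 * pi) / \<epsilon> * exp (- (v / \<epsilon>)\<^sup>2 / 2))"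
proof -
  have g: "exp (- y\<^sup>2 / 2) = sqrt (2 * pi) * std_normal_density y" for y
    by (simp add: std_normal_density_def)
  have i1: "integrable lborel (\<lambda>y. exp (- y\<^sup>2 / 2 :: real))"
    unfolding g using integrable_normal_density[of 1 0] by simp
  show "integrable lborel (\<lambda>x. exp (- (\<epsilon> * x)\<^sup>2 / 2))"
    using lborel_integrable_real_affine[OF i1, of \<epsilon> 0] e by simp
  define k where "k y = exp (\<i> * of_real (y * (v / \<epsilon>))) * of_real (exp (- y\<^sup>2 / 2))" for y
  have "of_real (exp (- (v/\<epsilon>)\<^sup>2 / 2)) = char std_normal_distribution (v/\<epsilon>)"
    by (simp add: char_std_normal_distribution)
  also have "\<dots> = (LINT x|lborel. std_normal_density x *\<^sub>R exp (\<i> * of_real ((v/\<epsilon>) * x)))"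
    unfolding char_def by (subst integral_density) auto
  also have "\<dots> = (LINT x|lborel. of_real (1 / sqrt (2 * pi)) * k x)"
    by (intro Bochner_Integration.integral_cong refl)
       (simp add: std_normal_density_def k_def scaleR_conv_of_real mult_ac)
  also have "\<dots> = of_real (1 / sqrt (2 * pi)) * (LINT x|lborel. k x)" by simp
  finally have k: "(LINT x|lborel. k x) = of_real (sqrt (2 * pi) * exp (- (v/\<epsilon>)\<^sup>2 / 2))"
    by (simp add: field_simps)
  have "(LINT x|lborel. exp (\<i> * of_real (x * v)) * of_real (exp (- (\<epsilon> * x)\<^sup>2 / 2))) = (LINT x|lborel. k (0 + \<epsilon> * x))"
    using e by (simp add: k_def)
  also have "\<dots> = (1/\<epsilon>) *\<^sub>R (LINT x|lborel. k x)"
    using lborel_integral_real_affine[of \<epsilon> k 0] e by simp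
  finally show "(LINT x|lborel. exp (\<i> * of_real (x * v)) * of_real (exp (- (\<epsilon> * x)\<^sup>2 / 2)))
       = of_real (sqrt (2 * pi) / \<epsilon> * exp (- (v / \<epsilon>)\<^sup>2 / 2))"
    unfolding k by (simp add: scaleR_conv_of_real)
qed

text \<open>
  The squared modulus of the transform is the transform of the autocorrelation \<open>A\<close>. By this,
  Plancherel's theorem becomes a statement about the value \<open>A 0\<close>.
\<close>

lemma fourier_norm_sq_eq:
  fixes h :: "real \<Rightarrow> complex"
  assumes h: "integrable lborel h"
  defines "A \<equiv> \<lambda>v. LINT u|lborel. h (u + v) * cnj (h u)"
  shows "integrable lborel A"
    and "of_real ((cmod (fourier h x))\<^sup>2) = (LINT v|lborel. A v * exp (\<i> * of_real (x * v)))"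
proof -
  have [measurable]: "h \<in> borel_measurable borel" using h by auto
  have int: "integrable (lborel \<Otimes>\<^sub>M lborel) (\<lambda>(u,v). h (u + v) * cnj (h u) * exp (\<i> * of_real (x * v)))" for x
  proof (rule lborel_pair.Fubini_integrable)
    show "(\<lambda>(u, v). h (u + v) * cnj (h u) * exp (\<i> * of_real (x * v))) \<in> borel_measurable (lborel \<Otimes>\<^sub>M lborel)"
      by measurable
    have "(\<lambda>u. LINT v|lborel. norm (case (u, v) of (u, v) \<Rightarrow> h (u + v) * cnj (h u) * exp (\<i> * of_real (x * v))))
       = (\<lambda>u. (LINT v|lborel. cmod (h v)) * cmod (h u))"
      using lborel_integral_shift[of "\<lambda>v. cmod (h v)"]
      by (auto simp: norm_mult add.commute simp del: of_real_mult)
    then show "integrable lborel (\<lambda>u. LINT v|lborel. norm (case (u, v) of (u, v) \<Rightarrow> h (u + v) * cnj (h u) * exp (\<i> * of_real (x * v))))"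
      using h by simp
    have "integrable lborel (\<lambda>v. h (u + v) * cnj (h u) * exp (\<i> * of_real (x * v)))" for u
      using fourier_integrable[OF lborel_integrable_shift[OF h, of u], of x]
      by (simp add: add.commute mult.assoc mult.left_commute[of _ "cnj (h u)"])
    then show "AE u in lborel. integrable lborel (\<lambda>v. case (u, v) of (u, v) \<Rightarrow> h (u + v) * cnj (h u) * exp (\<i> * of_real (x * v)))"
      by simp
  qed
  show "integrable lborel A"
    using lborel_pair.integrable_snd[OF int[of 0]] by (simp add: A_def)
  have "(LINT v|lborel. A v * exp (\<i> * of_real (x * v))) = (LINT v|lborel. (LINT u|lborel. h (u + v) * cnj (h u) * exp (\<i> * of_real (x * v))))"
    by (simp add: A_def)
  also have "\<dots> = (LINT u|lborel. (LINT v|lborel. h (u + v) * cnj (h u) * exp (\<i> * of_real (x * v))))"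
    using lborel_pair.Fubini_integral[OF int] by simp
  also have "\<dots> = (LINT u|lborel. fourier h x * cnj (h u * exp (\<i> * of_real (x * u))))"
  proof (intro Bochner_Integration.integral_cong refl)
    fix u :: real
    have "fourier h x = (LINT v|lborel. h (v + u) * exp (\<i> * of_real (x * (v + u))))"
      unfolding fourier_def by (rule lborel_integral_shift[symmetric])
    also have "\<dots> = (LINT v|lborel. h (u + v) * exp (\<i> * of_real (x * v)) * exp (\<i> * of_real (x * u)))"
      by (intro Bochner_Integration.integral_cong refl) (simp add: exp_add[symmetric] algebra_simps)
    finally have "fourier h x * cnj (h u * exp (\<i> * of_real (x * u))) =
        (LINT v|lborel. h (u + v) * exp (\<i> * of_real (x * v)) * exp (\<i> * of_real (x * u))) * cnj (h u * exp (\<i> * of_real (x * u)))" by simp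
    also have "\<dots> = (LINT v|lborel. h (u + v) * cnj (h u) * exp (\<i> * of_real (x * v)) * (exp (\<i> * of_real (x * u)) * cnj (exp (\<i> * of_real (x * u)))))"
      by (subst Bochner_Integration.integral_mult_left_zero[symmetric]) (simp add: mult_ac)
    also have "exp (\<i> * of_real (x * u)) * cnj (exp (\<i> * of_real (x * u))) = 1"
      by (simp add: exp_cnj exp_add[symmetric])
    finally show "(LINT v|lborel. h (u + v) * cnj (h u) * exp (\<i> * of_real (x * v))) = fourier h x * cnj (h u * exp (\<i> * of_real (x * u)))"
      by simp
  qed
  also have "\<dots> = fourier h x * cnj (fourier h x)"
    unfolding Bochner_Integration.integral_mult_right_zero Bochner_Integration.integral_cnj fourier_def[symmetric] ..
  finally show "of_real ((cmod (fourier h x))\<^sup>2) = (LINT v|lborel. A v * exp (\<i> * of_real (x * v)))"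
    by (simp add: complex_norm_square del: of_real_power)
qed

text \<open>
  With a Gaussian factor the integral of the squared modulus can be rewritten by Fubini's theorem as
  a Gaussian mean of the autocorrelation near \<open>0\<close>.
\<close>

lemma fourier_gaussian_regularised:
  fixes h :: "real \<Rightarrow> complex"
  assumes h: "integrable lborel h" and e: "\<epsilon> > 0"
  defines "A \<equiv> \<lambda>v. LINT u|lborel. h (u + v) * cnj (h u)"
  shows "integrable lborel (\<lambda>x. (cmod (fourier h x))\<^sup>2 * exp (- (\<epsilon> * x)\<^sup>2 / 2))" (is ?i)
    and "of_real (LINT x|lborel. (cmod (fourier h x))\<^sup>2 * exp (- (\<epsilon> * x)\<^sup>2 / 2))
       = (LINT y|lborel. of_real (sqrt (2 * pi)) * (A (\<epsilon> * y) * of_real (exp (- y\<^sup>2 / 2))))" (is ?e)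
proof -
  have [measurable]: "h \<in> borel_measurable borel" using h by auto
  have iA: "integrable lborel A" using fourier_norm_sq_eq(1)[OF h] by (simp add: A_def)
  then have [measurable]: "A \<in> borel_measurable borel" by auto
  note ig = integral_gaussian_iexp[OF e]
  have int: "integrable (lborel \<Otimes>\<^sub>M lborel) (\<lambda>(x,v). A v * exp (\<i> * of_real (x * v)) * of_real (exp (- (\<epsilon> * x)\<^sup>2 / 2)))"
  proof (rule lborel_pair.Fubini_integrable)
    show "(\<lambda>(x,v). A v * exp (\<i> * of_real (x * v)) * of_real (exp (- (\<epsilon> * x)\<^sup>2 / 2))) \<in> borel_measurable (lborel \<Otimes>\<^sub>M lborel)"
      by measurable
    have "(\<lambda>x. LINT v|lborel. norm (case (x, v) of (x,v) \<Rightarrow> A v * exp (\<i> * of_real (x * v)) * of_real (exp (- (\<epsilon> * x)\<^sup>2 / 2))))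
       = (\<lambda>x. (LINT v|lborel. cmod (A v)) * exp (- (\<epsilon> * x)\<^sup>2 / 2))"
      by (auto simp: norm_mult simp del: of_real_mult)
    then show "integrable lborel (\<lambda>x. LINT v|lborel. norm (case (x, v) of (x,v) \<Rightarrow> A v * exp (\<i> * of_real (x * v)) * of_real (exp (- (\<epsilon> * x)\<^sup>2 / 2))))"
      using ig(1) by simp
    show "AE x in lborel. integrable lborel (\<lambda>v. case (x, v) of (x,v) \<Rightarrow> A v * exp (\<i> * of_real (x * v)) * of_real (exp (- (\<epsilon> * x)\<^sup>2 / 2)))"
      using fourier_integrable[OF iA] by (auto simp del: of_real_mult)
  qed
  have eq: "(LINT v|lborel. A v * exp (\<i> * of_real (x * v)) * of_real (exp (- (\<epsilon> * x)\<^sup>2 / 2))) =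
     of_real ((cmod (fourier h x))\<^sup>2 * exp (- (\<epsilon> * x)\<^sup>2 / 2))" for x
  proof -
    have "of_real ((cmod (fourier h x))\<^sup>2) = (LINT v|lborel. A v * exp (\<i> * of_real (x * v)))"
      unfolding A_def by (rule fourier_norm_sq_eq(2)[OF h])
    then show ?thesis by (simp only: Bochner_Integration.integral_mult_left_zero of_real_mult)
  qed
  have "integrable lborel (\<lambda>x. LINT v|lborel. A v * exp (\<i> * of_real (x * v)) * of_real (exp (- (\<epsilon> * x)\<^sup>2 / 2)))"
    using lborel_pair.integrable_fst'[OF int] by simp
  then show ?i unfolding eq using integrable_Re by fastforce
  have "of_real (LINT x|lborel. (cmod (fourier h x))\<^sup>2 * exp (- (\<epsilon> * x)\<^sup>2 / 2))
     = (LINT x|lborel. (LINT v|lborel. A v * exp (\<i> * of_real (x * v)) * of_real (exp (- (\<epsilon> * x)\<^sup>2 / 2))))"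
    unfolding eq by (rule integral_complex_of_real[symmetric])
  also have "\<dots> = (LINT v|lborel. (LINT x|lborel. A v * exp (\<i> * of_real (x * v)) * of_real (exp (- (\<epsilon> * x)\<^sup>2 / 2))))"
    using lborel_pair.Fubini_integral[OF int] by simp
  also have "\<dots> = (LINT v|lborel. A v * of_real (sqrt (2 * pi) / \<epsilon> * exp (- (v / \<epsilon>)\<^sup>2 / 2)))"
    unfolding mult.assoc by (subst Bochner_Integration.integral_mult_right_zero, subst ig(2)) (rule refl)
  also have "\<dots> = \<epsilon> *\<^sub>R (LINT y|lborel. A (\<epsilon> * y) * of_real (sqrt (2 * pi) / \<epsilon> * exp (- y\<^sup>2 / 2)))"
    using lborel_integral_real_affine[of \<epsilon> "\<lambda>v. A v * of_real (sqrt (2 * pi) / \<epsilon> * exp (- (v / \<epsilon>)\<^sup>2 / 2))" 0] e by simp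
  also have "\<dots> = (LINT y|lborel. of_real \<epsilon> * (A (\<epsilon> * y) * of_real (sqrt (2 * pi) / \<epsilon> * exp (- y\<^sup>2 / 2))))"
    by (subst Bochner_Integration.integral_mult_right_zero) (simp add: scaleR_conv_of_real)
  also have "\<dots> = (LINT y|lborel. of_real (sqrt (2 * pi)) * (A (\<epsilon> * y) * of_real (exp (- y\<^sup>2 / 2))))"
    using e by (intro Bochner_Integration.integral_cong refl) (simp add: field_simps)
  finally show ?e .
qed

text \<open>
  As the width of the Gaussian factor grows, the regularised integrals increase to the full
  integral, while the means of the autocorrelation converge to its value at \<open>0\<close>.
\<close>

theorem plancherel:
  fixes h :: "real \<Rightarrow> complex"
  assumes h1: "integrable lborel h" and h2: "h \<in> L2 lborel"
  shows "fourier h \<in> L2 lborel" "l2_sq lborel (fourier h) = 2 * pi * l2_sq lborel h"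
proof -
  have [measurable]: "h \<in> borel_measurable borel" using h1 by auto
  define A where "A = (\<lambda>v. LINT u|lborel. h (u + v) * cnj (h u))"
  define \<epsilon> where "\<epsilon> n = 1 / real (Suc n)" for n
  have e0: "\<epsilon> n > 0" for n by (simp add: \<epsilon>_def)
  have elim: "\<epsilon> \<longlonglongrightarrow> 0" unfolding \<epsilon>_def using LIMSEQ_inverse_real_of_nat by (simp add: inverse_eq_divide)
  have [measurable]: "A \<in> borel_measurable borel" 
    using fourier_norm_sq_eq(1)[OF h1] unfolding A_def by auto
  have Ab: "cmod (A v) \<le> 2 * l2_sq lborel h" for v
  proof -
    have "l2_sq lborel (\<lambda>u. h (u + v)) = l2_sq lborel h"
      unfolding l2_sq_def by (rule lborel_integral_shift[of "\<lambda>u. (cmod (h u))\<^sup>2"])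
    then show ?thesis using l2_inner_norm_le[OF L2_shift[OF h2] h2, of 1 v] by (simp add: A_def l2_inner_def)
  qed
  note g1 = integral_gaussian_iexp[of 1]
  have "(\<lambda>n. LINT y|lborel. of_real (sqrt (2 * pi)) * (A (\<epsilon> n * y) * of_real (exp (- y\<^sup>2 / 2))))
     \<longlonglongrightarrow> (LINT y|lborel. of_real (sqrt (2 * pi)) * (of_real (l2_sq lborel h) * of_real (exp (- y\<^sup>2 / 2))))"
  proof (rule integral_dominated_convergence[where w="\<lambda>y. sqrt (2 * pi) * (2 * l2_sq lborel h) * exp (- y\<^sup>2 / 2)"])
    show "integrable lborel (\<lambda>y. sqrt (2 * pi) * (2 * l2_sq lborel h) * exp (- y\<^sup>2 / 2))"
      using g1(1) by (intro integrable_mult_right) auto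
    show "AE y in lborel. (\<lambda>n. of_real (sqrt (2 * pi)) * (A (\<epsilon> n * y) * of_real (exp (- y\<^sup>2 / 2))))
       \<longlonglongrightarrow> of_real (sqrt (2 * pi)) * (of_real (l2_sq lborel h) * of_real (exp (- y\<^sup>2 / 2)))"
      unfolding A_def
      by (intro AE_I2 tendsto_mult_left tendsto_mult_right autocorrelation_continuous[OF h2] tendsto_mult_left_zero[OF elim])
    show "AE y in lborel. norm (of_real (sqrt (2 * pi)) * (A (\<epsilon> n * y) * of_real (exp (- y\<^sup>2 / 2))))
      \<le> sqrt (2 * pi) * (2 * l2_sq lborel h) * exp (- y\<^sup>2 / 2)" for n
      using Ab by (intro AE_I2) (auto simp: norm_mult intro!: mult_right_mono mult_left_mono)
  qed measurable
  also have "(LINT y|lborel. of_real (sqrt (2 * pi)) * (of_real (l2_sq lborel h) * of_real (exp (- y\<^sup>2 / 2))))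
     = complex_of_real (sqrt (2 * pi) * (l2_sq lborel h)) * (LINT y|lborel. of_real (exp (- y\<^sup>2 / 2)))"
    by (subst Bochner_Integration.integral_mult_right_zero[symmetric]) (simp add: mult_ac)
  also have "(LINT y|lborel. of_real (exp (- y\<^sup>2 / 2))) = complex_of_real (sqrt (2 * pi))"
    using g1(2)[of 0] by simp
  also have "complex_of_real (sqrt (2 * pi) * (l2_sq lborel h)) * complex_of_real (sqrt (2 * pi)) = of_real (2 * pi * l2_sq lborel h)"
    unfolding of_real_mult[symmetric] by (simp add: mult_ac)
  finally have "(\<lambda>n. complex_of_real (LINT x|lborel. (cmod (fourier h x))\<^sup>2 * exp (- (\<epsilon> n * x)\<^sup>2 / 2))) \<longlonglongrightarrow> of_real (2 * pi * l2_sq lborel h)"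
    unfolding fourier_gaussian_regularised(2)[OF h1 e0] A_def .
  then have lim: "(\<lambda>n. LINT x|lborel. (cmod (fourier h x))\<^sup>2 * exp (- (\<epsilon> n * x)\<^sup>2 / 2)) \<longlonglongrightarrow> 2 * pi * l2_sq lborel h"
    by (simp only: tendsto_of_real_iff)
  have mono: "AE x in lborel. mono (\<lambda>n. (cmod (fourier h x))\<^sup>2 * exp (- (\<epsilon> n * x)\<^sup>2 / 2))"
  proof (intro AE_I2 monoI)
    fix x :: real and m n :: nat assume "m \<le> n"
    then have "\<epsilon> n \<le> \<epsilon> m" by (simp add: \<epsilon>_def divide_left_mono)
    then have "(\<epsilon> n * x)\<^sup>2 \<le> (\<epsilon> m * x)\<^sup>2"
      using e0[of n] by (simp add: power_mult_distrib mult_right_mono power_mono)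
    then show "(cmod (fourier h x))\<^sup>2 * exp (- (\<epsilon> m * x)\<^sup>2 / 2) \<le> (cmod (fourier h x))\<^sup>2 * exp (- (\<epsilon> n * x)\<^sup>2 / 2)"
      by (intro mult_left_mono) auto
  qed
  have ptw: "AE x in lborel. (\<lambda>n. (cmod (fourier h x))\<^sup>2 * exp (- (\<epsilon> n * x)\<^sup>2 / 2)) \<longlonglongrightarrow> (cmod (fourier h x))\<^sup>2"
  proof (intro AE_I2)
    fix x :: real
    have "(\<lambda>n. (cmod (fourier h x))\<^sup>2 * exp (- (\<epsilon> n * x)\<^sup>2 / 2)) \<longlonglongrightarrow> (cmod (fourier h x))\<^sup>2 * exp (- (0 * x)\<^sup>2 / 2)"
      by (intro tendsto_intros elim) auto
    then show "(\<lambda>n. (cmod (fourier h x))\<^sup>2 * exp (- (\<epsilon> n * x)\<^sup>2 / 2)) \<longlonglongrightarrow> (cmod (fourier h x))\<^sup>2" by simp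
  qed
  note mc = fourier_gaussian_regularised(1)[OF h1 e0] mono ptw lim
  have m: "(\<lambda>x. (cmod (fourier h x))\<^sup>2) \<in> borel_measurable lborel" by measurable
  show "fourier h \<in> L2 lborel"
    using integrable_monotone_convergence[OF mc m] by (simp add: L2_def)
  show "l2_sq lborel (fourier h) = 2 * pi * l2_sq lborel h"
    unfolding l2_sq_def using integral_monotone_convergence[OF mc m] by (simp add: l2_sq_def)
qed

corollary plancherel_inner:
  assumes f: "integrable lborel f" "f \<in> L2 lborel" and g: "integrable lborel g" "g \<in> L2 lborel"
  shows "l2_inner lborel (fourier f) (fourier g) = of_real (2 * pi) * l2_inner lborel f g"
proof -
  have e: "l2_sq lborel (\<lambda>x. fourier f x + c * fourier g x) = 2 * pi * l2_sq lborel (\<lambda>t. f t + c * g t)" for c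
    unfolding fourier_add[OF f(1) g(1), symmetric]
    by (rule plancherel(2)[OF _ L2_add[OF f(2) L2_scale[OF g(2)]]]) (use f g in simp)
  have "4 * l2_inner lborel (fourier f) (fourier g) = of_real (2 * pi) * (4 * l2_inner lborel f g)"
    unfolding l2_polarization[OF plancherel(1)[OF f] plancherel(1)[OF g]] l2_polarization[OF f(2) g(2)] e
    by (simp add: algebra_simps)
  then show ?thesis by simp
qed

section \<open>Laguerre polynomials\<close>

definition laguerre :: "nat \<Rightarrow> real \<Rightarrow> real"
  where "laguerre n y = (\<Sum>i\<le>n. real (n choose i) * (- y) ^ i / fact i)"

lemma laguerre_measurable [measurable]: "laguerre n \<in> borel_measurable borel"
  unfolding laguerre_def[abs_def] by measurable

lemma gamma_moment:
  "has_bochner_integral lborel (\<lambda>y. indicator {0<..} y * (y ^ k * exp (- y))) (fact k :: real)"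
proof (rule has_bochner_integral_nn_integral)
  have "(\<integral>\<^sup>+y. ennreal (indicator {0<..} y * (y ^ k * exp (- y))) \<partial>lborel) =
    (\<integral>\<^sup>+y. ennreal (y ^ k * exp (- y)) * indicator {0..} y \<partial>lborel)"
    using AE_lborel_singleton[of "0::real"]
    by (intro nn_integral_cong_AE) (auto elim!: eventually_mono simp: indicator_def)
  also have "\<dots> = ennreal (fact k)" by (subst nn_intergal_power_times_exp_Ici) auto
  finally show "(\<integral>\<^sup>+y. ennreal (indicator {0<..} y * (y ^ k * exp (- y))) \<partial>lborel) = ennreal (fact k)" .
qed (auto simp: indicator_def)

text \<open>
  The sum is, up to sign, the \<open>n\<close>-th difference of \<open>(a choose m)\<close> in \<open>a\<close>; each difference lowers \<open>m\<close>
  by one, by Pascal's rule.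
\<close>

lemma alternating_binomial_sum:
  fixes a m n :: nat
  shows "(\<Sum>i\<le>n. (-1) ^ i * int (n choose i) * int ((a + i) choose m))
    = (if n \<le> m then (-1) ^ n * int (a choose (m - n)) else 0)"
proof (induction n arbitrary: a m)
  case (Suc n)
  have "(\<Sum>i\<le>Suc n. (-1) ^ i * int (Suc n choose i) * int ((a + i) choose m))
     = (\<Sum>i\<le>n. (-1) ^ i * int (n choose i) * int ((a + i) choose m))
       - (\<Sum>i\<le>n. (-1) ^ i * int (n choose i) * int ((Suc a + i) choose m))"
  proof -
    have "(\<Sum>i\<le>Suc n. (-1) ^ i * int (Suc n choose i) * int ((a + i) choose m))
      = int (a choose m) - (\<Sum>i\<le>n. (-1) ^ i * int (Suc n choose Suc i) * int ((Suc a + i) choose m))"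
      by (subst sum.atMost_Suc_shift) (simp add: sum_negf)
    also have "(\<Sum>i\<le>n. (-1) ^ i * int (Suc n choose Suc i) * int ((Suc a + i) choose m))
      = (\<Sum>i\<le>n. (-1) ^ i * int (n choose i) * int ((Suc a + i) choose m))
      + (\<Sum>i\<le>n. (-1) ^ i * int (n choose Suc i) * int ((Suc a + i) choose m))"
      by (simp add: algebra_simps sum.distrib)
    also have "(\<Sum>i\<le>n. (-1) ^ i * int (n choose Suc i) * int ((Suc a + i) choose m))
      = int (a choose m) - (\<Sum>i\<le>Suc n. (-1) ^ i * int (n choose i) * int ((a + i) choose m))"
      by (subst sum.atMost_Suc_shift) (simp add: sum_negf)
    finally show ?thesis by simp
  qed
  also have "\<dots> = (if Suc n \<le> m then (-1) ^ Suc n * int (a choose (m - Suc n)) else 0)"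
  proof (cases "m - n")
    case (Suc d)
    then have "Suc n \<le> m" "m - Suc n = d" by auto
    then show ?thesis using Suc unfolding Suc.IH by (simp add: algebra_simps)
  next
    case 0
    then show ?thesis unfolding Suc.IH by (cases "m = n") auto
  qed
  finally show ?case .
qed simp

text \<open>
  The moments are alternating binomial sums; those below the degree vanish.
\<close>

lemma laguerre_moment:
  "has_bochner_integral lborel (\<lambda>y. indicator {0<..} y * (y ^ m * laguerre n y * exp (- y)))
     (if m < n then 0 else fact m * ((-1) ^ n * real (m choose (m - n))))"
proof -
  have "has_bochner_integral lborel
      (\<lambda>y. \<Sum>i\<le>n. (real (n choose i) * (-1) ^ i / fact i) * (indicator {0<..} y * (y ^ (m + i) * exp (- y))))
      (\<Sum>i\<le>n. (real (n choose i) * (-1) ^ i / fact i) * fact (m + i))"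
    by (intro has_bochner_integral_sum has_bochner_integral_mult_right gamma_moment)
  also have "(\<lambda>y. \<Sum>i\<le>n. (real (n choose i) * (-1) ^ i / fact i) * (indicator {0<..} y * (y ^ (m + i) * exp (- y)))) =
     (\<lambda>y. indicator {0<..} y * (y ^ m * laguerre n y * exp (- y)))"
  proof (rule ext)
    fix y :: real
    have "indicator {0<..} y * (y ^ m * laguerre n y * exp (- y)) =
       (\<Sum>i\<le>n. indicator {0<..} y * (y ^ m * (real (n choose i) * (- y) ^ i / fact i) * exp (- y)))"
      unfolding laguerre_def by (simp only: sum_distrib_left sum_distrib_right)
    also have "\<dots> = (\<Sum>i\<le>n. (real (n choose i) * (-1) ^ i / fact i) * (indicator {0<..} y * (y ^ (m + i) * exp (- y))))"
      by (intro sum.cong refl) (simp add: power_minus[of y] power_add mult_ac)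
    finally show "(\<Sum>i\<le>n. (real (n choose i) * (-1) ^ i / fact i) * (indicator {0<..} y * (y ^ (m + i) * exp (- y)))) =
      indicator {0<..} y * (y ^ m * laguerre n y * exp (- y))" by simp
  qed
  also have "(\<Sum>i\<le>n. (real (n choose i) * (-1) ^ i / fact i) * fact (m + i)) =
    fact m * real_of_int (\<Sum>i\<le>n. (-1) ^ i * int (n choose i) * int ((m + i) choose m))"
  proof -
    have "fact (m + i) / fact i = fact m * real ((m + i) choose m)" for i
      using binomial_fact[of m "m + i", where 'a=real] by simp
    then have "(real (n choose i) * (-1) ^ i / fact i) * fact (m + i) = fact m * ((-1) ^ i * real (n choose i) * real ((m + i) choose m))" for i
      by (simp add: field_simps)
    then show ?thesis by (simp add: sum_distrib_left)
  qed
  also have "\<dots> = (if m < n then 0 else fact m * ((-1) ^ n * real (m choose (m - n))))"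
    unfolding alternating_binomial_sum by auto
  finally show ?thesis .
qed

text \<open>
  Expanding the polynomial of smaller degree leaves only moments that vanish, except for the leading
  term when the degrees agree.
\<close>

lemma laguerre_orthonormal:
  "has_bochner_integral lborel (\<lambda>y. indicator {0<..} y * (laguerre j y * laguerre k y * exp (- y)))
     (if j = k then 1 else 0)"
proof -
  have *: "has_bochner_integral lborel (\<lambda>y. indicator {0<..} y * (laguerre j y * laguerre k y * exp (- y)))
     (if j = k then 1 else 0)" if "j \<le> k" for j k
  proof -
    have "has_bochner_integral lborel
        (\<lambda>y. \<Sum>i\<le>j. (real (j choose i) * (-1) ^ i / fact i) * (indicator {0<..} y * (y ^ i * laguerre k y * exp (- y))))
        (\<Sum>i\<le>j. (real (j choose i) * (-1) ^ i / fact i) * (if i < k then 0 else fact i * ((-1) ^ k * real (i choose (i - k)))))"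
      by (intro has_bochner_integral_sum has_bochner_integral_mult_right laguerre_moment)
    also have "(\<lambda>y. \<Sum>i\<le>j. (real (j choose i) * (-1) ^ i / fact i) * (indicator {0<..} y * (y ^ i * laguerre k y * exp (- y)))) =
       (\<lambda>y. indicator {0<..} y * (laguerre j y * laguerre k y * exp (- y)))"
    proof (rule ext)
      fix y :: real
      have "indicator {0<..} y * (laguerre j y * laguerre k y * exp (- y)) =
         (\<Sum>i\<le>j. indicator {0<..} y * ((real (j choose i) * (- y) ^ i / fact i) * laguerre k y * exp (- y)))"
        unfolding laguerre_def[of j] by (simp only: sum_distrib_left sum_distrib_right)
      also have "\<dots> = (\<Sum>i\<le>j. (real (j choose i) * (-1) ^ i / fact i) * (indicator {0<..} y * (y ^ i * laguerre k y * exp (- y))))"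
        by (intro sum.cong refl) (simp add: power_minus[of y] mult_ac)
      finally show "(\<Sum>i\<le>j. (real (j choose i) * (-1) ^ i / fact i) * (indicator {0<..} y * (y ^ i * laguerre k y * exp (- y)))) =
        indicator {0<..} y * (laguerre j y * laguerre k y * exp (- y))" by simp
    qed
    also have "(\<Sum>i\<le>j. (real (j choose i) * (-1) ^ i / fact i) * (if i < k then 0 else fact i * ((-1) ^ k * real (i choose (i - k)))))
       = (\<Sum>i\<in>{..j}. if i = k then (if j = k then 1 else 0) else 0)"
      using that by (intro sum.cong refl) (auto simp flip: power_mult_distrib)
    also have "\<dots> = (if j = k then 1 else 0)" by auto
    finally show ?thesis .
  qed
  show ?thesis
  proof (cases "j \<le> k")
    case False
    then show ?thesis using *[of k j] by (simp add: mult.commute[of "laguerre k _"] eq_commute[of j])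
  qed (rule *)
qed

text \<open>
  The transition from the powers to the Laguerre polynomials is triangular with nonzero diagonal.
\<close>

lemma power_eq_laguerre_sum: "\<exists>c. \<forall>y. y ^ a = (\<Sum>k\<le>a. c k * laguerre k y)"
proof (induction a rule: less_induct)
  case (less a)
  then have "\<forall>i. \<exists>c. i < a \<longrightarrow> (\<forall>y. y ^ i = (\<Sum>k\<le>i. c k * laguerre k y))" by blast
  then obtain C where C: "\<And>i y. i < a \<Longrightarrow> y ^ i = (\<Sum>k\<le>i. C i k * laguerre k y)" by metis
  define b where "b i = real (a choose i) * (-1) ^ i / fact i" for i
  have b: "b a \<noteq> 0" by (simp add: b_def)
  define c where "c k = (if k = a then 1 / b a else - (\<Sum>i<a. if k \<le> i then b i * C i k / b a else 0))" for k
  have "y ^ a = (\<Sum>k\<le>a. c k * laguerre k y)" for y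
  proof -
    have "laguerre a y = (\<Sum>i\<le>a. b i * y ^ i)"
      unfolding laguerre_def b_def by (intro sum.cong refl) (simp add: power_minus[of y])
    also have "\<dots> = b a * y ^ a + (\<Sum>i<a. b i * y ^ i)" by (simp add: lessThan_Suc_atMost[symmetric])
    finally have 1: "y ^ a = laguerre a y / b a - (\<Sum>i<a. b i * y ^ i / b a)"
      using b by (simp add: field_simps sum_divide_distrib[symmetric])
    have "(\<Sum>i<a. b i * y ^ i / b a) = (\<Sum>i<a. \<Sum>k<a. if k \<le> i then b i * C i k / b a * laguerre k y else 0)"
    proof (intro sum.cong refl)
      fix i assume "i \<in> {..<a}"
      then have "b i * y ^ i / b a = (\<Sum>k\<in>{..i}. b i * C i k / b a * laguerre k y)"
        using C[of i y] by (simp add: sum_distrib_left sum_divide_distrib mult_ac)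
      also have "\<dots> = (\<Sum>k<a. if k \<le> i then b i * C i k / b a * laguerre k y else 0)"
        using \<open>i \<in> {..<a}\<close> by (intro sum.mono_neutral_cong_left) auto
      finally show "b i * y ^ i / b a = (\<Sum>k<a. if k \<le> i then b i * C i k / b a * laguerre k y else 0)" .
    qed
    also have "\<dots> = (\<Sum>k<a. \<Sum>i<a. if k \<le> i then b i * C i k / b a * laguerre k y else 0)" by (rule sum.swap)
    also have "\<dots> = (\<Sum>k<a. - (c k * laguerre k y))"
      by (intro sum.cong refl) (auto simp: c_def sum_distrib_right intro!: sum.cong)
    finally have "y ^ a = laguerre a y / b a + (\<Sum>k<a. c k * laguerre k y)" unfolding 1 by (simp add: sum_negf)
    then show ?thesis by (simp add: c_def[of a] lessThan_Suc_atMost[symmetric])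
  qed
  then show ?case by blast
qed

lemma has_bochner_integral_halfline_scale:
  fixes g :: "real \<Rightarrow> real"
  assumes "has_bochner_integral lborel (\<lambda>y. indicator {0<..} y * g y) I" and "c > 0"
  shows "has_bochner_integral lborel (\<lambda>s. indicator {0<..} s * (c * g (c * s))) I"
proof -
  have "has_bochner_integral lborel (\<lambda>s. indicator {0<..} (0 + c * s) * g (0 + c * s)) (I /\<^sub>R \<bar>c\<bar>)"
    using assms by (intro lborel_has_bochner_integral_real_affine_iff[THEN iffD1]) auto
  from has_bochner_integral_mult_right[OF this, of c]
  have "has_bochner_integral lborel (\<lambda>s. c * (indicator {0<..} (0 + c * s) * g (0 + c * s))) I"
    using assms(2) by (simp add: field_simps)
  also have "(\<lambda>s. c * (indicator {0<..} (0 + c * s) * g (0 + c * s))) = (\<lambda>s. indicator {0<..} s * (c * g (c * s)))"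
    using assms(2) by (auto simp: indicator_def zero_less_mult_iff)
  finally show ?thesis .
qed

section \<open>Laplace transforms of square-integrable functions on the half-line\<close>

abbreviation half_line :: "real measure"
  where "half_line \<equiv> lebesgue_on {0<..}"

lemma half_line_borel:
  fixes k :: "real \<Rightarrow> 'a::{banach, second_countable_topology}"
  assumes [measurable]: "k \<in> borel_measurable borel"
  shows half_line_measurable: "k \<in> borel_measurable half_line"
    and half_line_integrable_iff: "integrable half_line k \<longleftrightarrow> integrable lborel (\<lambda>t. indicator {0<..} t *\<^sub>R k t)"
    and half_line_integral: "integral\<^sup>L half_line k = (LINT t|lborel. indicator {0<..} t *\<^sub>R k t)"
proof -
  have k: "k \<in> borel_measurable lebesgue" by (rule measurable_completion) simp
  have m: "(\<lambda>t. indicator {0<..} t *\<^sub>R k t) \<in> borel_measurable lborel" by measurable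
  show "k \<in> borel_measurable half_line" using k by (rule measurable_restrict_space1)
  show "integrable half_line k \<longleftrightarrow> integrable lborel (\<lambda>t. indicator {0<..} t *\<^sub>R k t)"
    by (subst integrable_restrict_space) (use integrable_completion[OF m] in auto)
  show "integral\<^sup>L half_line k = (LINT t|lborel. indicator {0<..} t *\<^sub>R k t)"
    by (subst integral_restrict_space) (use integral_completion[OF m] in auto)
qed

text \<open>
  Fubini's theorem needs Borel functions on the whole line, whereas elements of \<open>L2 half_line\<close> are only
  Lebesgue measurable and arbitrary outside the half-line.
\<close>

definition half_line_rep :: "(real \<Rightarrow> complex) \<Rightarrow> (real \<Rightarrow> complex) \<Rightarrow> bool"
  where "half_line_rep f g \<longleftrightarrow> g \<in> L2 lborel \<and> (\<forall>t\<le>0. g t = 0) \<and> (AE t in half_line. f t = g t)"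

lemma half_line_repD:
  assumes "half_line_rep f g"
  shows "g \<in> L2 lborel" "t \<le> 0 \<Longrightarrow> g t = 0" "AE t in half_line. f t = g t"
  using assms by (auto simp: half_line_rep_def)

lemma L2_half_line_borel_rep:
  assumes f: "f \<in> L2 half_line"
  obtains g where "half_line_rep f g"
proof -
  define F where "F t = indicator {0<..} t *\<^sub>R f t" for t
  have "f \<in> borel_measurable half_line" using f by (simp add: L2_def)
  then have F: "F \<in> borel_measurable lebesgue"
    unfolding F_def by (subst (asm) borel_measurable_restrict_space_iff) auto
  then have "(\<lambda>t. Re (F t)) \<in> borel_measurable lebesgue" "(\<lambda>t. Im (F t)) \<in> borel_measurable lebesgue" by auto
  from completion_ex_borel_measurable_real[OF this(1)] completion_ex_borel_measurable_real[OF this(2)]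
  obtain p q where pq [measurable]: "p \<in> borel_measurable borel" "q \<in> borel_measurable borel"
    and ae: "AE t in lborel. Re (F t) = p t" "AE t in lborel. Im (F t) = q t" by auto
  define g where "g t = indicator {0<..} t *\<^sub>R Complex (p t) (q t)" for t
  have [measurable]: "g \<in> borel_measurable borel" unfolding g_def Complex_eq by measurable
  have ae2: "AE t in lborel. F t = g t"
    using ae by eventually_elim (auto simp: complex_eq_iff g_def F_def indicator_def)
  then have "AE t in lebesgue. F t = g t" by (rule AE_completion)
  then have ae3: "AE t in half_line. f t = g t"
    by (subst AE_restrict_space_iff) (auto elim!: eventually_mono simp: F_def g_def)
  have "integrable half_line (\<lambda>t. (cmod (g t))\<^sup>2)"
    using L2_square_integrable[OF f]
  proof (rule integrable_cong_AE_imp)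
    show "(\<lambda>t. (cmod (g t))\<^sup>2) \<in> borel_measurable half_line" by (rule half_line_measurable) measurable
    show "AE t in half_line. (cmod (f t))\<^sup>2 = (cmod (g t))\<^sup>2" using ae3 by eventually_elim simp
  qed
  then have "integrable lborel (\<lambda>t. indicator {0<..} t *\<^sub>R (cmod (g t))\<^sup>2)"
    by (subst (asm) half_line_integrable_iff) auto
  also have "(\<lambda>t. indicator {0<..} t *\<^sub>R (cmod (g t))\<^sup>2) = (\<lambda>t. (cmod (g t))\<^sup>2)" by (auto simp: g_def indicator_def)
  finally have "g \<in> L2 lborel" by (simp add: L2_def)
  moreover have "g t = 0" if "t \<le> 0" for t using that by (simp add: g_def)
  ultimately have "half_line_rep f g" using ae3 by (simp add: half_line_rep_def)
  then show ?thesis by (rule that)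
qed

lemma half_line_integral_rep:
  fixes k :: "real \<Rightarrow> complex"
  assumes [measurable]: "k \<in> borel_measurable borel" and f: "f \<in> L2 half_line"
    and fg: "half_line_rep f g"
  shows "(LINT t|half_line. k t * f t) = (LINT t|lborel. k t * g t)"
proof -
  note g = half_line_repD[OF fg]
  have [measurable]: "g \<in> borel_measurable borel" using g(1) by (simp add: L2_def)
  have "(LINT t|half_line. k t * f t) = (LINT t|half_line. k t * g t)"
  proof (rule integral_cong_AE)
    show "AE t in half_line. k t * f t = k t * g t" using g(3) by eventually_elim simp
    have "f \<in> borel_measurable half_line" using f by (simp add: L2_def)
    then show "(\<lambda>t. k t * f t) \<in> borel_measurable half_line" using half_line_measurable[of k] by auto
    show "(\<lambda>t. k t * g t) \<in> borel_measurable half_line" by (rule half_line_measurable) measurable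
  qed
  also have "\<dots> = (LINT t|lborel. indicator {0<..} t *\<^sub>R (k t * g t))" by (rule half_line_integral) measurable
  also have "\<dots> = (LINT t|lborel. k t * g t)"
    using g(2) by (intro Bochner_Integration.integral_cong refl) (auto simp: indicator_def not_less)
  finally show ?thesis .
qed

text \<open>
  The factor \<open>t\<^sup>1\<^sup>/\<^sup>2\<close> is the weight of the Bergman transform: \<open>laplace 0\<close> is \<open>Ber\<close>, and differentiation
  raises \<open>m\<close>.
\<close>

definition laplace_kernel :: "nat \<Rightarrow> complex \<Rightarrow> real \<Rightarrow> complex"
  where "laplace_kernel m z t = of_real (t powr (1/2) * t ^ m) * exp (\<i> * z * of_real t)"

definition laplace :: "nat \<Rightarrow> (real \<Rightarrow> complex) \<Rightarrow> complex \<Rightarrow> complex"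
  where "laplace m f z = (LINT t|half_line. laplace_kernel m z t * f t)"

lemma laplace_kernel_measurable [measurable]: "laplace_kernel m z \<in> borel_measurable borel"
  unfolding laplace_kernel_def[abs_def] by measurable

lemma cmod_laplace_kernel: "t > 0 \<Longrightarrow> cmod (laplace_kernel m z t) = t powr (1/2) * t ^ m * exp (- Im z * t)"
  by (simp add: laplace_kernel_def norm_mult norm_power)

lemma laplace_kernel_L2:
  assumes z: "Im z > 0"
  shows "laplace_kernel m z \<in> L2 half_line"
proof -
  \<comment> \<open>The rescaling that turns the squared kernel into a gamma integrand.\<close>
  define c where "c = 2 * Im z"
  have c: "c > 0" using z by (simp add: c_def)
  have "integrable lborel (\<lambda>t. indicator {0<..} t * (c * ((c * t) ^ (2 * m + 1) * exp (- (c * t)))))"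
    using has_bochner_integral_halfline_scale[OF gamma_moment c, of "2 * m + 1"] by (rule integrable.intros)
  then have "integrable lborel (\<lambda>t. (1 / c ^ (2 * m + 2)) * (indicator {0<..} t * (c * ((c * t) ^ (2 * m + 1) * exp (- (c * t))))))"
    by (rule integrable_mult_right)
  also have "(\<lambda>t. (1 / c ^ (2 * m + 2)) * (indicator {0<..} t * (c * ((c * t) ^ (2 * m + 1) * exp (- (c * t))))))
     = (\<lambda>t. indicator {0<..} t *\<^sub>R (cmod (laplace_kernel m z t))\<^sup>2)"
  proof (rule ext)
    fix t :: real
    show "(1 / c ^ (2 * m + 2)) * (indicator {0<..} t * (c * ((c * t) ^ (2 * m + 1) * exp (- (c * t))))) =
        indicator {0<..} t *\<^sub>R (cmod (laplace_kernel m z t))\<^sup>2"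
    proof (cases "t > 0")
      case True
      have "(cmod (laplace_kernel m z t))\<^sup>2 = (t powr (1/2))\<^sup>2 * (t ^ m)\<^sup>2 * (exp (- Im z * t))\<^sup>2"
        unfolding cmod_laplace_kernel[OF True] by (simp only: power_mult_distrib)
      also have "(t powr (1/2))\<^sup>2 = t" using True by (simp add: powr_half_sqrt)
      also have "(exp (- Im z * t))\<^sup>2 = exp (- (c * t))" by (simp add: c_def power2_eq_square exp_add[symmetric])
      also have "(t ^ m)\<^sup>2 = t ^ (2 * m)" by (simp add: power_mult[symmetric] mult.commute)
      finally show ?thesis using True c by (simp add: power_mult_distrib field_simps)
    qed simp
  qed
  finally have "integrable half_line (\<lambda>t. (cmod (laplace_kernel m z t))\<^sup>2)"
    by (subst half_line_integrable_iff) auto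
  then show ?thesis using half_line_measurable[of "laplace_kernel m z"] by (simp add: L2_def)
qed

lemma laplace_integrable:
  assumes "f \<in> L2 half_line" "Im z > 0"
  shows "integrable half_line (\<lambda>t. laplace_kernel m z t * f t)"
  by (rule L2_mult_integrable[OF laplace_kernel_L2[OF assms(2)] assms(1)])

text \<open>
  Differentiation under the integral sign: the quadratic error of the exponential, at points closer
  than \<open>Im z / 2\<close>, is dominated by the kernel of order \<open>m + 2\<close> at height \<open>Im z / 2\<close>.
\<close>

lemma has_field_derivative_laplace:
  assumes f: "f \<in> L2 half_line" and z: "Im z > 0"
  shows "(laplace m f has_field_derivative \<i> * laplace (Suc m) f z) (at z)"
proof -
  \<comment> \<open>Any point at half the height of \<open>z\<close> would do.\<close>
  define z' where "z' = \<i> * of_real (Im z / 2)"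
  have z': "Im z' > 0" using z by (simp add: z'_def)
  define K where "K = (LINT t|half_line. cmod (laplace_kernel (m + 2) z' t * f t))"
  have bound: "cmod ((laplace m f (z + h) - laplace m f z) / h - \<i> * laplace (Suc m) f z) \<le> K * cmod h"
    if h: "h \<noteq> 0" "cmod h < Im z / 2" for h
  proof -
    have zh: "Im (z + h) > 0" using h(2) abs_Im_le_cmod[of h] z by simp
    have i1: "integrable half_line (\<lambda>t. laplace_kernel m (z + h) t * f t)" by (rule laplace_integrable[OF f zh])
    have i2: "integrable half_line (\<lambda>t. laplace_kernel m z t * f t)" by (rule laplace_integrable[OF f z])
    have i3: "integrable half_line (\<lambda>t. laplace_kernel (Suc m) z t * f t)" by (rule laplace_integrable[OF f z])
    have i4: "integrable half_line (\<lambda>t. laplace_kernel (m + 2) z' t * f t)" by (rule laplace_integrable[OF f z'])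
    have pt: "cmod (laplace_kernel m (z + h) t * f t - laplace_kernel m z t * f t - \<i> * h * (laplace_kernel (Suc m) z t * f t))
        \<le> (cmod h)\<^sup>2 * cmod (laplace_kernel (m + 2) z' t * f t)" if t: "t > 0" for t
    proof -
      define u where "u = \<i> * h * of_real t"
      have "cmod (exp u - 1 - u) \<le> exp (cmod u) * (cmod u)\<^sup>2"
        using Taylor_exp_field[of u 1] by (simp add: diff_diff_eq power2_eq_square)
      also have "cmod u = cmod h * t" using t by (simp add: u_def norm_mult)
      finally have 1: "cmod (exp u - 1 - u) \<le> exp (cmod h * t) * (cmod h * t)\<^sup>2" .
      have "laplace_kernel m (z + h) t * f t - laplace_kernel m z t * f t - \<i> * h * (laplace_kernel (Suc m) z t * f t)
         = laplace_kernel m z t * f t * (exp u - 1 - u)"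
        by (simp add: laplace_kernel_def u_def exp_add distrib_left distrib_right algebra_simps)
      then have "cmod (laplace_kernel m (z + h) t * f t - laplace_kernel m z t * f t - \<i> * h * (laplace_kernel (Suc m) z t * f t))
         \<le> cmod (laplace_kernel m z t) * cmod (f t) * (exp (cmod h * t) * (cmod h * t)\<^sup>2)"
        using 1 by (simp add: norm_mult mult_left_mono)
      also have "\<dots> = (cmod h)\<^sup>2 * (t powr (1/2) * t ^ (m + 2) * (exp (- Im z * t) * exp (cmod h * t))) * cmod (f t)"
        unfolding cmod_laplace_kernel[OF t] by (simp add: power_mult_distrib power_add power2_eq_square mult_ac)
      also have "\<dots> \<le> (cmod h)\<^sup>2 * (t powr (1/2) * t ^ (m + 2) * exp (- Im z' * t)) * cmod (f t)"
      proof -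
        have "exp (- Im z * t) * exp (cmod h * t) = exp ((cmod h - Im z) * t)"
          by (simp add: exp_add[symmetric] algebra_simps)
        also have "\<dots> \<le> exp (- Im z' * t)"
          using h t mult_right_mono[of "cmod h - Im z" "- Im z'" t] by (simp add: z'_def)
        finally show ?thesis using t by (intro mult_right_mono mult_left_mono) auto
      qed
      also have "\<dots> = (cmod h)\<^sup>2 * cmod (laplace_kernel (m + 2) z' t * f t)"
        unfolding norm_mult cmod_laplace_kernel[OF t] by (simp add: mult_ac)
      finally show ?thesis .
    qed
    have e: "laplace m f (z + h) - laplace m f z - \<i> * h * laplace (Suc m) f z =
       (LINT t|half_line. laplace_kernel m (z + h) t * f t - laplace_kernel m z t * f t - \<i> * h * (laplace_kernel (Suc m) z t * f t))"
      unfolding laplace_def using i1 i2 i3 by simp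
    have "cmod (laplace m f (z + h) - laplace m f z - \<i> * h * laplace (Suc m) f z) \<le> (LINT t|half_line. cmod (laplace_kernel m (z + h) t * f t - laplace_kernel m z t * f t - \<i> * h * (laplace_kernel (Suc m) z t * f t)))"
      unfolding e by (rule integral_norm_bound)
    also have "\<dots> \<le> (LINT t|half_line. (cmod h)\<^sup>2 * cmod (laplace_kernel (m + 2) z' t * f t))"
    proof (rule integral_mono)
      show "integrable half_line (\<lambda>t. cmod (laplace_kernel m (z + h) t * f t - laplace_kernel m z t * f t - \<i> * h * (laplace_kernel (Suc m) z t * f t)))"
        by (intro integrable_norm Bochner_Integration.integrable_diff i1 i2 integrable_mult_right i3)
      show "integrable half_line (\<lambda>t. (cmod h)\<^sup>2 * cmod (laplace_kernel (m + 2) z' t * f t))"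
        by (intro integrable_norm integrable_mult_right i4)
    next
      fix t assume "t \<in> space half_line"
      then have "t > 0" by simp
      then show "cmod (laplace_kernel m (z + h) t * f t - laplace_kernel m z t * f t - \<i> * h * (laplace_kernel (Suc m) z t * f t))
        \<le> (cmod h)\<^sup>2 * cmod (laplace_kernel (m + 2) z' t * f t)" by (rule pt)
    qed
    also have "\<dots> = (cmod h)\<^sup>2 * K" unfolding K_def by simp
    finally have "cmod (laplace m f (z + h) - laplace m f z - \<i> * h * laplace (Suc m) f z) \<le> (cmod h)\<^sup>2 * K" .
    moreover have "(laplace m f (z + h) - laplace m f z) / h - \<i> * laplace (Suc m) f z =
       (laplace m f (z + h) - laplace m f z - \<i> * h * laplace (Suc m) f z) / h"
      using h(1) by (simp add: field_simps)
    ultimately show ?thesis using h(1) by (simp add: norm_divide field_simps power2_eq_square)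
  qed
  have "((\<lambda>h. (laplace m f (z + h) - laplace m f z) / h - \<i> * laplace (Suc m) f z) \<longlongrightarrow> 0) (at 0)"
  proof (rule Lim_null_comparison)
    show "\<forall>\<^sub>F h in at 0. norm ((laplace m f (z + h) - laplace m f z) / h - \<i> * laplace (Suc m) f z) \<le> K * cmod h"
      unfolding eventually_at using bound z by (intro exI[of _ "Im z / 2"]) (auto simp: dist_norm)
    show "((\<lambda>h. K * cmod h) \<longlongrightarrow> 0) (at (0::complex))"
      by (intro tendsto_mult_right_zero tendsto_norm_zero tendsto_ident_at)
  qed
  then show ?thesis unfolding DERIV_def by (rule LIM_zero_cancel)
qed

lemma laplace_holomorphic: "f \<in> L2 half_line \<Longrightarrow> laplace m f holomorphic_on \<bbbU>"
  unfolding upper_half_plane_def holomorphic_on_def field_differentiable_def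
  by (auto intro: DERIV_subset[OF has_field_derivative_laplace])

section \<open>Polyanalytic functions on the upper half-plane\<close>

lemma open_upper_half_plane: "open \<bbbU>"
  unfolding upper_half_plane_def by (intro open_Collect_less continuous_intros)

lemma upper_half_plane_iff: "z \<in> \<bbbU> \<longleftrightarrow> Im z > 0"
  by (simp add: upper_half_plane_def)

lemma upper_half_plane_borel: "\<bbbU> \<in> sets borel"
  using open_upper_half_plane by (rule borel_open)

abbreviation half_plane :: "complex measure"
  where "half_plane \<equiv> lebesgue_on \<bbbU>"

lemma upper_half_plane_continuous:
  fixes F :: "complex \<Rightarrow> 'a::{banach, second_countable_topology}"
  assumes F: "continuous_on \<bbbU> F"
  shows upper_half_plane_measurable: "F \<in> borel_measurable half_plane"
    and upper_half_plane_integrable_iff: "integrable half_plane F \<longleftrightarrow> set_integrable lborel \<bbbU> F"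
    and upper_half_plane_integral: "integral\<^sup>L half_plane F = (LINT z:\<bbbU>|lborel. F z)"
proof -
  have m: "(\<lambda>z. indicator \<bbbU> z *\<^sub>R F z) \<in> borel_measurable lborel"
    using borel_measurable_continuous_on_indicator[OF upper_half_plane_borel F] by simp
  have U: "\<bbbU> \<inter> space lebesgue \<in> sets lebesgue" using upper_half_plane_borel by simp
  show "F \<in> borel_measurable half_plane"
    by (subst borel_measurable_restrict_space_iff[OF U]) (use measurable_completion[OF m] in simp)
  show "integrable half_plane F \<longleftrightarrow> set_integrable lborel \<bbbU> F"
    unfolding set_integrable_def by (subst integrable_restrict_space[OF U]) (rule integrable_completion[OF m])
  show "integral\<^sup>L half_plane F = (LINT z:\<bbbU>|lborel. F z)"
    unfolding set_lebesgue_integral_def by (subst integral_restrict_space[OF U]) (rule integral_completion[OF m])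
qed

text \<open>
  The operators \<open>partial_x\<close> and \<open>partial_s\<close> are defined by choice where a derivative does not exist; this
  predicate asserts existence together with the values.
\<close>

definition has_partials :: "(complex \<Rightarrow> complex) \<Rightarrow> complex \<Rightarrow> complex \<Rightarrow> complex \<Rightarrow> bool"
  where "has_partials F a b z \<longleftrightarrow>
    ((\<lambda>x. F (Complex x (Im z))) has_vector_derivative a) (at (Re z)) \<and>
    ((\<lambda>s. F (Complex (Re z) s)) has_vector_derivative b) (at (Im z))"

lemma has_partialsD:
  assumes "has_partials F a b z"
  shows "partial_x F z = a" "partial_s F z = b" "d_dz F z = (a - \<i> * b) / 2" "d_dzbar F z = (a + \<i> * b) / 2"
  using assms by (auto simp: has_partials_def partial_x_def partial_s_def d_dz_def d_dzbar_def vector_derivative_at)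

lemma has_partials_cong:
  assumes "has_partials F a b z" "z \<in> \<bbbU>" "\<And>w. w \<in> \<bbbU> \<Longrightarrow> F w = G w"
  shows "has_partials G a b z"
proof -
  have z: "Im z > 0" using assms(2) by (simp add: upper_half_plane_iff)
  have "((\<lambda>x. G (Complex x (Im z))) has_vector_derivative a) (at (Re z))"
    using assms(1,3) z unfolding has_partials_def
    by (auto intro: has_vector_derivative_transform_within_open[of _ _ _ UNIV] simp: upper_half_plane_iff)
  moreover have "((\<lambda>s. G (Complex (Re z) s)) has_vector_derivative b) (at (Im z))"
    using assms(1,3) z unfolding has_partials_def
    by (auto intro: has_vector_derivative_transform_within_open[of _ _ _ "{0<..}"] simp: upper_half_plane_iff)
  ultimately show ?thesis by (simp add: has_partials_def)
qed

lemma has_partials_scale: "has_partials F a b z \<Longrightarrow> has_partials (\<lambda>w. c * F w) (c * a) (c * b) z"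
  unfolding has_partials_def by (auto intro: has_vector_derivative_mult_right)

lemma has_partials_add:
  "has_partials F a b z \<Longrightarrow> has_partials G c d z \<Longrightarrow> has_partials (\<lambda>w. F w + G w) (a + c) (b + d) z"
  unfolding has_partials_def by (auto intro: has_vector_derivative_add)

lemma has_partials_sum:
  "(\<And>i. i \<in> I \<Longrightarrow> has_partials (F i) (a i) (b i) z) \<Longrightarrow>
    has_partials (\<lambda>w. \<Sum>i\<in>I. F i w) (\<Sum>i\<in>I. a i) (\<Sum>i\<in>I. b i) z"
  unfolding has_partials_def by (auto intro: has_vector_derivative_sum)

lemma has_partials_Im_power_mult:
  assumes "(\<phi> has_field_derivative D) (at z)"
  shows "has_partials (\<lambda>w. of_real (Im w) ^ k * \<phi> w) (of_real (Im z) ^ k * D)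
     (of_nat k * of_real (Im z) ^ (k - 1) * \<phi> z + \<i> * of_real (Im z) ^ k * D) z"
proof -
  have x: "((\<lambda>x. Complex x (Im z)) has_vector_derivative 1) (at (Re z))"
    unfolding Complex_eq by (auto intro!: derivative_eq_intros)
  have s: "((\<lambda>s. Complex (Re z) s) has_vector_derivative \<i>) (at (Im z))"
    unfolding Complex_eq by (auto intro!: derivative_eq_intros)
  have \<phi>x: "((\<lambda>x. \<phi> (Complex x (Im z))) has_vector_derivative D) (at (Re z))"
    using field_vector_diff_chain_at[OF x, of \<phi> D] assms by (simp add: o_def)
  have \<phi>s: "((\<lambda>s. \<phi> (Complex (Re z) s)) has_vector_derivative \<i> * D) (at (Im z))"
    using field_vector_diff_chain_at[OF s, of \<phi> D] assms by (simp add: o_def)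
  have o: "(complex_of_real has_vector_derivative 1) (at (Im z))"
    using has_vector_derivative_of_real[OF DERIV_ident] by simp
  have q: "((\<lambda>w. w ^ k) has_field_derivative of_nat k * w ^ (k - 1)) (at w)" for w :: complex
    by (auto intro!: derivative_eq_intros)
  have p: "((\<lambda>s. of_real s ^ k :: complex) has_vector_derivative of_nat k * of_real (Im z) ^ (k - 1)) (at (Im z))"
    using field_vector_diff_chain_at[OF o q] by (simp add: o_def)
  show ?thesis
    unfolding has_partials_def
    using has_vector_derivative_mult_right[OF \<phi>x, of "of_real (Im z) ^ k"] has_vector_derivative_mult[OF p \<phi>s]
    by (auto simp: algebra_simps)
qed

lemma differentiable_imp_has_partials:
  assumes "(F has_derivative F') (at z)"
  shows "has_partials F (F' 1) (F' \<i>) z"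
proof -
  have x: "((\<lambda>x. Complex x (Im z)) has_derivative (\<lambda>h. of_real h)) (at (Re z))"
    unfolding Complex_eq by (auto intro!: derivative_eq_intros)
  have s: "((\<lambda>s. Complex (Re z) s) has_derivative (\<lambda>h. \<i> * of_real h)) (at (Im z))"
    unfolding Complex_eq by (auto intro!: derivative_eq_intros)
  have lin: "linear F'" using assms has_derivative_linear by blast
  have "((\<lambda>x. F (Complex x (Im z))) has_derivative (\<lambda>h. F' (of_real h))) (at (Re z))"
    using has_derivative_compose[OF x, of F F'] assms by simp
  moreover have "((\<lambda>s. F (Complex (Re z) s)) has_derivative (\<lambda>h. F' (\<i> * of_real h))) (at (Im z))"
    using has_derivative_compose[OF s, of F F'] assms by simp
  moreover have "F' (of_real h) = h *\<^sub>R F' 1" "F' (\<i> * of_real h) = h *\<^sub>R F' \<i>" for h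
    using linear_scale[OF lin, of h 1] linear_scale[OF lin, of h \<i>] by (simp_all add: scaleR_conv_of_real mult.commute)
  ultimately show ?thesis by (simp add: has_partials_def has_vector_derivative_def)
qed

lemma differentiable_on_has_partials:
  assumes "F differentiable_on \<bbbU>" "z \<in> \<bbbU>"
  shows "has_partials F (partial_x F z) (partial_s F z) z"
proof -
  obtain F' where "(F has_derivative F') (at z within \<bbbU>)"
    using assms by (auto simp: differentiable_on_def differentiable_def)
  then have "(F has_derivative F') (at z)"
    by (simp only: at_within_open[OF assms(2) open_upper_half_plane])
  from differentiable_imp_has_partials[OF this] have p: "has_partials F (F' 1) (F' \<i>) z" .
  show ?thesis using p unfolding has_partialsD(1,2)[OF p] .
qed

lemma differentiable_on_cong:
  assumes "F differentiable_on S" "\<And>z. z \<in> S \<Longrightarrow> F z = G z"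
  shows "G differentiable_on S"
  unfolding differentiable_on_def
proof
  fix z assume z: "z \<in> S"
  have "F differentiable at z within S" using assms(1) z by (simp add: differentiable_on_def)
  then show "G differentiable at z within S"
    by (rule differentiable_transform_within[of _ _ _ 1]) (use assms(2) z in auto)
qed

lemma C_diff_cong:
  assumes "\<And>z. z \<in> \<bbbU> \<Longrightarrow> F z = G z" "C_diff k \<bbbU> F"
  shows "C_diff k \<bbbU> G"
  using assms
proof (induction k arbitrary: F G)
  case 0
  then show ?case using continuous_on_cong[of \<bbbU> \<bbbU> F G] by simp
next
  case (Suc k)
  have *: "has_partials F (partial_x F z) (partial_s F z) z" if "z \<in> \<bbbU>" for z
    using Suc.prems(2) that by (intro differentiable_on_has_partials) auto
  have e: "partial_x F z = partial_x G z" "partial_s F z = partial_s G z" if "z \<in> \<bbbU>" for z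
    using has_partialsD[OF has_partials_cong[OF *[OF that] that Suc.prems(1)]] by auto
  have "G differentiable_on \<bbbU>"
    using Suc.prems by (auto intro: differentiable_on_cong)
  moreover have "C_diff k \<bbbU> (partial_x G)" using Suc.IH[OF e(1)] Suc.prems(2) by simp
  moreover have "C_diff k \<bbbU> (partial_s G)" using Suc.IH[OF e(2)] Suc.prems(2) by simp
  ultimately show ?case by simp
qed

lemma C_diff_linear_combination:
  "C_diff k \<bbbU> F \<Longrightarrow> C_diff k \<bbbU> G \<Longrightarrow> C_diff k \<bbbU> (\<lambda>z. a * F z + b * G z)"
proof (induction k arbitrary: F G)
  case 0
  then show ?case by (auto intro!: continuous_intros)
next
  case (Suc k)
  then have dF: "F differentiable_on \<bbbU>" and dG: "G differentiable_on \<bbbU>" by auto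
  have p: "has_partials (\<lambda>z. a * F z + b * G z) (a * partial_x F z + b * partial_x G z) (a * partial_s F z + b * partial_s G z) z"
    if "z \<in> \<bbbU>" for z
    by (intro has_partials_add has_partials_scale differentiable_on_has_partials dF dG that)
  have "(\<lambda>z. a * F z + b * G z) differentiable_on \<bbbU>"
    using dF dG by (auto intro!: derivative_intros)
  moreover have "C_diff k \<bbbU> (partial_x (\<lambda>z. a * F z + b * G z))"
    by (rule C_diff_cong[OF _ Suc.IH[of "partial_x F" "partial_x G"]]) (use has_partialsD(1)[OF p] Suc.prems in auto)
  moreover have "C_diff k \<bbbU> (partial_s (\<lambda>z. a * F z + b * G z))"
    by (rule C_diff_cong[OF _ Suc.IH[of "partial_s F" "partial_s G"]]) (use has_partialsD(2)[OF p] Suc.prems in auto)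
  ultimately show ?case by simp
qed

text \<open>
  The functions annihilated by the \<open>N\<close>-th power of \<open>d_dzbar\<close>, written with powers of \<open>Im z\<close> instead of
  \<open>cnj z\<close>, which fits the transforms.
\<close>

definition polyanalytic_sum :: "nat \<Rightarrow> (complex \<Rightarrow> complex) \<Rightarrow> bool"
  where "polyanalytic_sum N F \<longleftrightarrow> (\<exists>\<phi>. (\<forall>k. \<phi> k holomorphic_on \<bbbU>) \<and>
    (\<forall>z\<in>\<bbbU>. F z = (\<Sum>k<N. of_real (Im z) ^ k * \<phi> k z)))"

lemma polyanalytic_sum_lin:
  assumes "polyanalytic_sum N F" "polyanalytic_sum N G"
  shows "polyanalytic_sum N (\<lambda>z. a * F z + b * G z)"
proof -
  obtain \<phi> where \<phi>: "\<And>k. \<phi> k holomorphic_on \<bbbU>" "\<And>z. z \<in> \<bbbU> \<Longrightarrow> F z = (\<Sum>k<N. of_real (Im z) ^ k * \<phi> k z)"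
    using assms(1) by (auto simp: polyanalytic_sum_def)
  obtain \<psi> where \<psi>: "\<And>k. \<psi> k holomorphic_on \<bbbU>" "\<And>z. z \<in> \<bbbU> \<Longrightarrow> G z = (\<Sum>k<N. of_real (Im z) ^ k * \<psi> k z)"
    using assms(2) by (auto simp: polyanalytic_sum_def)
  show ?thesis
    unfolding polyanalytic_sum_def
    by (intro exI[of _ "\<lambda>k z. a * \<phi> k z + b * \<psi> k z"])
       (auto simp: \<phi>(2) \<psi>(2) sum_distrib_left sum.distrib[symmetric] algebra_simps intro!: holomorphic_intros \<phi>(1) \<psi>(1))
qed

lemma polyanalytic_sum_zero: "polyanalytic_sum N (\<lambda>z. 0)"
  unfolding polyanalytic_sum_def by (intro exI[of _ "\<lambda>k z. 0"]) (auto intro!: holomorphic_intros)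

lemma polyanalytic_sum_sum:
  "(\<And>i. i \<in> I \<Longrightarrow> polyanalytic_sum N (F i)) \<Longrightarrow> polyanalytic_sum N (\<lambda>z. \<Sum>i\<in>I. F i z)"
proof (induction I rule: infinite_finite_induct)
  case (insert i I)
  then show ?case using polyanalytic_sum_lin[of N "F i" "\<lambda>z. \<Sum>i\<in>I. F i z" 1 1] by simp
qed (simp_all add: polyanalytic_sum_zero)

lemma sum_index_shift:
  fixes c :: "nat \<Rightarrow> complex"
  shows "(\<Sum>k<Suc N. of_nat k * s ^ (k - 1) * c k) = (\<Sum>k<N. s ^ k * (of_nat (Suc k) * c (Suc k)))"
  by (subst sum.lessThan_Suc_shift) (simp add: mult_ac)

lemma polyanalytic_sum_partials:
  assumes \<phi>: "\<And>k. \<phi> k holomorphic_on \<bbbU>" and F: "\<And>z. z \<in> \<bbbU> \<Longrightarrow> F z = (\<Sum>k<N. of_real (Im z) ^ k * \<phi> k z)"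
    and z: "z \<in> \<bbbU>"
  shows "has_partials F (\<Sum>k<N. of_real (Im z) ^ k * deriv (\<phi> k) z)
    (\<Sum>k<N. of_nat k * of_real (Im z) ^ (k - 1) * \<phi> k z + \<i> * of_real (Im z) ^ k * deriv (\<phi> k) z) z"
proof -
  have "(\<phi> k has_field_derivative deriv (\<phi> k) z) (at z)" for k
    using holomorphic_derivI[OF \<phi> open_upper_half_plane z] .
  then have "has_partials (\<lambda>z. \<Sum>k<N. of_real (Im z) ^ k * \<phi> k z) (\<Sum>k<N. of_real (Im z) ^ k * deriv (\<phi> k) z)
    (\<Sum>k<N. of_nat k * of_real (Im z) ^ (k - 1) * \<phi> k z + \<i> * of_real (Im z) ^ k * deriv (\<phi> k) z) z"
    by (intro has_partials_sum has_partials_Im_power_mult)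
  then show ?thesis by (rule has_partials_cong[OF _ z]) (simp add: F)
qed

lemma polyanalytic_sum_partial_x:
  assumes "polyanalytic_sum N F" shows "polyanalytic_sum N (partial_x F)"
proof -
  obtain \<phi> where \<phi>: "\<And>k. \<phi> k holomorphic_on \<bbbU>" and F: "\<And>z. z \<in> \<bbbU> \<Longrightarrow> F z = (\<Sum>k<N. of_real (Im z) ^ k * \<phi> k z)"
    using assms by (auto simp: polyanalytic_sum_def)
  show ?thesis unfolding polyanalytic_sum_def
    using has_partialsD(1)[OF polyanalytic_sum_partials[OF \<phi> F]] \<phi> open_upper_half_plane
    by (intro exI[of _ "\<lambda>k. deriv (\<phi> k)"]) (auto intro: holomorphic_deriv)
qed

lemma polyanalytic_sum_partial_s:
  assumes "polyanalytic_sum N F" shows "polyanalytic_sum N (partial_s F)"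
proof -
  obtain \<phi> where \<phi>: "\<And>k. \<phi> k holomorphic_on \<bbbU>" and F: "\<And>z. z \<in> \<bbbU> \<Longrightarrow> F z = (\<Sum>k<N. of_real (Im z) ^ k * \<phi> k z)"
    using assms by (auto simp: polyanalytic_sum_def)
  define \<psi> where "\<psi> k = (\<lambda>z. (if Suc k < N then of_nat (Suc k) * \<phi> (Suc k) z else 0) + \<i> * deriv (\<phi> k) z)" for k
  have "partial_s F z = (\<Sum>k<N. of_real (Im z) ^ k * \<psi> k z)" if "z \<in> \<bbbU>" for z
  proof -
    have "partial_s F z = (\<Sum>k<N. of_nat k * of_real (Im z) ^ (k - 1) * \<phi> k z) + (\<Sum>k<N. of_real (Im z) ^ k * (\<i> * deriv (\<phi> k) z))"
      using has_partialsD(2)[OF polyanalytic_sum_partials[OF \<phi> F that]] by (simp add: sum.distrib mult_ac)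
    also have "(\<Sum>k<N. of_nat k * of_real (Im z) ^ (k - 1) * \<phi> k z) =
      (\<Sum>k<N. of_real (Im z) ^ k * (if Suc k < N then of_nat (Suc k) * \<phi> (Suc k) z else 0))"
    proof (cases N)
      case (Suc M)
      show ?thesis unfolding Suc sum_index_shift by simp
    qed simp
    finally show ?thesis by (simp add: \<psi>_def sum.distrib[symmetric] distrib_left)
  qed
  moreover have "\<psi> k holomorphic_on \<bbbU>" for k
    unfolding \<psi>_def using \<phi> open_upper_half_plane by (cases "Suc k < N") (auto intro!: holomorphic_intros holomorphic_deriv)
  ultimately show ?thesis unfolding polyanalytic_sum_def by blast
qed

lemma polyanalytic_sum_dzbar:
  assumes \<phi>: "\<And>k. \<phi> k holomorphic_on \<bbbU>" and F: "\<And>z. z \<in> \<bbbU> \<Longrightarrow> F z = (\<Sum>k<Suc N. of_real (Im z) ^ k * \<phi> k z)"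
    and z: "z \<in> \<bbbU>"
  shows "d_dzbar F z = (\<Sum>k<N. of_real (Im z) ^ k * (\<i> / 2 * of_nat (Suc k) * \<phi> (Suc k) z))"
proof -
  let ?D = "\<Sum>k<Suc N. of_real (Im z) ^ k * deriv (\<phi> k) z"
  have "d_dzbar F z = (?D + \<i> * (\<Sum>k<Suc N. of_nat k * of_real (Im z) ^ (k - 1) * \<phi> k z
      + \<i> * of_real (Im z) ^ k * deriv (\<phi> k) z)) / 2"
    by (rule has_partialsD(4)[OF polyanalytic_sum_partials[OF \<phi> F z]])
  also have "(\<Sum>k<Suc N. of_nat k * of_real (Im z) ^ (k - 1) * \<phi> k z + \<i> * of_real (Im z) ^ k * deriv (\<phi> k) z)
     = (\<Sum>k<Suc N. of_nat k * of_real (Im z) ^ (k - 1) * \<phi> k z) + \<i> * ?D"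
    unfolding sum.distrib sum_distrib_left by (simp only: mult.assoc)
  also have "(?D + \<i> * ((\<Sum>k<Suc N. of_nat k * of_real (Im z) ^ (k - 1) * \<phi> k z) + \<i> * ?D)) / 2
     = \<i> / 2 * (\<Sum>k<Suc N. of_nat k * of_real (Im z) ^ (k - 1) * \<phi> k z)"
    by (simp add: algebra_simps del: sum.lessThan_Suc)
  also have "\<dots> = (\<Sum>k<N. of_real (Im z) ^ k * (\<i> / 2 * of_nat (Suc k) * \<phi> (Suc k) z))"
    unfolding sum_index_shift sum_distrib_left by (intro sum.cong refl) (simp add: mult_ac)
  finally show ?thesis .
qed

lemma polyanalytic_sum_differentiable:
  assumes "polyanalytic_sum N F" shows "F differentiable_on \<bbbU>"
proof -
  obtain \<phi> where \<phi>: "\<And>k. \<phi> k holomorphic_on \<bbbU>" and F: "\<And>z. z \<in> \<bbbU> \<Longrightarrow> F z = (\<Sum>k<N. of_real (Im z) ^ k * \<phi> k z)"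
    using assms by (auto simp: polyanalytic_sum_def)
  have "(\<lambda>z. \<Sum>k<N. of_real (Im z) ^ k * \<phi> k z) differentiable_on \<bbbU>"
    unfolding differentiable_on_def
  proof (intro ballI differentiable_sum differentiable_mult differentiable_power)
    fix z k assume z: "z \<in> \<bbbU>"
    show "\<phi> k differentiable at z within \<bbbU>"
      using \<phi>[of k] z unfolding holomorphic_on_def by (auto intro: field_differentiable_imp_differentiable)
    show "(\<lambda>z. of_real (Im z) :: complex) differentiable at z within \<bbbU>"
      by (rule bounded_linear_imp_differentiable)
         (intro bounded_linear_compose[OF bounded_linear_of_real] bounded_linear_Im)
  qed auto
  then show ?thesis using F by (auto intro: differentiable_on_cong)
qed

lemma polyanalytic_sum_C_diff: "polyanalytic_sum N F \<Longrightarrow> C_diff k \<bbbU> F"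
proof (induction k arbitrary: F)
  case 0
  then show ?case using polyanalytic_sum_differentiable differentiable_imp_continuous_on by auto
next
  case (Suc k)
  then show ?case
    using polyanalytic_sum_differentiable polyanalytic_sum_partial_x polyanalytic_sum_partial_s by auto
qed

lemma polyanalytic_sum_continuous: "polyanalytic_sum N F \<Longrightarrow> continuous_on \<bbbU> F"
  using polyanalytic_sum_C_diff[of N F 0] by simp

lemma polyanalytic_sum_dzbar_power_zero:
  "polyanalytic_sum n F \<Longrightarrow> z \<in> \<bbbU> \<Longrightarrow> (d_dzbar ^^ n) F z = 0"
proof (induction n arbitrary: F)
  case 0
  then show ?case by (auto simp: polyanalytic_sum_def)
next
  case (Suc n)
  obtain \<phi> where \<phi>: "\<And>k. \<phi> k holomorphic_on \<bbbU>" and F: "\<And>z. z \<in> \<bbbU> \<Longrightarrow> F z = (\<Sum>k<Suc n. of_real (Im z) ^ k * \<phi> k z)"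
    using Suc.prems(1) unfolding polyanalytic_sum_def by blast
  have "polyanalytic_sum n (d_dzbar F)"
    unfolding polyanalytic_sum_def using polyanalytic_sum_dzbar[OF \<phi> F] \<phi>
    by (intro exI[of _ "\<lambda>k z. \<i> / 2 * of_nat (Suc k) * \<phi> (Suc k) z"]) (auto intro!: holomorphic_intros)
  from Suc.IH[OF this Suc.prems(2)] show ?case by (simp add: funpow_swap1)
qed

text \<open>
  When the two partial derivatives satisfy the Cauchy-Riemann equation, the real differential is
  multiplication by a complex number.
\<close>

lemma Cauchy_Riemann_holomorphic:
  assumes dF: "F differentiable_on \<bbbU>" and CR: "\<And>z. z \<in> \<bbbU> \<Longrightarrow> d_dzbar F z = 0"
  shows "F holomorphic_on \<bbbU>"
  unfolding holomorphic_on_def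
proof
  fix z assume z: "z \<in> \<bbbU>"
  obtain F' where "(F has_derivative F') (at z within \<bbbU>)"
    using dF z by (auto simp: differentiable_on_def differentiable_def)
  then have F': "(F has_derivative F') (at z)"
    by (simp only: at_within_open[OF z open_upper_half_plane])
  have "F' 1 + \<i> * F' \<i> = 0"
    using CR[OF z] has_partialsD(4)[OF differentiable_imp_has_partials[OF F']] by simp
  then have "\<i> * (F' 1 + \<i> * F' \<i>) = 0" by simp
  then have i: "F' \<i> = \<i> * F' 1" by (simp add: algebra_simps)
  have lin: "linear F'" using F' has_derivative_linear by blast
  have "F' h = F' 1 * h" for h
  proof -
    have "F' h = F' (Re h *\<^sub>R 1 + Im h *\<^sub>R \<i>)" by (rule arg_cong[where f=F']) (simp add: complex_eq_iff)
    also have "\<dots> = Re h *\<^sub>R F' 1 + Im h *\<^sub>R F' \<i>" using lin by (simp add: linear_add linear_scale)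
    also have "\<dots> = F' 1 * (of_real (Re h) + \<i> * of_real (Im h))" unfolding i by (simp add: scaleR_conv_of_real algebra_simps)
    also have "of_real (Re h) + \<i> * of_real (Im h) = h" by (simp add: complex_eq_iff)
    finally show ?thesis .
  qed
  then have "F' = (*) (F' 1)" by (rule ext)
  then have "(F has_field_derivative F' 1) (at z)" using F' by (simp add: has_field_derivative_def)
  then show "F field_differentiable at z within \<bbbU>" unfolding field_differentiable_def by (blast intro: DERIV_subset)
qed

text \<open>
  By induction, \<open>d_dzbar F\<close> is such a sum with one term less. Integrating it term by term in \<open>Im z\<close>
  gives \<open>H\<close> with \<open>d_dzbar H = d_dzbar F\<close>, and \<open>F - H\<close> is holomorphic.
\<close>

lemma polyanalytic_sum_exists:
  "C_diff n \<bbbU> F \<Longrightarrow> (\<And>z. z \<in> \<bbbU> \<Longrightarrow> (d_dzbar ^^ n) F z = 0) \<Longrightarrow> polyanalytic_sum n F"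
proof (induction n arbitrary: F)
  case 0
  then show ?case by (auto simp: polyanalytic_sum_def intro!: exI[of _ "\<lambda>_ _. 0"] holomorphic_intros)
next
  case (Suc n)
  have dF: "F differentiable_on \<bbbU>" using Suc.prems(1) by simp
  have "C_diff n \<bbbU> (\<lambda>z. 1/2 * partial_x F z + \<i>/2 * partial_s F z)"
    using Suc.prems(1) by (intro C_diff_linear_combination) auto
  then have "C_diff n \<bbbU> (d_dzbar F)"
    by (rule C_diff_cong[rotated]) (simp add: d_dzbar_def field_simps)
  moreover have "(d_dzbar ^^ n) (d_dzbar F) z = 0" if "z \<in> \<bbbU>" for z
    using Suc.prems(2)[OF that] by (simp add: funpow_swap1)
  ultimately have "polyanalytic_sum n (d_dzbar F)" by (rule Suc.IH)
  then obtain \<psi> where \<psi>: "\<And>k. \<psi> k holomorphic_on \<bbbU>"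
    and dbF: "\<And>z. z \<in> \<bbbU> \<Longrightarrow> d_dzbar F z = (\<Sum>k<n. of_real (Im z) ^ k * \<psi> k z)"
    by (auto simp: polyanalytic_sum_def)
  \<comment> \<open>A term-by-term antiderivative in \<open>Im z\<close>: \<open>d_dzbar\<close> of \<open>(Im z)\<^sup>j\<^sup>+\<^sup>1 \<psi>\<close> is \<open>(j + 1) (i / 2) (Im z)\<^sup>j \<psi>\<close> for holomorphic \<open>\<psi>\<close>.\<close>
  define \<phi> where "\<phi> k = (case k of 0 \<Rightarrow> (\<lambda>_. 0) | Suc j \<Rightarrow> (\<lambda>z. 2 / (\<i> * of_nat (Suc j)) * \<psi> j z))" for k
  have \<phi>: "\<phi> k holomorphic_on \<bbbU>" for k
    unfolding \<phi>_def using \<psi> by (auto split: nat.split intro!: holomorphic_intros)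
  define H where "H z = (\<Sum>k<Suc n. of_real (Im z) ^ k * \<phi> k z)" for z
  have dH: "H differentiable_on \<bbbU>"
    by (rule polyanalytic_sum_differentiable[of "Suc n"]) (auto simp: polyanalytic_sum_def H_def intro!: exI[of _ \<phi>] \<phi>)
  have "\<i> / 2 * of_nat (Suc k) * \<phi> (Suc k) z = \<psi> k z" for k z
    unfolding \<phi>_def by (simp add: field_simps del: of_nat_Suc)
  then have dbH: "d_dzbar H z = d_dzbar F z" if "z \<in> \<bbbU>" for z
    using polyanalytic_sum_dzbar[OF \<phi> H_def that] dbF[OF that] by simp
  define G where "G z = F z + (-1) * H z" for z
  have "G differentiable_on \<bbbU>" unfolding G_def using dF dH by (auto intro!: derivative_intros)
  moreover have "d_dzbar G z = 0" if z: "z \<in> \<bbbU>" for z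
  proof -
    have "has_partials G (partial_x F z + (-1) * partial_x H z) (partial_s F z + (-1) * partial_s H z) z"
      unfolding G_def[abs_def] by (intro has_partials_add has_partials_scale differentiable_on_has_partials dF dH z)
    then have "d_dzbar G z = d_dzbar F z - d_dzbar H z"
      by (simp only: has_partialsD(4) d_dzbar_def[of F] d_dzbar_def[of H]) (simp add: field_simps)
    then show ?thesis using dbH[OF z] by simp
  qed
  ultimately have G: "G holomorphic_on \<bbbU>" by (rule Cauchy_Riemann_holomorphic)
  have "F z = (\<Sum>k<Suc n. of_real (Im z) ^ k * (if k = 0 then G else \<phi> k) z)" if "z \<in> \<bbbU>" for z
  proof -
    have "F z = G z + H z" by (simp add: G_def)
    also have "\<dots> = (\<Sum>k<Suc n. of_real (Im z) ^ k * (if k = 0 then G else \<phi> k) z)"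
      unfolding H_def sum.lessThan_Suc_shift by (simp add: \<phi>_def[of 0])
    finally show ?thesis .
  qed
  then show ?case unfolding polyanalytic_sum_def using \<phi> G
    by (intro exI[of _ "\<lambda>k. if k = 0 then G else \<phi> k"]) auto
qed

theorem poly_bergman_iff: "F \<in> poly_bergman n \<longleftrightarrow> F \<in> L2 half_plane \<and> polyanalytic_sum n F"
proof -
  have "C_diff n \<bbbU> F \<and> (\<forall>z\<in>\<bbbU>. (d_dzbar ^^ n) F z = 0) \<longleftrightarrow> polyanalytic_sum n F"
  proof
    assume "polyanalytic_sum n F"
    then show "C_diff n \<bbbU> F \<and> (\<forall>z\<in>\<bbbU>. (d_dzbar ^^ n) F z = 0)"
      using polyanalytic_sum_C_diff[of n F n] polyanalytic_sum_dzbar_power_zero[of n F] by auto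
  next
    assume "C_diff n \<bbbU> F \<and> (\<forall>z\<in>\<bbbU>. (d_dzbar ^^ n) F z = 0)"
    then show "polyanalytic_sum n F" using polyanalytic_sum_exists[of n F] by auto
  qed
  then show ?thesis by (simp add: poly_bergman_def)
qed

section \<open>A uniqueness theorem for polyanalytic Bergman functions\<close>

text \<open>
  On the circle of radius \<open>r\<close>, \<open>cnj \<zeta> = r\<^sup>2 / \<zeta>\<close>; Cauchy's formula therefore evaluates the integral of
  \<open>cnj \<zeta> ^ i * \<psi> \<zeta>\<close> as \<open>r\<^sup>2\<^sup>i\<close> times a Taylor coefficient of \<open>\<psi>\<close>.
\<close>

lemma circle_mean_polynomial:
  assumes \<psi>: "\<psi> holomorphic_on ball 0 1"
  obtains R :: "complex poly" where "degree R \<le> p" "poly R 0 = of_real (2 * pi) * \<psi> 0"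
    "\<And>r. 0 < r \<Longrightarrow> r < 1 \<Longrightarrow>
      ((\<lambda>t. (1 - of_real r * cis (- t)) ^ p * \<psi> (of_real r * cis t)) has_integral poly R (of_real (r\<^sup>2))) {0..2 * pi}"
proof -
  define c where "c i = (deriv ^^ i) \<psi> 0 / fact i" for i
  have moment: "((\<lambda>t. (of_real r * cis (- t)) ^ i * \<psi> (of_real r * cis t)) has_integral
      (of_real (2 * pi) * c i * of_real (r\<^sup>2) ^ i)) {0..2 * pi}" if r: "0 < r" "r < 1" for r i
  proof -
    have "((\<lambda>u. \<psi> u / (u - 0) ^ Suc i) has_contour_integral ((2 * pi * \<i>) / fact i * (deriv ^^ i) \<psi> 0)) (circlepath 0 r)"
    proof (rule Cauchy_has_contour_integral_higher_derivative_circlepath)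
      show "continuous_on (cball 0 r) \<psi>"
        using r by (intro holomorphic_on_imp_continuous_on holomorphic_on_subset[OF \<psi>]) auto
      show "\<psi> holomorphic_on ball 0 r" using r by (intro holomorphic_on_subset[OF \<psi>]) auto
    qed (use r in auto)
    then have "((\<lambda>t. \<psi> (0 + of_real r * cis t) / (0 + of_real r * cis t - 0) ^ Suc i * of_real r * \<i> * cis t)
        has_integral ((2 * pi * \<i>) / fact i * (deriv ^^ i) \<psi> 0)) {0..2 * pi}"
      unfolding circlepath_def by (subst (asm) has_contour_integral_part_circlepath_iff) auto
    then have "((\<lambda>t. (of_real (r\<^sup>2) ^ i / \<i>) * (\<psi> (0 + of_real r * cis t) / (0 + of_real r * cis t - 0) ^ Suc i * of_real r * \<i> * cis t))
        has_integral (of_real (r\<^sup>2) ^ i / \<i>) * ((2 * pi * \<i>) / fact i * (deriv ^^ i) \<psi> 0)) {0..2 * pi}"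
      by (rule has_integral_mult_right)
    also have "(of_real (r\<^sup>2) ^ i / \<i>) * ((2 * pi * \<i>) / fact i * (deriv ^^ i) \<psi> 0) = of_real (2 * pi) * c i * of_real (r\<^sup>2) ^ i"
      by (simp add: c_def field_simps)
    also have "(\<lambda>t. (of_real (r\<^sup>2) ^ i / \<i>) * (\<psi> (0 + of_real r * cis t) / (0 + of_real r * cis t - 0) ^ Suc i * of_real r * \<i> * cis t))
       = (\<lambda>t. (of_real r * cis (- t)) ^ i * \<psi> (of_real r * cis t))"
    proof (rule ext)
      fix t :: real
      define u where "u = of_real r * cis t"
      have u: "u \<noteq> 0" using r by (simp add: u_def)
      have "of_real (r\<^sup>2) = u * (of_real r * cis (- t))"
        by (simp add: u_def power2_eq_square cis_mult mult_ac)
      then have "of_real (r\<^sup>2) ^ i = u ^ i * (of_real r * cis (- t)) ^ i" by (simp add: power_mult_distrib)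
      moreover have "\<psi> (0 + of_real r * cis t) / (0 + of_real r * cis t - 0) ^ Suc i * of_real r * \<i> * cis t = \<i> * \<psi> u / u ^ i"
      proof -
        have 1: "A * of_real r * \<i> * cis t = A * \<i> * u" for A by (simp add: u_def)
        have 2: "\<psi> u / u ^ Suc i * \<i> * u = \<i> * \<psi> u / u ^ i" using u by (simp add: field_simps)
        show ?thesis unfolding 1 2[symmetric] by (simp add: u_def)
      qed
      ultimately show "(of_real (r\<^sup>2) ^ i / \<i>) * (\<psi> (0 + of_real r * cis t) / (0 + of_real r * cis t - 0) ^ Suc i * of_real r * \<i> * cis t)
         = (of_real r * cis (- t)) ^ i * \<psi> (of_real r * cis t)"
        using u by (simp only: u_def[symmetric]) (simp add: field_simps)
    qed
    finally show ?thesis .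
  qed
  define R where "R = (\<Sum>i\<le>p. monom (of_nat (p choose i) * (-1) ^ i * (of_real (2 * pi) * c i)) i)"
  have "degree R \<le> p"
    unfolding R_def by (intro degree_sum_le) (auto intro: order_trans[OF degree_monom_le])
  moreover have "poly R 0 = of_real (2 * pi) * \<psi> 0"
    unfolding R_def by (simp add: poly_sum poly_monom power_0_left c_def if_distrib cong: if_cong)
  moreover have "((\<lambda>t. (1 - of_real r * cis (- t)) ^ p * \<psi> (of_real r * cis t)) has_integral poly R (of_real (r\<^sup>2))) {0..2 * pi}"
    if r: "0 < r" "r < 1" for r
  proof -
    have "((\<lambda>t. \<Sum>i\<le>p. (of_nat (p choose i) * (-1) ^ i) * ((of_real r * cis (- t)) ^ i * \<psi> (of_real r * cis t))) has_integral
        (\<Sum>i\<le>p. (of_nat (p choose i) * (-1) ^ i) * (of_real (2 * pi) * c i * of_real (r\<^sup>2) ^ i))) {0..2 * pi}"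
      by (intro has_integral_sum has_integral_mult_right moment r) auto
    also have "(\<Sum>i\<le>p. (of_nat (p choose i) * (-1) ^ i) * (of_real (2 * pi) * c i * of_real (r\<^sup>2) ^ i)) = poly R (of_real (r\<^sup>2))"
      unfolding R_def by (simp add: poly_sum poly_monom mult_ac)
    also have "(\<lambda>t. \<Sum>i\<le>p. (of_nat (p choose i) * (-1) ^ i) * ((of_real r * cis (- t)) ^ i * \<psi> (of_real r * cis t)))
       = (\<lambda>t. (1 - of_real r * cis (- t)) ^ p * \<psi> (of_real r * cis t))"
    proof (rule ext)
      fix t :: real
      define x where "x = of_real r * cis (- t)"
      have "(1 - x) ^ p = (- x + 1) ^ p" by simp
      also have "\<dots> = (\<Sum>i\<le>p. of_nat (p choose i) * (- x) ^ i)" unfolding binomial_ring by simp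
      also have "\<dots> = (\<Sum>i\<le>p. of_nat (p choose i) * (-1) ^ i * x ^ i)" by (simp add: power_minus[of x] mult.assoc)
      finally show "(\<Sum>i\<le>p. (of_nat (p choose i) * (-1) ^ i) * ((of_real r * cis (- t)) ^ i * \<psi> (of_real r * cis t)))
         = (1 - of_real r * cis (- t)) ^ p * \<psi> (of_real r * cis t)"
        by (simp add: x_def sum_distrib_right mult.assoc)
    qed
    finally show ?thesis .
  qed
  ultimately show ?thesis by (rule that)
qed

text \<open>
  The powers of \<open>1 - \<rho>\<close>, with \<open>\<rho> = exp (2 x)\<close>, span the polynomials of degree at most \<open>n\<close>, in
  particular the conjugate of \<open>q\<close>. So the weighted integral of \<open>\<bar>q\<bar>\<^sup>2\<close> vanishes, and \<open>q\<close> has infinitely many roots.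
\<close>

lemma polynomial_orthogonal_zero:
  fixes q :: "complex poly"
  assumes deg: "degree q \<le> n"
    and int: "\<And>j. j \<le> n \<Longrightarrow> integrable lborel (\<lambda>x. indicator {..<0} x *\<^sub>R (of_real (exp (2 * x) * (1 - exp (2 * x)) ^ j) * poly q (of_real (exp (2 * x)))))"
    and zero: "\<And>j. j \<le> n \<Longrightarrow> (LINT x|lborel. indicator {..<0} x *\<^sub>R (of_real (exp (2 * x) * (1 - exp (2 * x)) ^ j) * poly q (of_real (exp (2 * x))))) = 0"
  shows "q = 0"
proof -
  \<comment> \<open>The conjugate of \<open>q\<close>, as a polynomial in \<open>1 - \<rho>\<close> instead of \<open>\<rho>\<close>.\<close>
  define q' where "q' = pcompose (map_poly cnj q) [:1, -1:]"
  have deg': "degree q' \<le> n"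
    unfolding q'_def using degree_pcompose_le[of "map_poly cnj q" "[:1, -1:]"] map_poly_degree_leq[of cnj q] deg by simp
  have cnjq: "poly (map_poly cnj q) (of_real y) = cnj (poly q (of_real y))" for y
    by (induction q) (auto simp: map_poly_pCons)
  have q'1: "poly q' (of_real (1 - y)) = cnj (poly q (of_real y))" for y
  proof -
    have "poly q' (of_real (1 - y)) = poly (map_poly cnj q) (of_real y)"
      unfolding q'_def poly_pcompose by (rule arg_cong[where f="poly _"]) simp
    then show ?thesis by (simp only: cnjq)
  qed
  have exp: "(\<Sum>j\<le>n. coeff q' j * of_real ((1 - y) ^ j)) = cnj (poly q (of_real y))" for y
    unfolding q'1[symmetric] poly_altdef[of q']
    by (intro sum.mono_neutral_cong_right) (use deg' in \<open>auto simp: coeff_eq_0\<close>)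
  define f where "f j x = indicator {..<0} x *\<^sub>R (of_real (exp (2 * x) * (1 - exp (2 * x)) ^ j) * poly q (of_real (exp (2 * x))))" for j and x :: real
  have fi: "integrable lborel (f j)" and fz: "(LINT x|lborel. f j x) = 0" if "j \<le> n" for j
    unfolding f_def[abs_def] using int[OF that] zero[OF that] by simp_all
  have "(\<Sum>j\<le>n. coeff q' j * f j x) = of_real (indicator {..<0} x * exp (2 * x) * (cmod (poly q (of_real (exp (2 * x)))))\<^sup>2)" for x
  proof -
    have "(\<Sum>j\<le>n. coeff q' j * f j x) =
       indicator {..<0} x *\<^sub>R (of_real (exp (2 * x)) * poly q (of_real (exp (2 * x))) * (\<Sum>j\<le>n. coeff q' j * of_real ((1 - exp (2 * x)) ^ j)))"
      unfolding f_def by (simp add: sum_distrib_left scaleR_sum_right mult_ac indicator_def)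
    also have "\<dots> = indicator {..<0} x *\<^sub>R (of_real (exp (2 * x)) * (poly q (of_real (exp (2 * x))) * cnj (poly q (of_real (exp (2 * x))))))"
      unfolding exp by (simp only: mult.assoc)
    also have "\<dots> = of_real (indicator {..<0} x * exp (2 * x) * (cmod (poly q (of_real (exp (2 * x)))))\<^sup>2)"
      unfolding complex_norm_square[symmetric] by (simp add: scaleR_conv_of_real)
    finally show ?thesis .
  qed
  note e = this
  define h where "h x = indicator {..<0} x * exp (2 * x) * (cmod (poly q (of_real (exp (2 * x)))))\<^sup>2" for x :: real
  have i: "integrable lborel (\<lambda>x. complex_of_real (h x))"
    unfolding h_def e[symmetric] by (intro Bochner_Integration.integrable_sum integrable_mult_right fi) simp
  have "(LINT x|lborel. complex_of_real (h x)) = (\<Sum>j\<le>n. coeff q' j * (LINT x|lborel. f j x))"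
    unfolding h_def e[symmetric] by (subst Bochner_Integration.integral_sum) (auto intro!: integrable_mult_right fi)
  also have "\<dots> = 0" using fz by simp
  finally have z: "(LINT x|lborel. h x) = 0" by (simp only: integral_complex_of_real of_real_eq_0_iff)
  have i2: "integrable lborel h" using integrable_Re[OF i] by simp
  have "AE x in lborel. h x = 0"
    using integral_nonneg_eq_0_iff_AE[OF i2] z by (auto simp: h_def)
  then have ae: "AE x in lborel. x < 0 \<longrightarrow> poly q (of_real (exp (2 * x))) = 0"
    by eventually_elim (auto simp: h_def indicator_def)
  show ?thesis
  proof (rule ccontr)
    assume "q \<noteq> 0"
    then have "finite {x. poly q x = 0}" by (rule poly_roots_finite)
    then have "finite ((\<lambda>x. of_real (exp (2 * x)) :: complex) -` {x. poly q x = 0})"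
      by (rule finite_vimageI) (auto simp: inj_on_def)
    then have "countable {x. poly q (of_real (exp (2 * x))) = 0}" by (simp add: vimage_def countable_finite)
    from AE_not_in[OF countable_imp_null_set_lborel[OF this]] ae
    have "AE x in lborel. x \<notin> {..<0::real}" by eventually_elim auto
    then have "emeasure lborel {..<0::real} = 0" by (subst (asm) AE_iff_measurable[OF _ refl]) (auto simp: lessThan_def)
    moreover have "emeasure lborel {-1..<0::real} \<le> emeasure lborel {..<0::real}" by (intro emeasure_mono) auto
    ultimately show False by simp
  qed
qed

text \<open>
  The Moebius map from the unit disc onto the upper half-plane that sends \<open>0\<close> to a point \<open>w\<close> of the half-plane.
\<close>

definition disc_map :: "complex \<Rightarrow> complex \<Rightarrow> complex"
  where "disc_map w \<zeta> = (w - cnj w * \<zeta>) / (1 - \<zeta>)"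

lemma disc_map_identities:
  assumes \<zeta>: "cmod \<zeta> < 1"
  shows "1 - \<zeta> \<noteq> 0" "1 - cnj \<zeta> \<noteq> 0"
    and "disc_map w \<zeta> - cnj w = 2 * \<i> * of_real (Im w) / (1 - \<zeta>)"
    and "cnj (disc_map w \<zeta>) - w = - (2 * \<i> * of_real (Im w)) / (1 - cnj \<zeta>)"
    and "of_real (Im (disc_map w \<zeta>)) = of_real (Im w) * (1 - \<zeta> * cnj \<zeta>) / ((1 - \<zeta>) * (1 - cnj \<zeta>))"
    and "disc_map w \<zeta> - w = 2 * \<i> * of_real (Im w) * \<zeta> / (1 - \<zeta>)"
proof -
  show n: "1 - \<zeta> \<noteq> 0" using \<zeta> by auto
  show n': "1 - cnj \<zeta> \<noteq> 0" using n by (metis complex_cnj_cancel_iff complex_cnj_diff complex_cnj_one complex_cnj_zero complex_cnj_cnj)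
  have d: "w - cnj w = 2 * \<i> * of_real (Im w)" by (simp add: complex_eq_iff)
  show 1: "disc_map w \<zeta> - cnj w = 2 * \<i> * of_real (Im w) / (1 - \<zeta>)"
    unfolding d[symmetric] disc_map_def using n by (simp add: field_simps)
  show 2: "cnj (disc_map w \<zeta>) - w = - (2 * \<i> * of_real (Im w)) / (1 - cnj \<zeta>)"
    using arg_cong[OF 1, of cnj] by simp
  show "disc_map w \<zeta> - w = 2 * \<i> * of_real (Im w) * \<zeta> / (1 - \<zeta>)"
    unfolding d[symmetric] disc_map_def using n by (simp add: field_simps)
  have "2 * \<i> * of_real (Im (disc_map w \<zeta>)) = disc_map w \<zeta> - cnj (disc_map w \<zeta>)" by (simp add: complex_eq_iff)
  also have "\<dots> = (disc_map w \<zeta> - cnj w) - (cnj (disc_map w \<zeta>) - w) - (w - cnj w)" by simp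
  also have "\<dots> = 2 * \<i> * (of_real (Im w) * (1 - \<zeta> * cnj \<zeta>) / ((1 - \<zeta>) * (1 - cnj \<zeta>)))"
  proof -
    have m: "1 - \<zeta> * cnj \<zeta> = (1 - \<zeta>) + (1 - cnj \<zeta>) - (1 - \<zeta>) * (1 - cnj \<zeta>)" by (simp add: algebra_simps)
    have "c / p - (- c) / p' - c = 2 * \<i> * (a * (p + p' - p * p') / (p * p'))"
      if "p \<noteq> 0" "p' \<noteq> 0" "c = 2 * \<i> * a" for c a p p' :: complex
      using that by (simp add: field_simps)
    from this[OF n n' refl] show ?thesis unfolding 1 2 d m .
  qed
  finally have e: "2 * \<i> * of_real (Im (disc_map w \<zeta>)) = 2 * \<i> * (of_real (Im w) * (1 - \<zeta> * cnj \<zeta>) / ((1 - \<zeta>) * (1 - cnj \<zeta>)))" .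
  have "2 * \<i> \<noteq> (0::complex)" by simp
  from e show "of_real (Im (disc_map w \<zeta>)) = of_real (Im w) * (1 - \<zeta> * cnj \<zeta>) / ((1 - \<zeta>) * (1 - cnj \<zeta>))"
    by (simp only: mult_left_cancel[OF \<open>2 * \<i> \<noteq> (0::complex)\<close>])
qed

lemma Im_disc_map_pos:
  assumes "cmod \<zeta> < 1" "Im w > 0"
  shows "Im (disc_map w \<zeta>) > 0"
proof -
  have "complex_of_real (Im (disc_map w \<zeta>)) = of_real (Im w * (1 - (cmod \<zeta>)\<^sup>2) / (cmod (1 - \<zeta>))\<^sup>2)"
    unfolding disc_map_identities(5)[OF assms(1)] of_real_divide of_real_mult of_real_diff complex_norm_square
    by simp
  then have "Im (disc_map w \<zeta>) = Im w * (1 - (cmod \<zeta>)\<^sup>2) / (cmod (1 - \<zeta>))\<^sup>2" by (simp only: of_real_eq_iff)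
  moreover have "(cmod \<zeta>)\<^sup>2 < 1" using assms(1) by (simp add: power_less_one_iff abs_square_less_1)
  ultimately show ?thesis using assms disc_map_identities(1)[OF assms(1)] by simp
qed

text \<open>
  Logarithmic polar coordinates of the punctured unit disc: \<open>exp\<close> is holomorphic and injective here, so
  that a single holomorphic change of variables covers both the Moebius map and polar coordinates.
\<close>

definition strip :: "complex set"
  where "strip = {\<omega>. Re \<omega> < 0 \<and> 0 \<le> Im \<omega> \<and> Im \<omega> < 2 * pi}"

lemma strip_borel: "strip \<in> sets borel"
proof -
  have "strip = {\<omega>. Re \<omega> < 0} \<inter> {\<omega>. 0 \<le> Im \<omega>} \<inter> {\<omega>. Im \<omega> < 2 * pi}" by (auto simp: strip_def)
  also have "\<dots> \<in> sets borel"
    by (intro sets.Int borel_open borel_closed open_Collect_less closed_Collect_le continuous_intros)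
  finally show ?thesis .
qed

lemma disc_map_exp_bij:
  assumes w: "Im w > 0"
  shows "inj_on (\<lambda>\<omega>. disc_map w (exp \<omega>)) strip" "(\<lambda>\<omega>. disc_map w (exp \<omega>)) ` strip = \<bbbU> - {w}"
proof -
  have lt: "cmod (exp \<omega>) < 1" if "\<omega> \<in> strip" for \<omega> using that by (simp add: strip_def)
  show "inj_on (\<lambda>\<omega>. disc_map w (exp \<omega>)) strip"
  proof (rule inj_onI)
    fix a b assume a: "a \<in> strip" and b: "b \<in> strip" and eq: "disc_map w (exp a) = disc_map w (exp b)"
    have "2 * \<i> * of_real (Im w) / (1 - exp a) = 2 * \<i> * of_real (Im w) / (1 - exp b)"
      by (simp only: disc_map_identities(3)[OF lt[OF a], of w, symmetric] disc_map_identities(3)[OF lt[OF b], of w, symmetric] eq)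
    moreover have "Im w \<noteq> 0" using w by simp
    ultimately have "exp a = exp b"
      using disc_map_identities(1)[OF lt[OF a]] disc_map_identities(1)[OF lt[OF b]] by (simp add: field_simps)
    moreover have "\<bar>Im a - Im b\<bar> < 2 * pi"
      using a b unfolding strip_def by (simp add: abs_less_iff)
    ultimately show "a = b" by (simp only: exp_complex_eqI)
  qed
  show "(\<lambda>\<omega>. disc_map w (exp \<omega>)) ` strip = \<bbbU> - {w}"
  proof (intro equalityI subsetI)
    fix z assume "z \<in> (\<lambda>\<omega>. disc_map w (exp \<omega>)) ` strip"
    then obtain \<omega> where \<omega>: "\<omega> \<in> strip" "z = disc_map w (exp \<omega>)" by auto
    have "z - w \<noteq> 0" unfolding \<omega>(2) disc_map_identities(6)[OF lt[OF \<omega>(1)]]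
      using w disc_map_identities(1)[OF lt[OF \<omega>(1)]] by simp
    then show "z \<in> \<bbbU> - {w}" using Im_disc_map_pos[OF lt[OF \<omega>(1)] w] \<omega>(2) by (simp add: upper_half_plane_iff)
  next
    fix z assume z: "z \<in> \<bbbU> - {w}"
    define \<zeta> where "\<zeta> = (z - w) / (z - cnj w)"
    have Imz: "Im z > 0" using z by (simp add: upper_half_plane_iff)
    have ne: "z - cnj w \<noteq> 0" using Imz w by (auto simp: complex_eq_iff)
    have "cmod (z - w) < cmod (z - cnj w)"
    proof (rule power2_less_imp_less)
      have "(cmod (z - cnj w))\<^sup>2 - (cmod (z - w))\<^sup>2 = 4 * Im z * Im w"
        unfolding cmod_power2 by (simp add: power2_eq_square algebra_simps)
      then show "(cmod (z - w))\<^sup>2 < (cmod (z - cnj w))\<^sup>2" using Imz w by (smt (verit) mult_pos_pos)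
    qed simp
    then have l1: "cmod \<zeta> < 1" using ne by (simp add: \<zeta>_def norm_divide)
    have n0: "\<zeta> \<noteq> 0" using z ne by (simp add: \<zeta>_def)
    define \<omega> where "\<omega> = Complex (ln (cmod \<zeta>)) (Arg2pi \<zeta>)"
    have "exp \<omega> = of_real (cmod \<zeta>) * exp (\<i> * of_real (Arg2pi \<zeta>))"
      unfolding \<omega>_def Complex_eq exp_add using n0 by (simp add: exp_of_real)
    then have e: "exp \<omega> = \<zeta>" using Arg2pi_eq[of \<zeta>] by simp
    have "\<omega> \<in> strip" using l1 n0 Arg2pi_ge_0[of \<zeta>] Arg2pi_lt_2pi[of \<zeta>] by (simp add: strip_def \<omega>_def)
    moreover have "disc_map w \<zeta> = z"
    proof -
      have 1: "1 - \<zeta> = (w - cnj w) / (z - cnj w)" using ne by (simp add: \<zeta>_def field_simps)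
      have 2: "w - cnj w * \<zeta> = z * ((w - cnj w) / (z - cnj w))" using ne by (simp add: \<zeta>_def field_simps)
      have "w - cnj w \<noteq> 0" using w by (auto simp: complex_eq_iff)
      then show ?thesis unfolding disc_map_def 1 2 using ne by simp
    qed
    ultimately show "z \<in> (\<lambda>\<omega>. disc_map w (exp \<omega>)) ` strip" using e by force
  qed
qed

lemma disc_map_exp_deriv:
  assumes "Re \<omega> < 0"
  shows "((\<lambda>\<omega>. disc_map w (exp \<omega>)) has_field_derivative (2 * \<i> * of_real (Im w) * exp \<omega> / (1 - exp \<omega>)\<^sup>2)) (at \<omega> within S)"
proof -
  have n: "1 - exp \<omega> \<noteq> 0" using disc_map_identities(1)[of "exp \<omega>"] assms by simp
  have d: "2 * \<i> * of_real (Im w) = w - cnj w" by (simp add: complex_eq_iff)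
  show ?thesis unfolding disc_map_def d
    by (rule derivative_eq_intros refl n)+ (use n in \<open>simp add: field_simps power2_eq_square\<close>)
qed

lemma disc_map_holomorphic: "disc_map w holomorphic_on ball 0 1"
  unfolding disc_map_def by (intro holomorphic_intros) auto

text \<open>
  Chosen such that, after conjugation and pullback to the disc, only a power of \<open>cnj (1 - \<zeta>)\<close> and a
  holomorphic factor remain besides powers of \<open>1 - \<bar>\<zeta>\<bar>\<^sup>2\<close>.
\<close>

definition bergman_test :: "nat \<Rightarrow> complex \<Rightarrow> nat \<Rightarrow> complex \<Rightarrow> complex"
  where "bergman_test n w j z = of_real (Im z) ^ j * (cnj z - w) ^ (n - j) / (z - cnj w) ^ (n + j + 2)"

text \<open>
  In the \<open>k\<close>-th term the power of \<open>1 - cnj \<zeta>\<close> from the test function absorbs the negative power coming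
  from \<open>(Im z)\<^sup>k\<close>. The remaining exponent \<open>n - k\<close> and the \<open>k\<close> factors \<open>1 - \<bar>\<zeta>\<bar>\<^sup>2\<close> together keep the
  degree of the circle integrals at most \<open>n\<close>.
\<close>

lemma bergman_test_pullback:
  assumes \<zeta>: "cmod \<zeta> < 1" and w: "Im w > 0" and j: "j \<le> n"
    and G: "G (disc_map w \<zeta>) = (\<Sum>k\<le>n. of_real (Im (disc_map w \<zeta>)) ^ k * \<phi> k (disc_map w \<zeta>))"
  defines "d \<equiv> 2 * \<i> * of_real (Im w)"
  shows "of_real ((cmod (d * \<zeta> / (1 - \<zeta>)\<^sup>2))\<^sup>2) * (G (disc_map w \<zeta>) * cnj (bergman_test n w j (disc_map w \<zeta>)))
    = (of_real (Im w) ^ j * d ^ (n - j) * d * (- d) / (- d) ^ (n + j + 2)) *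
      (\<zeta> * cnj \<zeta> * (1 - \<zeta> * cnj \<zeta>) ^ j *
        (\<Sum>k\<le>n. (1 - \<zeta> * cnj \<zeta>) ^ k * ((1 - cnj \<zeta>) ^ (n - k) *
           (of_real (Im w) ^ k * \<phi> k (disc_map w \<zeta>) / (1 - \<zeta>) ^ (n + 2 + k)))))"
proof -
  define p where "p = 1 - \<zeta>"
  define p' where "p' = 1 - cnj \<zeta>"
  define m where "m = 1 - \<zeta> * cnj \<zeta>"
  define v where "v = complex_of_real (Im w)"
  define z where "z = disc_map w \<zeta>"
  note id = disc_map_identities(3-5)[OF \<zeta>, of w, folded p_def p'_def m_def v_def z_def d_def]
  have p0: "p \<noteq> 0" and p'0: "p' \<noteq> 0" using disc_map_identities(1,2)[OF \<zeta>] by (auto simp: p_def p'_def)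
  have d0: "d \<noteq> 0" using w by (simp add: d_def)
  have cnjp: "cnj p = p'" by (simp add: p_def p'_def)
  have cnjd: "cnj d = - d" by (simp add: d_def)
  have s: "of_real (Im z) = v * m / (p * p')" using id(3) by simp
  have z1: "z - cnj w = d / p" and z2: "cnj z - w = - d / p'" using id(1,2) by (auto simp: d_def v_def)
  have J: "of_real ((cmod (d * \<zeta> / p\<^sup>2))\<^sup>2) = d * (- d) * (\<zeta> * cnj \<zeta>) / (p\<^sup>2 * p'\<^sup>2)"
    unfolding complex_norm_square by (simp add: cnjp cnjd)
  have ct: "cnj (bergman_test n w j z) = of_real (Im z) ^ j * (z - cnj w) ^ (n - j) / (cnj z - w) ^ (n + j + 2)"
    by (simp add: bergman_test_def)
  have ct': "cnj (bergman_test n w j z) = v ^ j * m ^ j * d ^ (n - j) / (- d) ^ (n + j + 2) * (p' ^ (n + 2) / p ^ n)"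
  proof -
    have e: "p ^ n = p ^ j * p ^ (n - j)" "p' ^ (n + j + 2) = p' ^ j * p' ^ (n + 2)"
      using j by (simp_all add: add_ac flip: power_add)
    show ?thesis
      unfolding ct s z1 z2 power_divide power_mult_distrib e using p0 p'0 d0 by (simp add: field_simps)
  qed
  have Gz: "G z = (\<Sum>k\<le>n. m ^ k * (v ^ k * \<phi> k z) / (p ^ k * p' ^ k))"
    using G unfolding z_def[symmetric] s power_divide power_mult_distrib by (simp add: mult_ac)
  have K: "(p' ^ (n + 2) / p ^ n) / (p\<^sup>2 * p'\<^sup>2) * G z = (\<Sum>k\<le>n. m ^ k * (p' ^ (n - k) * (v ^ k * \<phi> k z / p ^ (n + 2 + k))))"
    unfolding Gz sum_distrib_left
  proof (intro sum.cong refl)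
    fix k assume "k \<in> {..n}"
    then have e: "p' ^ (n + 2) = p' ^ (n - k) * p' ^ k * p'\<^sup>2" by (simp flip: power_add)
    have e2: "p ^ (n + 2 + k) = p ^ n * p\<^sup>2 * p ^ k" by (simp add: power_add power2_eq_square)
    show "(p' ^ (n + 2) / p ^ n) / (p\<^sup>2 * p'\<^sup>2) * (m ^ k * (v ^ k * \<phi> k z) / (p ^ k * p' ^ k))
       = m ^ k * (p' ^ (n - k) * (v ^ k * \<phi> k z / p ^ (n + 2 + k)))"
    proof -
      have "(A * B * C / N) / (P * C) * (M * V / (Q * B)) = M * (A * (V / (N * P * Q)))"
        if "B \<noteq> 0" "C \<noteq> 0" for A B C N P M V Q :: complex
        using that by (simp add: mult_ac)
      then show ?thesis unfolding e e2 using p'0 by simp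
    qed
  qed
  have "of_real ((cmod (d * \<zeta> / p\<^sup>2))\<^sup>2) * (G z * cnj (bergman_test n w j z)) =
    (v ^ j * d ^ (n - j) * d * (- d) / (- d) ^ (n + j + 2)) * (\<zeta> * cnj \<zeta> * m ^ j * ((p' ^ (n + 2) / p ^ n) / (p\<^sup>2 * p'\<^sup>2) * G z))"
    unfolding J ct' by (simp add: mult_ac)
  then show ?thesis unfolding K unfolding p_def p'_def m_def v_def z_def .
qed

text \<open>
  In logarithmic polar coordinates about \<open>w\<close>, orthogonality to the \<open>j\<close>-th test function says that
  the circle integrals of \<open>G\<close>, a polynomial \<open>q\<close> in the squared radius \<open>\<rho>\<close>, are orthogonal to
  \<open>(1 - \<rho>)\<^sup>j\<close>; hence \<open>q = 0\<close>. Its constant term is \<open>2 pi G w\<close>.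
\<close>

theorem bergman_uniqueness:
  assumes \<phi>: "\<And>k. \<phi> k holomorphic_on \<bbbU>"
    and G: "\<And>z. z \<in> \<bbbU> \<Longrightarrow> G z = (\<Sum>k\<le>n. of_real (Im z) ^ k * \<phi> k z)"
    and GL: "G \<in> L2 half_plane"
    and w: "w \<in> \<bbbU>"
    and tL: "\<And>j. j \<le> n \<Longrightarrow> bergman_test n w j \<in> L2 half_plane"
    and orth: "\<And>j. j \<le> n \<Longrightarrow> l2_inner half_plane G (bergman_test n w j) = 0"
  shows "G w = 0"
proof -
  have v: "Im w > 0" using w by (simp add: upper_half_plane_iff)
  define d where "d = 2 * \<i> * complex_of_real (Im w)"
  have d0: "d \<noteq> 0" using v by (simp add: d_def)
  define g where "g \<omega> = disc_map w (exp \<omega>)" for \<omega>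
  define g' where "g' \<omega> = d * exp \<omega> / (1 - exp \<omega>)\<^sup>2" for \<omega>
  define H where "H j z = G z * cnj (bergman_test n w j z)" for j z
  have lt: "cmod (exp \<omega>) < 1" if "\<omega> \<in> strip" for \<omega> using that by (simp add: strip_def)
  have n0: "1 - exp \<omega> \<noteq> 0" if "\<omega> \<in> strip" for \<omega> using disc_map_identities(1)[OF lt[OF that]] .
  note inj = disc_map_exp_bij(1)[OF v, folded g_def] and img = disc_map_exp_bij(2)[OF v, folded g_def]
  have contG: "continuous_on \<bbbU> G"
    by (rule polyanalytic_sum_continuous[of "Suc n"])
      (auto simp: polyanalytic_sum_def lessThan_Suc_atMost G intro!: exI[of _ \<phi>] \<phi>)
  have nz: "z - cnj w \<noteq> 0" "cnj z - w \<noteq> 0" if "z \<in> \<bbbU>" for z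
    using that v by (auto simp: upper_half_plane_iff complex_eq_iff)
  have contH: "continuous_on \<bbbU> (H j)" for j
    unfolding H_def bergman_test_def using nz by (intro continuous_intros contG) auto
  have inth: "set_integrable lborel (\<bbbU> - {w}) (H j)" and zeroh: "(LINT z:\<bbbU> - {w}|lborel. H j z) = 0" if j: "j \<le> n" for j
  proof -
    have "integrable half_plane (H j)" unfolding H_def by (rule L2_inner_integrable[OF GL tL[OF j]])
    then have i: "set_integrable lborel \<bbbU> (H j)" using upper_half_plane_integrable_iff[OF contH] by simp
    then show i2: "set_integrable lborel (\<bbbU> - {w}) (H j)"
      by (rule set_integrable_subset) (use upper_half_plane_borel in auto)
    have "(LINT z:\<bbbU> - {w}|lborel. H j z) = (LINT z:\<bbbU>|lborel. H j z)"
    proof (rule set_integral_cong_set)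
      show "AE z in lborel. (z \<in> \<bbbU>) = (z \<in> \<bbbU> - {w})"
        using AE_lborel_singleton[of w] by eventually_elim auto
    qed (use i i2 in \<open>auto simp: set_borel_measurable_def set_integrable_def integrable_iff_bounded\<close>)
    also have "\<dots> = l2_inner half_plane G (bergman_test n w j)"
      unfolding l2_inner_def upper_half_plane_integral[OF contH, symmetric] by (simp add: H_def[abs_def])
    finally show "(LINT z:\<bbbU> - {w}|lborel. H j z) = 0" using orth[OF j] by simp
  qed
  have contP: "continuous_on strip (\<lambda>\<omega>. of_real ((cmod (g' \<omega>))\<^sup>2) * H j (g \<omega>))" for j
  proof -
    have "continuous_on strip g" unfolding g_def disc_map_def using n0 by (intro continuous_intros) auto
    then have "continuous_on strip (\<lambda>\<omega>. H j (g \<omega>))"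
      by (rule continuous_on_compose2[OF contH]) (use img in auto)
    moreover have "continuous_on strip g'" unfolding g'_def using n0 by (intro continuous_intros) auto
    ultimately show ?thesis by (intro continuous_intros)
  qed
  have mP: "set_borel_measurable borel strip (\<lambda>\<omega>. of_real ((cmod (g' \<omega>))\<^sup>2) * H j (g \<omega>))" for j
    unfolding set_borel_measurable_def using borel_measurable_continuous_on_indicator[OF strip_borel contP] .
  have der: "(g has_field_derivative g' \<omega>) (at \<omega> within strip)" if "\<omega> \<in> strip" for \<omega>
    unfolding g_def g'_def d_def by (rule disc_map_exp_deriv) (use that in \<open>simp add: strip_def\<close>)
  have imgb: "g ` strip \<in> sets borel" unfolding img using upper_half_plane_borel by simp
  \<comment> \<open>The holomorphic factor of the \<open>k\<close>-th term after pullback to the disc.\<close>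
  define \<psi> where "\<psi> k \<zeta> = of_real (Im w) ^ k * \<phi> k (disc_map w \<zeta>) / (1 - \<zeta>) ^ (n + 2 + k)" for k \<zeta>
  define K where "K j \<zeta> = \<zeta> * cnj \<zeta> * (1 - \<zeta> * cnj \<zeta>) ^ j *
      (\<Sum>k\<le>n. (1 - \<zeta> * cnj \<zeta>) ^ k * ((1 - cnj \<zeta>) ^ (n - k) * \<psi> k \<zeta>))" for j \<zeta>
  define C where "C j = of_real (Im w) ^ j * d ^ (n - j) * d * (- d) / (- d) ^ (n + j + 2)" for j
  have C0: "C j \<noteq> 0" for j using d0 v by (simp add: C_def)
  have PK: "of_real ((cmod (g' \<omega>))\<^sup>2) * H j (g \<omega>) = C j * K j (exp \<omega>)" if "\<omega> \<in> strip" "j \<le> n" for \<omega> j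
    unfolding g'_def H_def g_def C_def K_def \<psi>_def d_def
    by (rule bergman_test_pullback[OF lt[OF that(1)] v that(2)], rule G)
       (use Im_disc_map_pos[OF lt[OF that(1)] v] in \<open>simp add: upper_half_plane_iff\<close>)
  have intK: "integrable lborel (\<lambda>\<omega>. indicator strip \<omega> *\<^sub>R K j (exp \<omega>))"
    and zeroK: "(LINT \<omega>|lborel. indicator strip \<omega> *\<^sub>R K j (exp \<omega>)) = 0" if j: "j \<le> n" for j
  proof -
    note cov = holomorphic_change_of_variables[OF strip_borel imgb der inj mP, unfolded img, OF _ inth[OF j]]
    have e: "indicator strip \<omega> *\<^sub>R K j (exp \<omega>) = (1 / C j) * (indicator strip \<omega> *\<^sub>R (of_real ((cmod (g' \<omega>))\<^sup>2) * H j (g \<omega>)))" for \<omega>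
      using PK[OF _ j] C0[of j] by (auto simp: indicator_def)
    show "integrable lborel (\<lambda>\<omega>. indicator strip \<omega> *\<^sub>R K j (exp \<omega>))"
      unfolding e using cov(1) unfolding set_integrable_def by (intro integrable_mult_right) simp
    show "(LINT \<omega>|lborel. indicator strip \<omega> *\<^sub>R K j (exp \<omega>)) = 0"
      unfolding e using cov(2) zeroh[OF j] unfolding set_lebesgue_integral_def by (subst integral_mult_right_zero) simp
  qed
  have \<psi>h: "\<psi> k holomorphic_on ball 0 1" for k
  proof -
    have "(\<phi> k \<circ> disc_map w) holomorphic_on ball 0 1"
      by (rule holomorphic_on_compose_gen[OF disc_map_holomorphic \<phi>])
         (use Im_disc_map_pos v in \<open>auto simp: upper_half_plane_iff\<close>)
    then show ?thesis unfolding \<psi>_def o_def by (intro holomorphic_intros) auto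
  qed
  define is_mean where "is_mean k R \<longleftrightarrow> degree R \<le> n - k \<and> poly R 0 = of_real (2 * pi) * \<psi> k 0 \<and>
      (\<forall>r. 0 < r \<longrightarrow> r < 1 \<longrightarrow> ((\<lambda>t. (1 - of_real r * cis (- t)) ^ (n - k) * \<psi> k (of_real r * cis t)) has_integral poly R (of_real (r\<^sup>2))) {0..2 * pi})" for k R
  have "\<exists>R. is_mean k R" for k
    unfolding is_mean_def
  proof -
    obtain R where "degree R \<le> n - k" "poly R 0 = of_real (2 * pi) * \<psi> k 0"
      "\<And>r. 0 < r \<Longrightarrow> r < 1 \<Longrightarrow> ((\<lambda>t. (1 - of_real r * cis (- t)) ^ (n - k) * \<psi> k (of_real r * cis t)) has_integral poly R (of_real (r\<^sup>2))) {0..2 * pi}"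
      by (rule circle_mean_polynomial[OF \<psi>h[of k], of "n - k"]) (rule that; assumption)
    then show "\<exists>R. degree R \<le> n - k \<and> poly R 0 = of_real (2 * pi) * \<psi> k 0 \<and>
      (\<forall>r. 0 < r \<longrightarrow> r < 1 \<longrightarrow> ((\<lambda>t. (1 - of_real r * cis (- t)) ^ (n - k) * \<psi> k (of_real r * cis t)) has_integral poly R (of_real (r\<^sup>2))) {0..2 * pi})" by (intro exI[of _ R] conjI allI impI)
  qed
  then obtain R where R': "\<And>k. is_mean k (R k)" by metis
  have R: "degree (R k) \<le> n - k" "poly (R k) 0 = of_real (2 * pi) * \<psi> k 0"
     "0 < r \<Longrightarrow> r < 1 \<Longrightarrow> ((\<lambda>t. (1 - of_real r * cis (- t)) ^ (n - k) * \<psi> k (of_real r * cis t)) has_integral poly (R k) (of_real (r\<^sup>2))) {0..2 * pi}" for k r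
    using R'[of k] unfolding is_mean_def by blast+
  \<comment> \<open>The integral of the pulled-back \<open>G\<close> over a circle, as a polynomial in the squared radius.\<close>
  define q where "q = (\<Sum>k\<le>n. [:1, -1:] ^ k * R k)"
  have degq: "degree q \<le> n"
    unfolding q_def
  proof (rule degree_sum_le)
    fix k assume k: "k \<in> {..n}"
    have "degree ([:1, -1:] ^ k * R k) \<le> degree ([:1, -1:] ^ k :: complex poly) + degree (R k)" by (rule degree_mult_le)
    also have "\<dots> \<le> k + (n - k)"
      using degree_power_le[of "[:1, -1:] :: complex poly" k] R(1)[of k] by (intro add_mono) auto
    finally show "degree ([:1, -1:] ^ k * R k) \<le> n" using k by simp
  qed simp
  \<comment> \<open>For fixed \<open>x\<close> the variable \<open>y\<close> runs once around the circle of radius \<open>exp x\<close>.\<close>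
  have inner: "(LINT y|lborel. indicator strip (Complex x y) *\<^sub>R K j (exp (Complex x y))) =
     indicator {..<0} x *\<^sub>R (of_real (exp (2 * x) * (1 - exp (2 * x)) ^ j) * poly q (of_real (exp (2 * x))))" for x j
  proof (cases "x < 0")
    case False
    then show ?thesis by (simp add: strip_def)
  next
    case True
    define r where "r = exp x"
    have r: "0 < r" "r < 1" using True by (auto simp: r_def)
    have r2: "exp (2 * x) = r\<^sup>2" by (simp add: r_def power2_eq_square exp_add[symmetric])
    define f where "f y = of_real (r\<^sup>2 * (1 - r\<^sup>2) ^ j) *
       (\<Sum>k\<le>n. of_real (1 - r\<^sup>2) ^ k * ((1 - of_real r * cis (- y)) ^ (n - k) * \<psi> k (of_real r * cis y)))" for y
    have Kf: "K j (exp (Complex x y)) = f y" for y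
    proof -
      have e: "exp (Complex x y) = of_real r * cis y" by (simp add: exp_eq_polar r_def exp_of_real)
      have ec: "cnj (of_real r * cis y) = of_real r * cis (- y)" by (simp add: cis_cnj)
      have ee: "(of_real r * cis y) * cnj (of_real r * cis y) = of_real (r\<^sup>2)"
        unfolding complex_norm_square[symmetric] by (simp add: norm_mult)
      have "K j (exp (Complex x y)) = of_real (r\<^sup>2) * (1 - of_real (r\<^sup>2)) ^ j *
        (\<Sum>k\<le>n. (1 - of_real (r\<^sup>2)) ^ k * ((1 - of_real r * cis (- y)) ^ (n - k) * \<psi> k (of_real r * cis y)))"
        unfolding K_def e ee unfolding ec ..
      then show ?thesis unfolding f_def by simp
    qed
    have contf: "continuous_on {0..2 * pi} f"
    proof -
      have "continuous_on {0..2 * pi} (\<lambda>y. \<psi> k (of_real r * cis y))" for k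
        by (rule continuous_on_compose2[OF holomorphic_on_imp_continuous_on[OF \<psi>h]])
           (use r in \<open>auto intro!: continuous_intros simp: norm_mult\<close>)
      then show ?thesis unfolding f_def by (intro continuous_intros)
    qed
    have fint: "set_integrable lborel {0..2 * pi} f" by (rule borel_integrable_atLeastAtMost'[OF contf])
    have fint': "set_integrable lborel {0..<2 * pi} f" by (rule set_integrable_subset[OF fint]) auto
    have "(f has_integral (of_real (r\<^sup>2 * (1 - r\<^sup>2) ^ j) * (\<Sum>k\<le>n. of_real (1 - r\<^sup>2) ^ k * poly (R k) (of_real (r\<^sup>2))))) {0..2 * pi}"
      unfolding f_def by (intro has_integral_mult_right has_integral_sum R(3) r) auto
    also have "(\<Sum>k\<le>n. of_real (1 - r\<^sup>2) ^ k * poly (R k) (of_real (r\<^sup>2))) = poly q (of_real (r\<^sup>2))"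
      unfolding q_def by (simp add: poly_sum)
    finally have hi: "(f has_integral (of_real (r\<^sup>2 * (1 - r\<^sup>2) ^ j) * poly q (of_real (r\<^sup>2)))) {0..2 * pi}" .
    have "(LINT y|lborel. indicator strip (Complex x y) *\<^sub>R K j (exp (Complex x y))) = (LINT y:{0..<2 * pi}|lborel. f y)"
      unfolding set_lebesgue_integral_def Kf using True
      by (intro Bochner_Integration.integral_cong) (auto simp: strip_def indicator_def)
    also have "\<dots> = (LINT y:{0..2 * pi}|lborel. f y)"
    proof (rule set_integral_cong_set)
      show "AE y in lborel. (y \<in> {0..2 * pi}) = (y \<in> {0..<2 * pi})"
        using AE_lborel_singleton[of "2 * pi"] by eventually_elim auto
    qed (use fint fint' in \<open>auto simp: set_borel_measurable_def set_integrable_def integrable_iff_bounded\<close>)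
    also have "\<dots> = integral {0..2 * pi} f" by (rule set_borel_integral_eq_integral(2)[OF fint])
    also have "\<dots> = of_real (r\<^sup>2 * (1 - r\<^sup>2) ^ j) * poly q (of_real (r\<^sup>2))" using hi by (rule integral_unique)
    finally show ?thesis using True by (simp add: r2)
  qed
  have "q = 0"
  proof (rule polynomial_orthogonal_zero[OF degq])
    fix j assume j: "j \<le> n"
    show "integrable lborel (\<lambda>x. indicator {..<0} x *\<^sub>R (of_real (exp (2 * x) * (1 - exp (2 * x)) ^ j) * poly q (of_real (exp (2 * x)))))"
      using integrable_complex_iterated'[OF intK[OF j]] unfolding inner .
    show "(LINT x|lborel. indicator {..<0} x *\<^sub>R (of_real (exp (2 * x) * (1 - exp (2 * x)) ^ j) * poly q (of_real (exp (2 * x))))) = 0"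
      using integral_complex_iterated'[OF intK[OF j]] zeroK[OF j] unfolding inner by simp
  qed
  then have "0 = poly q 0" by simp
  also have "\<dots> = (\<Sum>k\<le>n. of_real (2 * pi) * (of_real (Im w) ^ k * \<phi> k w))"
    unfolding q_def by (simp add: poly_sum R(2) \<psi>_def disc_map_def)
  also have "\<dots> = of_real (2 * pi) * G w" unfolding G[OF w] sum_distrib_left ..
  finally show "G w = 0" by simp
qed

section \<open>The Bergman transforms as Laguerre transforms\<close>

definition laguerre_kernel :: "nat \<Rightarrow> complex \<Rightarrow> real \<Rightarrow> complex"
  where "laguerre_kernel n z t = of_real (laguerre n (2 * Im z * t)) * laplace_kernel 0 z t"

definition laguerre_transform :: "nat \<Rightarrow> (real \<Rightarrow> complex) \<Rightarrow> complex \<Rightarrow> complex"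
  where "laguerre_transform n f z = of_real ((-1) ^ n / sqrt pi) * (LINT t|half_line. laguerre_kernel n z t * f t)"

definition laguerre_coeff :: "nat \<Rightarrow> nat \<Rightarrow> real"
  where "laguerre_coeff n j = real (n choose j) * (-2) ^ j / fact j"

lemma laguerre_kernel_measurable [measurable]: "laguerre_kernel n z \<in> borel_measurable borel"
  unfolding laguerre_kernel_def[abs_def] by measurable

lemma laguerre_kernel_expand:
  "laguerre_kernel n z t = (\<Sum>j\<le>n. of_real (laguerre_coeff n j * Im z ^ j) * laplace_kernel j z t)"
proof -
  have "laguerre n (2 * Im z * t) = (\<Sum>j\<le>n. laguerre_coeff n j * Im z ^ j * t ^ j)"
    unfolding laguerre_def laguerre_coeff_def
  proof (intro sum.cong refl)
    fix j
    have "- (2 * Im z * t) = (-2) * Im z * t" by simp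
    then have "(- (2 * Im z * t)) ^ j = (-2) ^ j * Im z ^ j * t ^ j" by (simp only: power_mult_distrib)
    then show "real (n choose j) * (- (2 * Im z * t)) ^ j / fact j = real (n choose j) * (-2) ^ j / fact j * Im z ^ j * t ^ j"
      by simp
  qed
  then show ?thesis
    unfolding laguerre_kernel_def by (simp add: sum_distrib_left sum_distrib_right laplace_kernel_def mult_ac)
qed

lemma laguerre_kernel_L2:
  assumes "Im z > 0" shows "laguerre_kernel n z \<in> L2 half_line"
  unfolding laguerre_kernel_expand[abs_def]
  by (intro L2_sum L2_scale laplace_kernel_L2 assms)

lemma laguerre_transform_expand:
  assumes f: "f \<in> L2 half_line" and z: "Im z > 0"
  shows "laguerre_transform n f z = of_real ((-1) ^ n / sqrt pi) * (\<Sum>j\<le>n. of_real (laguerre_coeff n j * Im z ^ j) * laplace j f z)"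
proof -
  have "(LINT t|half_line. laguerre_kernel n z t * f t) =
     (LINT t|half_line. (\<Sum>j\<le>n. of_real (laguerre_coeff n j * Im z ^ j) * (laplace_kernel j z t * f t)))"
    unfolding laguerre_kernel_expand by (simp add: sum_distrib_right mult.assoc)
  also have "\<dots> = (\<Sum>j\<le>n. LINT t|half_line. of_real (laguerre_coeff n j * Im z ^ j) * (laplace_kernel j z t * f t))"
    by (rule Bochner_Integration.integral_sum) (intro integrable_mult_right laplace_integrable f z)
  finally show ?thesis unfolding laguerre_transform_def laplace_def by simp
qed

lemma laguerre_transform_linear:
  assumes "f \<in> L2 half_line" "g \<in> L2 half_line" "Im z > 0"
  shows "laguerre_transform n (\<lambda>t. a * f t + b * g t) z = a * laguerre_transform n f z + b * laguerre_transform n g z"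
proof -
  note i = L2_mult_integrable[OF laguerre_kernel_L2[OF assms(3)]]
  have "(LINT t|half_line. laguerre_kernel n z t * (a * f t + b * g t)) =
    (LINT t|half_line. a * (laguerre_kernel n z t * f t) + b * (laguerre_kernel n z t * g t))"
    by (intro Bochner_Integration.integral_cong refl) (simp add: algebra_simps)
  also have "\<dots> = a * (LINT t|half_line. laguerre_kernel n z t * f t) + b * (LINT t|half_line. laguerre_kernel n z t * g t)"
    using i[OF assms(1)] i[OF assms(2)] by simp
  finally show ?thesis unfolding laguerre_transform_def by (simp add: algebra_simps)
qed

lemma laguerre_transform_polyanalytic_sum:
  assumes f: "f \<in> L2 half_line" and "n \<le> N"
  shows "polyanalytic_sum (Suc N) (laguerre_transform n f)"
proof -
  define \<phi> where "\<phi> j = (\<lambda>z. (if j \<le> n then of_real ((-1) ^ n / sqrt pi) * of_real (laguerre_coeff n j) * laplace j f z else 0))" for j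
  have "\<phi> j holomorphic_on \<bbbU>" for j
    unfolding \<phi>_def using laplace_holomorphic[OF f] by (cases "j \<le> n") (auto intro!: holomorphic_intros)
  moreover have "laguerre_transform n f z = (\<Sum>j<Suc N. of_real (Im z) ^ j * \<phi> j z)" if "z \<in> \<bbbU>" for z
  proof -
    have "laguerre_transform n f z = (\<Sum>j\<in>{..n}. of_real (Im z) ^ j * \<phi> j z)"
      using that unfolding upper_half_plane_iff
      by (subst laguerre_transform_expand[OF f]) (auto simp: \<phi>_def sum_distrib_left mult_ac intro!: sum.cong)
    also have "\<dots> = (\<Sum>j<Suc N. of_real (Im z) ^ j * \<phi> j z)"
      using assms(2) by (intro sum.mono_neutral_left) (auto simp: \<phi>_def)
    finally show ?thesis .
  qed
  ultimately show ?thesis unfolding polyanalytic_sum_def by blast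
qed

text \<open>
  The Leibniz rule for a derivation that raises one of two indices.
\<close>

lemma pascal_sum:
  fixes u :: "nat \<Rightarrow> nat \<Rightarrow> complex"
  shows "(\<Sum>i\<le>k. of_nat (k choose i) * (u (Suc i) (k - i) + u i (Suc (k - i)))) =
    (\<Sum>i\<le>Suc k. of_nat (Suc k choose i) * u i (Suc k - i))"
proof -
  have "(\<Sum>i\<le>Suc k. of_nat (Suc k choose i) * u i (Suc k - i)) =
    u 0 (Suc k) + (\<Sum>i\<le>k. of_nat (k choose i) * u (Suc i) (k - i)) + (\<Sum>i\<le>k. of_nat (k choose Suc i) * u (Suc i) (k - i))"
    by (subst sum.atMost_Suc_shift) (simp add: sum.distrib distrib_right)
  also have "u 0 (Suc k) + (\<Sum>i\<le>k. of_nat (k choose i) * u (Suc i) (k - i)) + (\<Sum>i\<le>k. of_nat (k choose Suc i) * u (Suc i) (k - i))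
    = (\<Sum>i\<le>k. of_nat (k choose i) * u (Suc i) (k - i)) + (\<Sum>i\<le>Suc k. of_nat (k choose i) * u i (Suc k - i))"
    by (subst sum.atMost_Suc_shift) simp
  also have "(\<Sum>i\<le>Suc k. of_nat (k choose i) * u i (Suc k - i)) = (\<Sum>i\<le>k. of_nat (k choose i) * u i (Suc (k - i)))"
    unfolding sum.atMost_Suc by (auto simp: Suc_diff_le binomial_eq_0 intro!: sum.cong)
  finally show ?thesis by (simp add: sum.distrib distrib_left)
qed

text \<open>
  A Leibniz rule: \<open>d_dz\<close> lowers the power of \<open>Im w\<close>, with the factor \<open>1 / (2 i)\<close>, and differentiates \<open>\<Phi>\<close>.
\<close>

lemma d_dz_power_Im_mult:
  assumes \<Phi>: "\<And>m z. z \<in> \<bbbU> \<Longrightarrow> (\<Phi> m has_field_derivative \<Phi> (Suc m) z) (at z)"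
    and z: "z \<in> \<bbbU>"
  shows "(d_dz ^^ k) (\<lambda>w. of_real (Im w) ^ n * \<Phi> 0 w) z =
    (\<Sum>i\<le>k. of_nat (k choose i) * (of_nat (\<Prod>j<i. n - j) * (1 / (2 * \<i>)) ^ i * of_real (Im z) ^ (n - i) * \<Phi> (k - i) z))"
  using z
proof (induction k arbitrary: z)
  case 0
  then show ?case by simp
next
  case (Suc k)
  define u where "u i m w = of_nat (\<Prod>j<i. n - j) * (1 / (2 * \<i>)) ^ i * (of_real (Im w) ^ (n - i) * \<Phi> m w)" for i m w
  let ?F = "(d_dz ^^ k) (\<lambda>w. of_real (Im w) ^ n * \<Phi> 0 w)"
  have F: "?F w = (\<Sum>i\<le>k. of_nat (k choose i) * u i (k - i) w)" if "w \<in> \<bbbU>" for w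
    using Suc.IH[OF that] by (simp add: u_def mult.assoc)
  define a where "a i m = of_nat (\<Prod>j<i. n - j) * (1 / (2 * \<i>)) ^ i * (of_real (Im z) ^ (n - i) * \<Phi> (Suc m) z)" for i m
  define b where "b i m = of_nat (\<Prod>j<i. n - j) * (1 / (2 * \<i>)) ^ i *
    (of_nat (n - i) * of_real (Im z) ^ (n - i - 1) * \<Phi> m z + \<i> * of_real (Im z) ^ (n - i) * \<Phi> (Suc m) z)" for i m
  have p: "has_partials (u i m) (a i m) (b i m) z" for i m
    unfolding u_def[abs_def] a_def b_def
    by (intro has_partials_scale has_partials_Im_power_mult \<Phi> Suc.prems)
  have ab: "(a i m - \<i> * b i m) / 2 = u (Suc i) m z + u i (Suc m) z" for i m
  proof -
    have e: "1 / (2 * \<i>) = - \<i> / 2" by (simp add: field_simps)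
    show ?thesis unfolding a_def b_def u_def e by (simp add: field_simps)
  qed
  have "has_partials (\<lambda>w. \<Sum>i\<le>k. of_nat (k choose i) * u i (k - i) w)
     (\<Sum>i\<le>k. of_nat (k choose i) * a i (k - i)) (\<Sum>i\<le>k. of_nat (k choose i) * b i (k - i)) z"
    by (intro has_partials_sum has_partials_scale p)
  then have "has_partials ?F (\<Sum>i\<le>k. of_nat (k choose i) * a i (k - i)) (\<Sum>i\<le>k. of_nat (k choose i) * b i (k - i)) z"
    by (rule has_partials_cong[OF _ Suc.prems]) (simp add: F)
  from has_partialsD(3)[OF this]
  have "(d_dz ^^ Suc k) (\<lambda>w. of_real (Im w) ^ n * \<Phi> 0 w) z =
     ((\<Sum>i\<le>k. of_nat (k choose i) * a i (k - i)) - \<i> * (\<Sum>i\<le>k. of_nat (k choose i) * b i (k - i))) / 2"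
    by simp
  also have "\<dots> = (\<Sum>i\<le>k. of_nat (k choose i) * ((a i (k - i) - \<i> * b i (k - i)) / 2))"
    by (simp add: sum_distrib_left sum_divide_distrib sum_subtractf[symmetric] algebra_simps)
  also have "\<dots> = (\<Sum>i\<le>k. of_nat (k choose i) * (u (Suc i) (k - i) z + u i (Suc (k - i)) z))"
    unfolding ab ..
  also have "\<dots> = (\<Sum>i\<le>Suc k. of_nat (Suc k choose i) * u i (Suc k - i) z)"
    by (rule pascal_sum[of k "\<lambda>i m. u i m z"])
  finally show ?case by (simp add: u_def mult.assoc)
qed

text \<open>
  The constants work out because \<open>4\<^sup>n (1 / (2 i))\<^sup>2\<^sup>n = (-1)\<^sup>n\<close>: one factor \<open>(1 / (2 i))\<^sup>n\<close> belongs to the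
  definition of the transform, the other comes from differentiating \<open>(Im z)\<^sup>n\<close>.
\<close>

lemma normalized_true_Ber_eq:
  assumes f: "f \<in> L2 half_line" and z: "z \<in> \<bbbU>"
  shows "normalized_true_Ber n f z = laguerre_transform n f z"
proof -
  have Imz: "Im z > 0" using z by (simp add: upper_half_plane_iff)
  have Ber: "Ber f = laplace 0 f"
    unfolding Ber_def laplace_def laplace_kernel_def by (rule ext) (simp add: mult_ac)
  define \<Phi> where "\<Phi> m w = \<i> ^ m * laplace m f w" for m w
  have \<Phi>: "(\<Phi> m has_field_derivative \<Phi> (Suc m) w) (at w)" if "w \<in> \<bbbU>" for m w
    unfolding \<Phi>_def using has_field_derivative_laplace[OF f, of w m] that
    by (auto simp: upper_half_plane_iff intro!: derivative_eq_intros)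
  define \<kappa> where "\<kappa> = 1 / (2 * \<i>)"
  have \<kappa>: "\<kappa> \<noteq> 0" "\<kappa> * \<kappa> = - (1 / 4)" by (auto simp: \<kappa>_def field_simps)
  have "(d_dz ^^ n) (\<lambda>w. of_real (Im w) ^ n * Ber f w) z =
    (\<Sum>i\<le>n. of_nat (n choose i) * (of_nat (\<Prod>j<i. n - j) * \<kappa> ^ i * of_real (Im z) ^ (n - i) * \<Phi> (n - i) z))"
    using d_dz_power_Im_mult[of \<Phi>, OF \<Phi> z, of n n] unfolding Ber \<kappa>_def by (simp add: \<Phi>_def)
  also have "\<dots> = (\<Sum>j\<le>n. of_nat (n choose (n - j)) * (of_nat (\<Prod>l<n - j. n - l) * \<kappa> ^ (n - j) * of_real (Im z) ^ (n - (n - j)) * \<Phi> (n - (n - j)) z))"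
    by (rule sum.nat_diff_reindex[symmetric, where n="Suc n", simplified lessThan_Suc_atMost, simplified])
  also have "\<dots> = (\<Sum>j\<le>n. fact n * \<kappa> ^ n * (of_real (laguerre_coeff n j * Im z ^ j) * laplace j f z))"
  proof (intro sum.cong refl)
    fix j assume "j \<in> {..n}"
    then have j: "j \<le> n" by simp
    have "(\<Prod>l<i. n - l) * fact (n - i) = fact n" if "i \<le> n" for i
      using that
    proof (induction i)
      case (Suc i)
      then have "fact (n - i) = (n - i) * fact (n - Suc i)" by (metis Suc_diff_Suc Suc_le_lessD fact_Suc of_nat_id)
      then show ?case using Suc by (simp add: mult_ac)
    qed simp
    from this[of "n - j"] j have "(\<Prod>l<n - j. n - l) * fact j = fact n" by simp
    then have "of_nat (\<Prod>l<n - j. n - l) * fact j = (fact n :: complex)" by (metis of_nat_mult of_nat_fact)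
    then have pr: "of_nat (\<Prod>l<n - j. n - l) = (fact n / fact j :: complex)" by (simp add: field_simps)
    have "\<kappa> ^ (n - j) * \<i> ^ j = \<kappa> ^ n * (-2) ^ j"
    proof -
      have "\<i> = \<kappa> * (-2)" by (simp add: \<kappa>_def field_simps)
      then have "\<i> ^ j = \<kappa> ^ j * (-2) ^ j" by (metis power_mult_distrib)
      moreover have "\<kappa> ^ (n - j) * \<kappa> ^ j = \<kappa> ^ n" using j by (simp flip: power_add)
      ultimately show ?thesis by (simp add: mult.assoc[symmetric])
    qed
    then have k: "\<kappa> ^ (n - j) * (\<i> ^ j * c) = \<kappa> ^ n * (-2) ^ j * c" for c by (simp add: mult.assoc[symmetric])
    have "of_nat (n choose (n - j)) * (of_nat (\<Prod>l<n - j. n - l) * \<kappa> ^ (n - j) * of_real (Im z) ^ (n - (n - j)) * \<Phi> (n - (n - j)) z)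
      = of_nat (n choose j) * (fact n / fact j) * of_real (Im z) ^ j * (\<kappa> ^ (n - j) * (\<i> ^ j * laplace j f z))"
      unfolding pr \<Phi>_def using j binomial_symmetric[OF j] by (simp add: mult_ac)
    also have "\<dots> = fact n * \<kappa> ^ n * (of_real (laguerre_coeff n j * Im z ^ j) * laplace j f z)"
      unfolding k laguerre_coeff_def by simp
    finally show "of_nat (n choose (n - j)) * (of_nat (\<Prod>l<n - j. n - l) * \<kappa> ^ (n - j) * of_real (Im z) ^ (n - (n - j)) * \<Phi> (n - (n - j)) z) =
      fact n * \<kappa> ^ n * (of_real (laguerre_coeff n j * Im z ^ j) * laplace j f z)" .
  qed
  finally have d: "(d_dz ^^ n) (\<lambda>w. of_real (Im w) ^ n * Ber f w) z =
    fact n * \<kappa> ^ n * (\<Sum>j\<le>n. of_real (laguerre_coeff n j * Im z ^ j) * laplace j f z)" (is "_ = _ * ?S")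
    by (simp add: sum_distrib_left)
  have "1 / ((2 * \<i>) ^ n * fact n) = \<kappa> ^ n / fact n" 
    by (simp only: \<kappa>_def power_one_over divide_divide_eq_left)
  then have "normalized_true_Ber n f z = of_real (4 ^ n / sqrt pi) * (\<kappa> ^ n / fact n * (fact n * \<kappa> ^ n * ?S))"
    unfolding normalized_true_Ber_def true_Ber_def d by simp
  also have "\<dots> = of_real (4 ^ n / sqrt pi) * ((\<kappa> * \<kappa>) ^ n * ?S)"
    by (simp add: power_mult_distrib)
  also have "of_real (4 ^ n / sqrt pi) * ((\<kappa> * \<kappa>) ^ n * ?S) = of_real ((-1) ^ n / sqrt pi) * ?S"
  proof -
    have "(4 :: complex) ^ n * (- (1 / 4)) ^ n = (-1) ^ n" by (simp flip: power_mult_distrib)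
    then show ?thesis unfolding \<kappa>(2) by (simp add: field_simps)
  qed
  finally show ?thesis unfolding laguerre_transform_expand[OF f Imz] .
qed

section \<open>Isometry and mutual orthogonality\<close>

lemma exp_minus_power_bound:
  fixes s t :: real
  assumes "s > 0" "t \<ge> 0"
  shows "t ^ k * exp (- (s * t)) \<le> fact k / s ^ k"
proof -
  have "(s * t) ^ k / fact k \<le> exp (s * t)"
    using assms sum_le_suminf[OF summable_exp, of "{k}" "s * t"]
    by (simp add: exp_def divide_inverse mult.commute)
  then show ?thesis using assms by (simp add: exp_minus power_mult_distrib field_simps)
qed

text \<open>
  Boundedness makes the slices below square integrable, as Plancherel's theorem requires.
\<close>

lemma laplace_kernel_bounded:
  assumes z: "Im z > 0"
  obtains M where "\<And>t. t > 0 \<Longrightarrow> cmod (laplace_kernel j z t) \<le> M"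
proof -
  have "cmod (laplace_kernel j z t) \<le> fact j / Im z ^ j + fact (Suc j) / Im z ^ Suc j" if t: "t > 0" for t
  proof -
    have "t powr (1/2) \<le> 1 + t"
    proof -
      have "sqrt t * 1 \<le> (t + 1) / 2" using arith_geo_mean_sqrt[of t 1] t by simp
      then show ?thesis using t by (simp add: powr_half_sqrt)
    qed
    then have "t powr (1/2) * (t ^ j * exp (- (Im z * t))) \<le> (1 + t) * (t ^ j * exp (- (Im z * t)))"
      using t by (intro mult_right_mono) auto
    also have "\<dots> = t ^ j * exp (- (Im z * t)) + t ^ Suc j * exp (- (Im z * t))" by (simp add: algebra_simps)
    also have "\<dots> \<le> fact j / Im z ^ j + fact (Suc j) / Im z ^ Suc j"
      using z t by (intro add_mono exp_minus_power_bound) auto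
    finally show ?thesis unfolding cmod_laplace_kernel[OF t] by (simp add: mult.assoc)
  qed
  then show ?thesis by (rule that)
qed

lemma laguerre_kernel_bounded:
  assumes z: "Im z > 0"
  obtains M where "\<And>t. t > 0 \<Longrightarrow> cmod (laguerre_kernel n z t) \<le> M"
proof -
  have "\<forall>j. \<exists>M. \<forall>t>0. cmod (laplace_kernel j z t) \<le> M" using laplace_kernel_bounded[OF z] by meson
  then obtain M where M: "\<And>j t. t > 0 \<Longrightarrow> cmod (laplace_kernel j z t) \<le> M j" by metis
  have "cmod (laguerre_kernel n z t) \<le> (\<Sum>j\<le>n. \<bar>laguerre_coeff n j * Im z ^ j\<bar> * M j)" if "t > 0" for t
    unfolding laguerre_kernel_expand
    by (rule order_trans[OF norm_sum], intro sum_mono)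
       (simp only: norm_mult norm_of_real mult_left_mono M[OF that] abs_ge_zero)
  then show ?thesis by (rule that)
qed

lemma laguerre_kernel_slice:
  "laguerre_kernel n (Complex x s) t = laguerre_kernel n (\<i> * of_real s) t * exp (\<i> * of_real (x * t))"
proof -
  have "\<i> * Complex x s * of_real t = \<i> * (\<i> * of_real s) * of_real t + \<i> * of_real (x * t)"
    by (simp add: complex_eq_iff)
  then have "exp (\<i> * Complex x s * of_real t) = exp (\<i> * (\<i> * of_real s) * of_real t) * exp (\<i> * of_real (x * t))"
    by (simp only: exp_add)
  then show ?thesis by (simp add: laguerre_kernel_def laplace_kernel_def)
qed

context
  fixes f g :: "real \<Rightarrow> complex"
  assumes f: "f \<in> L2 half_line" and fg: "half_line_rep f g"
begin

lemmas half_line_rep_facts = half_line_repD[OF fg]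

lemma half_line_rep_L2: "g \<in> L2 half_line"
proof -
  have [measurable]: "g \<in> borel_measurable borel" using half_line_rep_facts(1) by (simp add: L2_def)
  have "(\<lambda>t. indicator {0<..} t *\<^sub>R (cmod (g t))\<^sup>2) = (\<lambda>t. (cmod (g t))\<^sup>2)"
    by (rule ext) (use half_line_rep_facts(2) in \<open>auto simp: indicator_def not_less\<close>)
  then have "integrable half_line (\<lambda>t. (cmod (g t))\<^sup>2)"
    using L2_square_integrable[OF half_line_rep_facts(1)] by (subst half_line_integrable_iff) auto
  then show ?thesis using half_line_measurable[of g] by (simp add: L2_def)
qed

lemma laguerre_slice_L1: "s > 0 \<Longrightarrow> integrable lborel (\<lambda>t. laguerre_kernel n (\<i> * of_real s) t * g t)"
proof -
  assume s: "s > 0"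
  have [measurable]: "g \<in> borel_measurable borel" using half_line_rep_facts(1) by (simp add: L2_def)
  have "integrable half_line (\<lambda>t. laguerre_kernel n (\<i> * of_real s) t * g t)"
    by (rule L2_mult_integrable[OF laguerre_kernel_L2 half_line_rep_L2]) (use s in simp)
  then have "integrable lborel (\<lambda>t. indicator {0<..} t *\<^sub>R (laguerre_kernel n (\<i> * of_real s) t * g t))"
    by (subst (asm) half_line_integrable_iff) auto
  also have "(\<lambda>t. indicator {0<..} t *\<^sub>R (laguerre_kernel n (\<i> * of_real s) t * g t)) = (\<lambda>t. laguerre_kernel n (\<i> * of_real s) t * g t)"
    using half_line_rep_facts(2) by (auto simp: indicator_def not_less)
  finally show ?thesis .
qed

lemma laguerre_slice_L2: "s > 0 \<Longrightarrow> (\<lambda>t. laguerre_kernel n (\<i> * of_real s) t * g t) \<in> L2 lborel"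
proof -
  assume s: "s > 0"
  have [measurable]: "g \<in> borel_measurable borel" using half_line_rep_facts(1) by (simp add: L2_def)
  obtain M where M: "\<And>t. t > 0 \<Longrightarrow> cmod (laguerre_kernel n (\<i> * of_real s) t) \<le> M"
    using laguerre_kernel_bounded[of "\<i> * of_real s" n] s by auto
  have "integrable lborel (\<lambda>t. (cmod (laguerre_kernel n (\<i> * of_real s) t * g t))\<^sup>2)"
  proof (rule Bochner_Integration.integrable_bound)
    show "integrable lborel (\<lambda>t. M\<^sup>2 * (cmod (g t))\<^sup>2)" using L2_square_integrable[OF half_line_rep_facts(1)] by simp
    show "AE t in lborel. norm ((cmod (laguerre_kernel n (\<i> * of_real s) t * g t))\<^sup>2) \<le> norm (M\<^sup>2 * (cmod (g t))\<^sup>2)"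
    proof (intro AE_I2)
      fix t :: real
      show "norm ((cmod (laguerre_kernel n (\<i> * of_real s) t * g t))\<^sup>2) \<le> norm (M\<^sup>2 * (cmod (g t))\<^sup>2)"
      proof (cases "t > 0")
        case True
        then show ?thesis using M[OF True]
          by (auto simp: norm_mult power_mult_distrib intro!: mult_right_mono power_mono)
      qed (use half_line_rep_facts(2) in auto)
    qed
  qed measurable
  then show ?thesis by (simp add: L2_def)
qed

text \<open>
  On a horizontal line the transform is a Fourier transform.
\<close>

lemma laguerre_transform_slice:
  assumes s: "s > 0"
  shows "laguerre_transform n f (Complex x s) =
    of_real ((-1) ^ n / sqrt pi) * fourier (\<lambda>t. laguerre_kernel n (\<i> * of_real s) t * g t) x"
proof -
  have "(LINT t|half_line. laguerre_kernel n (Complex x s) t * f t) = (LINT t|lborel. laguerre_kernel n (Complex x s) t * g t)"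
    by (rule half_line_integral_rep[OF _ f fg]) measurable
  also have "\<dots> = fourier (\<lambda>t. laguerre_kernel n (\<i> * of_real s) t * g t) x"
    unfolding fourier_def by (intro Bochner_Integration.integral_cong refl) (simp only: laguerre_kernel_slice mult_ac)
  finally show ?thesis by (simp add: laguerre_transform_def)
qed

end

text \<open>
  Twice the product of two Laguerre kernels at height \<open>s\<close>, as a function of \<open>s\<close> for fixed \<open>t\<close>; it is the
  rescaled orthogonality weight.
\<close>

definition laguerre_weight :: "nat \<Rightarrow> nat \<Rightarrow> real \<Rightarrow> real \<Rightarrow> real"
  where "laguerre_weight j k t s = indicator {0<..} s * (2 * t * (laguerre j (2 * t * s) * laguerre k (2 * t * s) * exp (- (2 * t * s))))"

lemma laguerre_weight_measurable [measurable]: "(\<lambda>(t, s). laguerre_weight j k t s) \<in> borel_measurable (borel \<Otimes>\<^sub>M borel)"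
  unfolding laguerre_weight_def[abs_def] by measurable

lemma laguerre_weight_integral:
  assumes "t > 0"
  shows "has_bochner_integral lborel (laguerre_weight j k t) (if j = k then 1 else 0)"
  unfolding laguerre_weight_def[abs_def]
  by (rule has_bochner_integral_halfline_scale[OF laguerre_orthonormal]) (use assms in simp)

text \<open>
  The constant does not depend on \<open>t\<close>; this makes the double integral behind the orthonormality of
  the transforms absolutely convergent.
\<close>

lemma laguerre_weight_abs_integral:
  obtains C where "\<And>t. t > 0 \<Longrightarrow> has_bochner_integral lborel (\<lambda>s. \<bar>laguerre_weight j k t s\<bar>) C"
proof -
  have "integrable lborel (\<lambda>y. \<bar>indicator {0<..} y * (laguerre j y * laguerre k y * exp (- y))\<bar>)"
    using laguerre_orthonormal[of j k] by (intro integrable_abs) (rule integrable.intros)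
  also have "(\<lambda>y. \<bar>indicator {0<..} y * (laguerre j y * laguerre k y * exp (- y))\<bar>) = (\<lambda>y. indicator {0<..} y * \<bar>laguerre j y * laguerre k y * exp (- y)\<bar>)"
    by (auto simp: indicator_def)
  finally obtain C where C: "has_bochner_integral lborel (\<lambda>y. indicator {0<..} y * \<bar>laguerre j y * laguerre k y * exp (- y)\<bar>) C"
    by (auto simp: integrable.simps)
  have "has_bochner_integral lborel (\<lambda>s. \<bar>laguerre_weight j k t s\<bar>) C" if t: "t > 0" for t
  proof -
    have "has_bochner_integral lborel (\<lambda>s. indicator {0<..} s * (2 * t * \<bar>laguerre j (2 * t * s) * laguerre k (2 * t * s) * exp (- (2 * t * s))\<bar>)) C"
      by (rule has_bochner_integral_halfline_scale[OF C]) (use t in simp)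
    also have "(\<lambda>s. indicator {0<..} s * (2 * t * \<bar>laguerre j (2 * t * s) * laguerre k (2 * t * s) * exp (- (2 * t * s))\<bar>)) = (\<lambda>s. \<bar>laguerre_weight j k t s\<bar>)"
      using t by (auto simp: laguerre_weight_def abs_mult indicator_def)
    finally show ?thesis .
  qed
  then show ?thesis by (rule that)
qed

lemma laguerre_kernel_product:
  assumes "t > 0" "s > 0"
  shows "2 * (laguerre_kernel j (\<i> * of_real s) t * cnj (laguerre_kernel k (\<i> * of_real s) t)) = of_real (laguerre_weight j k t s)"
proof -
  have "laguerre_kernel n (\<i> * of_real s) t = of_real (laguerre n (2 * t * s) * (t powr (1/2) * exp (- (s * t))))" for n
  proof -
    have "\<i> * (\<i> * of_real s) * of_real t = complex_of_real (- (s * t))" by (simp add: complex_eq_iff)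
    then have "exp (\<i> * (\<i> * of_real s) * of_real t) = complex_of_real (exp (- (s * t)))" by (simp only: exp_of_real)
    then show ?thesis unfolding laguerre_kernel_def laplace_kernel_def by (simp add: mult_ac)
  qed
  then have "2 * (laguerre_kernel j (\<i> * of_real s) t * cnj (laguerre_kernel k (\<i> * of_real s) t)) =
     of_real (2 * ((laguerre j (2 * t * s) * (t powr (1/2) * exp (- (s * t)))) * (laguerre k (2 * t * s) * (t powr (1/2) * exp (- (s * t))))))"
    by simp
  also have "2 * ((laguerre j (2 * t * s) * (t powr (1/2) * exp (- (s * t)))) * (laguerre k (2 * t * s) * (t powr (1/2) * exp (- (s * t)))))
     = 2 * (t powr (1/2) * t powr (1/2)) * (laguerre j (2 * t * s) * laguerre k (2 * t * s) * (exp (- (s * t)) * exp (- (s * t))))"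
    by (simp only: mult_ac)
  also have "t powr (1/2) * t powr (1/2) = t" using assms by (simp add: powr_half_sqrt)
  also have "exp (- (s * t)) * exp (- (s * t)) = exp (- (2 * t * s))" by (simp add: exp_add[symmetric] mult_ac)
  finally show ?thesis using assms by (simp add: laguerre_weight_def)
qed

text \<open>
  Plancherel's theorem on one horizontal line.
\<close>

lemma laguerre_transform_slice_inner:
  assumes f: "f \<in> L2 half_line"
    and fg: "half_line_rep f g"
    and f': "f' \<in> L2 half_line"
    and fg': "half_line_rep f' g'"
    and s: "s > 0"
  shows "(\<lambda>x. laguerre_transform j f (Complex x s)) \<in> L2 lborel"
    and "(LINT x|lborel. laguerre_transform j f (Complex x s) * cnj (laguerre_transform k f' (Complex x s)))
      = (-1) ^ (j + k) * (LINT t|lborel. of_real (laguerre_weight j k t s) * (g t * cnj (g' t)))"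
proof -
  note g = half_line_repD[OF fg]
  note sl = laguerre_transform_slice[OF f fg s] and sl' = laguerre_transform_slice[OF f' fg' s]
  note P = laguerre_slice_L1[OF f fg s] laguerre_slice_L2[OF f fg s]
  note P' = laguerre_slice_L1[OF f' fg' s] laguerre_slice_L2[OF f' fg' s]
  show "(\<lambda>x. laguerre_transform j f (Complex x s)) \<in> L2 lborel"
    unfolding sl by (intro L2_scale plancherel(1) P)
  have pp: "complex_of_real ((-1) ^ j / sqrt pi) * of_real ((-1) ^ k / sqrt pi) = (-1) ^ (j + k) / of_real pi"
    unfolding of_real_mult[symmetric] by (simp add: power_add)
  have "(LINT x|lborel. laguerre_transform j f (Complex x s) * cnj (laguerre_transform k f' (Complex x s)))
     = (LINT x|lborel. ((-1) ^ (j + k) / of_real pi) * (fourier (\<lambda>t. laguerre_kernel j (\<i> * of_real s) t * g t) x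
          * cnj (fourier (\<lambda>t. laguerre_kernel k (\<i> * of_real s) t * g' t) x)))"
    unfolding sl sl' pp[symmetric] by (intro Bochner_Integration.integral_cong refl) (simp add: mult_ac)
  also have "\<dots> = ((-1) ^ (j + k) / of_real pi) * (of_real (2 * pi) *
      l2_inner lborel (\<lambda>t. laguerre_kernel j (\<i> * of_real s) t * g t) (\<lambda>t. laguerre_kernel k (\<i> * of_real s) t * g' t))"
    unfolding plancherel_inner[OF P P', symmetric] by (simp add: l2_inner_def)
  also have "\<dots> = (-1) ^ (j + k) * (LINT t|lborel. 2 * ((laguerre_kernel j (\<i> * of_real s) t * g t) * cnj (laguerre_kernel k (\<i> * of_real s) t * g' t)))"
    by (simp add: l2_inner_def)
  also have "(LINT t|lborel. 2 * ((laguerre_kernel j (\<i> * of_real s) t * g t) * cnj (laguerre_kernel k (\<i> * of_real s) t * g' t)))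
     = (LINT t|lborel. of_real (laguerre_weight j k t s) * (g t * cnj (g' t)))"
  proof (intro Bochner_Integration.integral_cong refl)
    fix t :: real
    show "2 * ((laguerre_kernel j (\<i> * of_real s) t * g t) * cnj (laguerre_kernel k (\<i> * of_real s) t * g' t)) =
        of_real (laguerre_weight j k t s) * (g t * cnj (g' t))"
    proof (cases "t > 0")
      case True
      show ?thesis unfolding laguerre_kernel_product[OF True s, symmetric] by (simp add: mult_ac)
    qed (use g(2) in auto)
  qed
  finally show "(LINT x|lborel. laguerre_transform j f (Complex x s) * cnj (laguerre_transform k f' (Complex x s)))
      = (-1) ^ (j + k) * (LINT t|lborel. of_real (laguerre_weight j k t s) * (g t * cnj (g' t)))" .
qed

lemma laguerre_transform_continuous: "f \<in> L2 half_line \<Longrightarrow> continuous_on \<bbbU> (laguerre_transform n f)"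
  by (rule polyanalytic_sum_continuous[OF laguerre_transform_polyanalytic_sum[OF _ order_refl]])

text \<open>
  Tonelli's theorem: the squared norms of the slices integrate, over the height, to the squared
  norm of \<open>f\<close>.
\<close>

theorem laguerre_transform_L2:
  assumes f: "f \<in> L2 half_line"
  shows "laguerre_transform n f \<in> L2 half_plane"
proof -
  obtain g where fg: "half_line_rep f g" using L2_half_line_borel_rep[OF f] .
  note g = half_line_repD[OF fg]
  have [measurable]: "g \<in> borel_measurable borel" using g by (simp add: L2_def)
  let ?T = "laguerre_transform n f"
  note cont = laguerre_transform_continuous[OF f, of n]
  have contsq: "continuous_on \<bbbU> (\<lambda>z. (cmod (?T z))\<^sup>2)" by (intro continuous_intros cont)
  have m: "(\<lambda>z. indicator \<bbbU> z *\<^sub>R (cmod (?T z))\<^sup>2) \<in> borel_measurable borel"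
    by (rule borel_measurable_continuous_on_indicator[OF upper_half_plane_borel contsq])
  have Wnn: "laguerre_weight n n t s \<ge> 0" if "t \<ge> 0" for t s
    using that by (auto simp: laguerre_weight_def indicator_def)
  have "(\<integral>\<^sup>+z. ennreal (indicator \<bbbU> z *\<^sub>R (cmod (?T z))\<^sup>2) \<partial>lborel)
      = (\<integral>\<^sup>+s. (\<integral>\<^sup>+x. ennreal (indicator \<bbbU> (Complex x s) *\<^sub>R (cmod (?T (Complex x s)))\<^sup>2) \<partial>lborel) \<partial>lborel)"
    by (rule nn_integral_complex_iterated) (use m in measurable)
  also have "\<dots> = (\<integral>\<^sup>+s. (\<integral>\<^sup>+t. ennreal (laguerre_weight n n t s * (cmod (g t))\<^sup>2) \<partial>lborel) \<partial>lborel)"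
  proof (rule nn_integral_cong)
    fix s :: real
    show "(\<integral>\<^sup>+x. ennreal (indicator \<bbbU> (Complex x s) *\<^sub>R (cmod (?T (Complex x s)))\<^sup>2) \<partial>lborel) =
      (\<integral>\<^sup>+t. ennreal (laguerre_weight n n t s * (cmod (g t))\<^sup>2) \<partial>lborel)"
    proof (cases "s > 0")
      case False
      then show ?thesis by (simp add: laguerre_weight_def upper_half_plane_def)
    next
      case True
      note si = laguerre_transform_slice_inner[OF f fg f fg True]
      have iW: "integrable lborel (\<lambda>t. laguerre_weight n n t s * (cmod (g t))\<^sup>2)"
      proof -
        have "integrable lborel (\<lambda>t. 2 * (cmod (laguerre_kernel n (\<i> * of_real s) t * g t))\<^sup>2)"
          using L2_square_integrable[OF laguerre_slice_L2[OF f fg True]] by simp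
        also have "(\<lambda>t. 2 * (cmod (laguerre_kernel n (\<i> * of_real s) t * g t))\<^sup>2) = (\<lambda>t. laguerre_weight n n t s * (cmod (g t))\<^sup>2)"
        proof (rule ext)
          fix t :: real
          show "2 * (cmod (laguerre_kernel n (\<i> * of_real s) t * g t))\<^sup>2 = laguerre_weight n n t s * (cmod (g t))\<^sup>2"
          proof (cases "t > 0")
            case t: True
            have "of_real (2 * (cmod (laguerre_kernel n (\<i> * of_real s) t))\<^sup>2) = complex_of_real (laguerre_weight n n t s)"
              unfolding laguerre_kernel_product[OF t True, symmetric] of_real_mult complex_norm_square by simp
            then have "2 * (cmod (laguerre_kernel n (\<i> * of_real s) t))\<^sup>2 = laguerre_weight n n t s" by (simp only: of_real_eq_iff)
            then show ?thesis by (simp add: norm_mult power_mult_distrib)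
          qed (use g(2) in auto)
        qed
        finally show ?thesis .
      qed
      have "complex_of_real (l2_sq lborel (\<lambda>x. ?T (Complex x s))) = (LINT x|lborel. ?T (Complex x s) * cnj (?T (Complex x s)))"
        using l2_inner_self[of lborel "\<lambda>x. ?T (Complex x s)"] by (simp add: l2_inner_def)
      also have "\<dots> = (LINT t|lborel. of_real (laguerre_weight n n t s * (cmod (g t))\<^sup>2))"
        unfolding si(2) of_real_mult complex_norm_square by (simp add: mult_2[symmetric] power_mult)
      also have "\<dots> = of_real (LINT t|lborel. laguerre_weight n n t s * (cmod (g t))\<^sup>2)"
        by (rule integral_complex_of_real)
      finally have e: "l2_sq lborel (\<lambda>x. ?T (Complex x s)) = (LINT t|lborel. laguerre_weight n n t s * (cmod (g t))\<^sup>2)"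
        by (simp only: of_real_eq_iff)
      have "(\<integral>\<^sup>+x. ennreal (indicator \<bbbU> (Complex x s) *\<^sub>R (cmod (?T (Complex x s)))\<^sup>2) \<partial>lborel) =
         (\<integral>\<^sup>+x. ennreal ((cmod (?T (Complex x s)))\<^sup>2) \<partial>lborel)"
        using True by (simp add: upper_half_plane_def)
      also have "\<dots> = ennreal (l2_sq lborel (\<lambda>x. ?T (Complex x s)))"
        unfolding l2_sq_def using L2_square_integrable[OF si(1)] by (intro nn_integral_eq_integral) auto
      also have "\<dots> = (\<integral>\<^sup>+t. ennreal (laguerre_weight n n t s * (cmod (g t))\<^sup>2) \<partial>lborel)"
        unfolding e
      proof (rule nn_integral_eq_integral[symmetric, OF iW], intro AE_I2)
        fix t show "0 \<le> laguerre_weight n n t s * (cmod (g t))\<^sup>2"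
          using g(2)[of t] Wnn[of t s] by (cases "t > 0") auto
      qed
      finally show ?thesis .
    qed
  qed
  also have "\<dots> = (\<integral>\<^sup>+t. (\<integral>\<^sup>+s. ennreal (laguerre_weight n n t s * (cmod (g t))\<^sup>2) \<partial>lborel) \<partial>lborel)"
    by (rule lborel_pair.Fubini') measurable
  also have "\<dots> = (\<integral>\<^sup>+t. ennreal ((cmod (g t))\<^sup>2) \<partial>lborel)"
  proof (rule nn_integral_cong)
    fix t :: real
    show "(\<integral>\<^sup>+s. ennreal (laguerre_weight n n t s * (cmod (g t))\<^sup>2) \<partial>lborel) = ennreal ((cmod (g t))\<^sup>2)"
    proof (cases "t > 0")
      case True
      have hb: "has_bochner_integral lborel (\<lambda>s. laguerre_weight n n t s * (cmod (g t))\<^sup>2) (1 * (cmod (g t))\<^sup>2)"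
        using has_bochner_integral_mult_left[OF laguerre_weight_integral[OF True, of n n], of "(cmod (g t))\<^sup>2"] by simp
      have "(\<integral>\<^sup>+s. ennreal (laguerre_weight n n t s * (cmod (g t))\<^sup>2) \<partial>lborel) = ennreal (LINT s|lborel. laguerre_weight n n t s * (cmod (g t))\<^sup>2)"
        using hb Wnn[of t] True by (intro nn_integral_eq_integral) (auto simp: has_bochner_integral_iff)
      also have "(LINT s|lborel. laguerre_weight n n t s * (cmod (g t))\<^sup>2) = (cmod (g t))\<^sup>2"
        using hb unfolding has_bochner_integral_iff by (simp only: mult_1)
      finally show ?thesis .
    qed (use g(2) in auto)
  qed
  also have "\<dots> < \<infinity>"
    using L2_square_integrable[OF g(1)] by (simp add: integrable_iff_bounded)
  finally have "set_integrable lborel \<bbbU> (\<lambda>z. (cmod (?T z))\<^sup>2)"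
    unfolding set_integrable_def using m by (intro integrableI_bounded) (auto simp: indicator_def if_distrib cong: if_cong)
  then show ?thesis
    using upper_half_plane_integrable_iff[OF contsq] upper_half_plane_measurable[OF cont] by (simp add: L2_def)
qed

text \<open>
  The inner products of the slices are integrated over the height; after Fubini's theorem the inner
  integral is the orthonormality relation of the Laguerre polynomials.
\<close>

theorem laguerre_transform_orthonormal:
  assumes f: "f \<in> L2 half_line" and f': "f' \<in> L2 half_line"
  shows "l2_inner half_plane (laguerre_transform j f) (laguerre_transform k f') =
    (if j = k then l2_inner half_line f f' else 0)"
proof -
  obtain g where fg: "half_line_rep f g" using L2_half_line_borel_rep[OF f] .
  note g = half_line_repD[OF fg]
  obtain g' where fg': "half_line_rep f' g'" using L2_half_line_borel_rep[OF f'] .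
  note g' = half_line_repD[OF fg']
  have [measurable]: "g \<in> borel_measurable borel" "g' \<in> borel_measurable borel" using g g' by (auto simp: L2_def)
  define H where "H z = laguerre_transform j f z * cnj (laguerre_transform k f' z)" for z
  have contH: "continuous_on \<bbbU> H"
    unfolding H_def by (intro continuous_intros laguerre_transform_continuous f f')
  have "integrable half_plane H"
    unfolding H_def by (intro L2_inner_integrable laguerre_transform_L2 f f')
  then have iH: "integrable lborel (\<lambda>z. indicator \<bbbU> z *\<^sub>R H z)"
    using upper_half_plane_integrable_iff[OF contH] by (simp add: set_integrable_def)
  obtain C where C: "\<And>t. t > 0 \<Longrightarrow> has_bochner_integral lborel (\<lambda>s. \<bar>laguerre_weight j k t s\<bar>) C"
    using laguerre_weight_abs_integral by blast
  have igg: "integrable lborel (\<lambda>t. g t * cnj (g' t))" by (rule L2_inner_integrable[OF g(1) g'(1)])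
  have pair: "integrable (lborel \<Otimes>\<^sub>M lborel) (\<lambda>(t, s). of_real (laguerre_weight j k t s) * (g t * cnj (g' t)))"
  proof (rule lborel_pair.Fubini_integrable)
    show "(\<lambda>(t, s). of_real (laguerre_weight j k t s) * (g t * cnj (g' t))) \<in> borel_measurable (lborel \<Otimes>\<^sub>M lborel)"
      by measurable
    have "(LINT s|lborel. norm (case (t, s) of (t, s) \<Rightarrow> of_real (laguerre_weight j k t s) * (g t * cnj (g' t)))) = C * cmod (g t * cnj (g' t))" for t
    proof (cases "t > 0")
      case True
      then show ?thesis using C[OF True] by (simp add: norm_mult has_bochner_integral_iff)
    qed (use g(2) in simp)
    then show "integrable lborel (\<lambda>t. LINT s|lborel. norm (case (t, s) of (t, s) \<Rightarrow> of_real (laguerre_weight j k t s) * (g t * cnj (g' t))))"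
      using igg by (simp only:) (intro integrable_mult_right integrable_norm)
    have "integrable lborel (\<lambda>s. of_real (laguerre_weight j k t s) * (g t * cnj (g' t)))" for t
    proof (cases "t > 0")
      case True
      then show ?thesis using laguerre_weight_integral[OF True, of j k]
        by (intro integrable_mult_left integrable_of_real) (auto simp: has_bochner_integral_iff)
    qed (use g(2) in simp)
    then show "AE t in lborel. integrable lborel (\<lambda>s. case (t, s) of (t, s) \<Rightarrow> of_real (laguerre_weight j k t s) * (g t * cnj (g' t)))"
      by simp
  qed
  have "l2_inner half_plane (laguerre_transform j f) (laguerre_transform k f') = (LINT z|lborel. indicator \<bbbU> z *\<^sub>R H z)"
    unfolding l2_inner_def H_def[symmetric] upper_half_plane_integral[OF contH] set_lebesgue_integral_def ..
  also have "\<dots> = (LINT s|lborel. LINT x|lborel. indicator \<bbbU> (Complex x s) *\<^sub>R H (Complex x s))"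
    by (rule integral_complex_iterated[OF iH])
  also have "\<dots> = (LINT s|lborel. (-1) ^ (j + k) * (LINT t|lborel. of_real (laguerre_weight j k t s) * (g t * cnj (g' t))))"
  proof (intro Bochner_Integration.integral_cong refl)
    fix s :: real
    show "(LINT x|lborel. indicator \<bbbU> (Complex x s) *\<^sub>R H (Complex x s)) = (-1) ^ (j + k) * (LINT t|lborel. of_real (laguerre_weight j k t s) * (g t * cnj (g' t)))"
    proof (cases "s > 0")
      case True
      show ?thesis unfolding laguerre_transform_slice_inner(2)[OF f fg f' fg' True, symmetric] H_def
        using True by (simp add: upper_half_plane_def)
    next
      case False
      then show ?thesis by (simp add: laguerre_weight_def upper_half_plane_def)
    qed
  qed
  also have "\<dots> = (-1) ^ (j + k) * (LINT s|lborel. LINT t|lborel. of_real (laguerre_weight j k t s) * (g t * cnj (g' t)))"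
    by simp
  also have "(LINT s|lborel. LINT t|lborel. of_real (laguerre_weight j k t s) * (g t * cnj (g' t))) =
     (LINT t|lborel. LINT s|lborel. of_real (laguerre_weight j k t s) * (g t * cnj (g' t)))"
    by (rule lborel_pair.Fubini_integral[OF pair])
  also have "\<dots> = (LINT t|lborel. (if j = k then 1 else 0) * (g t * cnj (g' t)))"
  proof (intro Bochner_Integration.integral_cong refl)
    fix t :: real
    show "(LINT s|lborel. of_real (laguerre_weight j k t s) * (g t * cnj (g' t))) = (if j = k then 1 else 0) * (g t * cnj (g' t))"
    proof (cases "t > 0")
      case True
      have "(LINT s|lborel. complex_of_real (laguerre_weight j k t s)) = (if j = k then 1 else 0)"
        using laguerre_weight_integral[OF True, of j k] by (simp add: integral_complex_of_real has_bochner_integral_iff)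
      then show ?thesis by (simp only: Bochner_Integration.integral_mult_left_zero)
    qed (use g(2) in simp)
  qed
  also have "(-1) ^ (j + k) * \<dots> = (if j = k then l2_inner half_line f f' else 0)"
  proof (cases "j = k")
    case True
    have "l2_inner half_line f f' = (LINT t|half_line. g t * cnj (g' t))"
      unfolding l2_inner_def
    proof (rule integral_cong_AE)
      show "AE t in half_line. f t * cnj (f' t) = g t * cnj (g' t)"
        using g(3) g'(3) by eventually_elim simp
      show "(\<lambda>t. f t * cnj (f' t)) \<in> borel_measurable half_line" using L2_inner_integrable[OF f f'] by auto
      show "(\<lambda>t. g t * cnj (g' t)) \<in> borel_measurable half_line" by (rule half_line_measurable) measurable
    qed
    also have "\<dots> = (LINT t|lborel. indicator {0<..} t *\<^sub>R (g t * cnj (g' t)))" by (rule half_line_integral) measurable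
    also have "\<dots> = (LINT t|lborel. g t * cnj (g' t))"
      using g(2) by (intro Bochner_Integration.integral_cong refl) (auto simp: indicator_def not_less)
    finally show ?thesis using True by (simp add: mult_2[symmetric] power_mult)
  qed simp
  finally show ?thesis .
qed

section \<open>Decomposition of the polyanalytic Bergman spaces\<close>

lemma exp_linear_decay: "((\<lambda>t. exp (- (s * t)) * (a * t + b)) \<longlongrightarrow> 0) at_top" if "s > 0" for s a b :: real
proof -
  have l1: "((\<lambda>t. (s * t) / exp (s * t)) \<longlongrightarrow> 0) at_top"
  proof (rule filterlim_compose[of "\<lambda>y. y / exp y" _ at_top "\<lambda>t. s * t"])
    show "((\<lambda>y. y / exp y) \<longlongrightarrow> (0::real)) at_top" using tendsto_power_div_exp_0[of 1] by simp
    show "filterlim (\<lambda>t. s * t) at_top at_top" using that by (rule filterlim_tendsto_pos_mult_at_top[OF tendsto_const _ filterlim_ident])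
  qed
  have l2: "((\<lambda>t. 1 / exp (s * t)) \<longlongrightarrow> 0) at_top"
  proof (rule filterlim_compose[of "\<lambda>y. 1 / exp y" _ at_top "\<lambda>t. s * t"])
    show "((\<lambda>y. 1 / exp y) \<longlongrightarrow> (0::real)) at_top" using tendsto_power_div_exp_0[of 0] by simp
    show "filterlim (\<lambda>t. s * t) at_top at_top" using that by (rule filterlim_tendsto_pos_mult_at_top[OF tendsto_const _ filterlim_ident])
  qed
  have "((\<lambda>t. (a / s) * ((s * t) / exp (s * t)) + b * (1 / exp (s * t))) \<longlongrightarrow> (a / s) * 0 + b * 0) at_top"
    by (intro tendsto_intros l1 l2)
  also have "(\<lambda>t. (a / s) * ((s * t) / exp (s * t)) + b * (1 / exp (s * t))) = (\<lambda>t. exp (- (s * t)) * (a * t + b))"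
    using that by (auto simp: exp_minus field_simps)
  finally show ?thesis by simp
qed

lemma laplace_kernel_mult: "t > 0 \<Longrightarrow> laplace_kernel a z t * laplace_kernel b z' t = of_real (t ^ (a + b + 1)) * exp (\<i> * (z + z') * of_real t)"
proof -
  assume t: "t > 0"
  have "laplace_kernel a z t * laplace_kernel b z' t = of_real ((t powr (1/2) * t powr (1/2)) * (t ^ a * t ^ b)) * (exp (\<i> * z * of_real t) * exp (\<i> * z' * of_real t))"
    by (simp add: laplace_kernel_def)
  also have "t powr (1/2) * t powr (1/2) = t" using t by (simp add: powr_half_sqrt)
  also have "exp (\<i> * z * of_real t) * exp (\<i> * z' * of_real t) = exp (\<i> * (z + z') * of_real t)"
    by (simp add: exp_add[symmetric] algebra_simps)
  finally show ?thesis by (simp add: power_add)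
qed

lemma laplace_kernel_shift:
  assumes "Im z > 0" shows "laplace a (laplace_kernel b z') z = laplace (a + b) (laplace_kernel 0 z') z"
  unfolding laplace_def by (intro Bochner_Integration.integral_cong refl) (simp add: laplace_kernel_mult)

text \<open>
  The integral of \<open>t exp (i \<zeta> t)\<close>, by the fundamental theorem of calculus.
\<close>

lemma laplace_kernel_base:
  assumes z: "Im z > 0" and z': "Im z' > 0"
  shows "laplace 0 (laplace_kernel 0 z') z = 1 / (- \<i> * (z + z'))\<^sup>2"
proof -
  define \<zeta> where "\<zeta> = z + z'"
  have \<zeta>: "Im \<zeta> > 0" using z z' by (simp add: \<zeta>_def)
  then have \<zeta>0: "\<zeta> \<noteq> 0" by auto
  \<comment> \<open>An antiderivative of \<open>t exp (i \<zeta> t)\<close>.\<close>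
  define F where "F t = (of_real t / (\<i> * \<zeta>) + 1 / \<zeta>\<^sup>2) * exp (\<i> * \<zeta> * of_real t)" for t :: real
  define k where "k t = of_real t * exp (\<i> * \<zeta> * of_real t)" for t :: real
  have km: "k \<in> borel_measurable borel" unfolding k_def[abs_def] by measurable
  have "integrable half_line (\<lambda>t. laplace_kernel 0 z t * laplace_kernel 0 z' t)"
    by (rule laplace_integrable[OF laplace_kernel_L2[OF z'] z])
  also have "integrable half_line (\<lambda>t. laplace_kernel 0 z t * laplace_kernel 0 z' t) \<longleftrightarrow> integrable half_line k"
    by (intro Bochner_Integration.integrable_cong) (auto simp: laplace_kernel_mult k_def \<zeta>_def)
  finally have ki: "set_integrable lborel {0<..} k"
    unfolding half_line_integrable_iff[OF km] set_integrable_def .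
  have "laplace 0 (laplace_kernel 0 z') z = integral\<^sup>L half_line k"
    unfolding laplace_def by (intro Bochner_Integration.integral_cong refl) (auto simp: laplace_kernel_mult k_def \<zeta>_def)
  also have "\<dots> = (LINT t:{0<..}|lborel. k t)"
    unfolding half_line_integral[OF km] set_lebesgue_integral_def ..
  also have "\<dots> = (LBINT t=0..\<infinity>. k t)"
    by (simp add: interval_lebesgue_integral_0_infty)
  also have "\<dots> = 0 - 1 / \<zeta>\<^sup>2"
  proof (rule interval_integral_FTC_integrable)
    fix t :: real
    have "(F has_vector_derivative (1 / (\<i> * \<zeta>)) * exp (\<i> * \<zeta> * of_real t) + (of_real t / (\<i> * \<zeta>) + 1 / \<zeta>\<^sup>2) * (\<i> * \<zeta> * exp (\<i> * \<zeta> * of_real t))) (at t)"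
    proof -
      have "((\<lambda>w. (w / (\<i> * \<zeta>) + 1 / \<zeta>\<^sup>2) * exp (\<i> * \<zeta> * w)) has_field_derivative
         (1 / (\<i> * \<zeta>)) * exp (\<i> * \<zeta> * w) + (w / (\<i> * \<zeta>) + 1 / \<zeta>\<^sup>2) * (\<i> * \<zeta> * exp (\<i> * \<zeta> * w))) (at w)" for w
        using \<zeta>0 by (auto intro!: derivative_eq_intros simp: field_simps)
      moreover have "(complex_of_real has_vector_derivative 1) (at t)"
        using has_vector_derivative_of_real[OF DERIV_ident] by simp
      ultimately show ?thesis
        using field_vector_diff_chain_at[of complex_of_real 1 t] unfolding F_def[abs_def] o_def by fastforce
    qed
    also have "(1 / (\<i> * \<zeta>)) * exp (\<i> * \<zeta> * of_real t) + (of_real t / (\<i> * \<zeta>) + 1 / \<zeta>\<^sup>2) * (\<i> * \<zeta> * exp (\<i> * \<zeta> * of_real t)) = k t"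
    proof -
      have 1: "1 / (\<i> * \<zeta>) + (c / (\<i> * \<zeta>) + 1 / \<zeta>\<^sup>2) * (\<i> * \<zeta>) = c" for c
        using \<zeta>0 by (simp add: field_simps power2_eq_square)
      have 2: "A * E + B * (C * E) = (A + B * C) * E" for A B C E :: complex by (simp add: algebra_simps)
      show ?thesis unfolding k_def 2 1 ..
    qed
    finally show "(F has_vector_derivative k t) (at t)" .
    show "isCont k t" unfolding k_def by (intro continuous_intros)
  next
    have "einterval 0 \<infinity> = {0<..}" by (auto simp: einterval_def)
    then show "set_integrable lborel (einterval 0 \<infinity>) k" using ki by simp
    have "isCont F 0" unfolding F_def by (intro continuous_intros) (use \<zeta>0 in auto)
    then have "(F \<longlongrightarrow> F 0) (at_right 0)" by (simp add: isCont_def filterlim_at_split)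
    then show "((F \<circ> real_of_ereal) \<longlongrightarrow> 1 / \<zeta>\<^sup>2) (at_right 0)"
      using ereal_tendsto_simps(2)[of F "1/\<zeta>\<^sup>2" 0] by (simp add: F_def zero_ereal_def)
    have "(F \<longlongrightarrow> 0) at_top"
    proof (rule Lim_null_comparison)
      show "\<forall>\<^sub>F t in at_top. norm (F t) \<le> exp (- (Im \<zeta> * t)) * ((1 / cmod \<zeta>) * t + 1 / (cmod \<zeta>)\<^sup>2)"
      proof (rule eventually_mono[OF eventually_ge_at_top[of 0]])
        fix t :: real assume t: "t \<ge> 0"
        have "norm (F t) = cmod (of_real t / (\<i> * \<zeta>) + 1 / \<zeta>\<^sup>2) * exp (- (Im \<zeta> * t))"
          by (simp add: F_def norm_mult)
        also have "\<dots> \<le> (t / cmod \<zeta> + 1 / (cmod \<zeta>)\<^sup>2) * exp (- (Im \<zeta> * t))"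
          using t by (intro mult_right_mono order_trans[OF norm_triangle_ineq]) (auto simp: norm_divide norm_mult norm_power)
        finally show "norm (F t) \<le> exp (- (Im \<zeta> * t)) * ((1 / cmod \<zeta>) * t + 1 / (cmod \<zeta>)\<^sup>2)" by (simp add: mult.commute)
      qed
      show "((\<lambda>t. exp (- (Im \<zeta> * t)) * ((1 / cmod \<zeta>) * t + 1 / (cmod \<zeta>)\<^sup>2)) \<longlongrightarrow> 0) at_top"
        by (rule exp_linear_decay[OF \<zeta>])
    qed
    then show "((F \<circ> real_of_ereal) \<longlongrightarrow> 0) (at_left \<infinity>)"
      by (simp add: ereal_tendsto_simps)
  qed auto
  also have "0 - 1 / \<zeta>\<^sup>2 = 1 / (- \<i> * \<zeta>)\<^sup>2" unfolding power_mult_distrib by simp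
  finally show ?thesis by (simp add: \<zeta>_def)
qed

text \<open>
  Both sides satisfy the same recursion under differentiation in \<open>z\<close>.
\<close>

lemma laplace_kernel_power:
  assumes z': "Im z' > 0"
  shows "Im z > 0 \<Longrightarrow> laplace m (laplace_kernel 0 z') z = fact (m + 1) / (- \<i> * (z + z')) ^ (m + 2)"
proof (induction m arbitrary: z)
  case 0
  then show ?case using laplace_kernel_base[OF 0 z'] by (simp add: power2_eq_square)
next
  case (Suc m)
  define R where "R w = fact (m + 1) / (- \<i> * (w + z')) ^ (m + 2)" for w
  have zU: "z \<in> \<bbbU>" using Suc.prems by (simp add: upper_half_plane_iff)
  have n: "- \<i> * (z + z') \<noteq> 0" using Suc.prems z' by (auto simp: complex_eq_iff)
  have "(laplace m (laplace_kernel 0 z') has_field_derivative \<i> * laplace (Suc m) (laplace_kernel 0 z') z) (at z)"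
    by (rule has_field_derivative_laplace[OF laplace_kernel_L2[OF z'] Suc.prems])
  then have 1: "(R has_field_derivative \<i> * laplace (Suc m) (laplace_kernel 0 z') z) (at z)"
    by (rule has_field_derivative_transform_within_open[OF _ open_upper_half_plane zU])
       (use Suc.IH in \<open>auto simp: R_def upper_half_plane_iff\<close>)
  define x where "x = - \<i> * (z + z')"
  have p: "((\<lambda>w. (- \<i> * (w + z')) ^ (m + 2)) has_field_derivative (of_nat (m + 2) * x ^ (m + 1) * (- \<i>))) (at z)"
  proof -
    have q: "((\<lambda>w. - \<i> * (w + z')) has_field_derivative - \<i>) (at z)"
      by (auto intro!: derivative_eq_intros)
    have "of_nat (m + 2) * (- \<i> * (- \<i> * (z + z')) ^ (m + 2 - Suc 0)) = of_nat (m + 2) * x ^ (m + 1) * (- \<i>)"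
      unfolding x_def[symmetric] by (simp add: mult_ac)
    with DERIV_power[OF q, of "m + 2"] show ?thesis by (simp only:)
  qed
  have "((\<lambda>w. inverse ((- \<i> * (w + z')) ^ (m + 2))) has_field_derivative
      - (inverse (x ^ (m + 2)) * (of_nat (m + 2) * x ^ (m + 1) * (- \<i>)) * inverse (x ^ (m + 2)))) (at z)"
    unfolding x_def by (rule DERIV_inverse'[OF p[unfolded x_def]]) (use n in simp)
  from DERIV_cmult[OF this, of "fact (m + 1)"]
  have 2: "(R has_field_derivative fact (m + 1) * (- (inverse (x ^ (m + 2)) * (of_nat (m + 2) * x ^ (m + 1) * (- \<i>)) * inverse (x ^ (m + 2))))) (at z)"
    unfolding R_def[abs_def] by (simp only: divide_inverse)
  have x0: "x \<noteq> 0" using n by (simp only: x_def not_False_eq_True)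
  have "\<i> * laplace (Suc m) (laplace_kernel 0 z') z =
      fact (m + 1) * (- (inverse (x ^ (m + 2)) * (of_nat (m + 2) * x ^ (m + 1) * (- \<i>)) * inverse (x ^ (m + 2))))"
    by (rule DERIV_unique[OF 1 2])
  also have "\<dots> = \<i> * (of_nat (m + 2) * fact (m + 1)) * ((x ^ (m + 1) * inverse (x ^ (m + 2))) * inverse (x ^ (m + 2)))"
    by (simp only: mult_minus_left mult_minus_right minus_minus mult_ac)
  also have "x ^ (m + 1) * inverse (x ^ (m + 2)) = inverse x" using x0 by (simp add: field_simps)
  also have "of_nat (m + 2) * fact (m + 1) = (fact (Suc m + 1) :: complex)" by simp
  also have "inverse x * inverse (x ^ (m + 2)) = inverse (x ^ (Suc m + 2))" by simp
  also have "\<i> * fact (Suc m + 1) * inverse (x ^ (Suc m + 2)) = \<i> * (fact (Suc m + 1) / (- \<i> * (z + z')) ^ (Suc m + 2))"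
    unfolding x_def divide_inverse mult.assoc ..
  finally have e: "\<i> * laplace (Suc m) (laplace_kernel 0 z') z = \<i> * (fact (Suc m + 1) / (- \<i> * (z + z')) ^ (Suc m + 2))" .
  show ?case by (rule mult_left_cancel[THEN iffD1, OF complex_i_not_zero e])
qed

text \<open>
  The power \<open>(Im z t)\<^sup>a\<close> is a combination of Laguerre polynomials in \<open>2 Im z t\<close>.
\<close>

lemma Im_power_laplace_in_span:
  assumes f: "f \<in> L2 half_line"
  obtains c where "\<And>z. z \<in> \<bbbU> \<Longrightarrow> of_real (Im z) ^ a * laplace a f z = (\<Sum>k\<le>a. c k * laguerre_transform k f z)"
proof -
  obtain b where b: "\<And>y. y ^ a = (\<Sum>k\<le>a. b k * laguerre k y)" using power_eq_laguerre_sum by blast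
  define c :: "nat \<Rightarrow> complex" where "c k = of_real (b k / 2 ^ a / ((-1) ^ k / sqrt pi))" for k
  have "of_real (Im z) ^ a * laplace a f z = (\<Sum>k\<le>a. c k * laguerre_transform k f z)" if z: "z \<in> \<bbbU>" for z
  proof -
    have Imz: "Im z > 0" using z by (simp add: upper_half_plane_iff)
    have ker: "of_real (Im z) ^ a * laplace_kernel a z t = (\<Sum>k\<le>a. of_real (b k / 2 ^ a) * laguerre_kernel k z t)" for t
    proof -
      have "Im z ^ a * t ^ a = (2 * Im z * t) ^ a / 2 ^ a" by (simp add: power_mult_distrib)
      also have "\<dots> = (\<Sum>k\<le>a. b k / 2 ^ a * laguerre k (2 * Im z * t))"
        unfolding b by (simp add: sum_divide_distrib)
      finally have "complex_of_real (Im z ^ a * t ^ a) = (\<Sum>k\<le>a. of_real (b k / 2 ^ a) * of_real (laguerre k (2 * Im z * t)))" by simp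
      moreover have "of_real (Im z) ^ a * laplace_kernel a z t = complex_of_real (Im z ^ a * t ^ a) * laplace_kernel 0 z t"
        by (simp add: laplace_kernel_def)
      ultimately show ?thesis by (simp add: laguerre_kernel_def sum_distrib_right mult.assoc)
    qed
    have "of_real (Im z) ^ a * laplace a f z = (LINT t|half_line. of_real (Im z) ^ a * laplace_kernel a z t * f t)"
      by (simp add: laplace_def mult.assoc)
    also have "\<dots> = (LINT t|half_line. (\<Sum>k\<le>a. of_real (b k / 2 ^ a) * (laguerre_kernel k z t * f t)))"
      unfolding ker by (simp add: sum_distrib_right mult.assoc)
    also have "\<dots> = (\<Sum>k\<le>a. LINT t|half_line. of_real (b k / 2 ^ a) * (laguerre_kernel k z t * f t))"
      by (rule Bochner_Integration.integral_sum) (intro integrable_mult_right L2_mult_integrable laguerre_kernel_L2 f Imz)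
    also have "\<dots> = (\<Sum>k\<le>a. c k * laguerre_transform k f z)"
    proof (intro sum.cong refl)
      fix k
      have "c k * of_real ((-1) ^ k / sqrt pi) = of_real (b k / 2 ^ a)"
        unfolding c_def of_real_mult[symmetric] by simp
      then show "(LINT t|half_line. of_real (b k / 2 ^ a) * (laguerre_kernel k z t * f t)) = c k * laguerre_transform k f z"
        unfolding laguerre_transform_def Bochner_Integration.integral_mult_right_zero by (simp only: mult.assoc[symmetric])
    qed
    finally show ?thesis .
  qed
  then show ?thesis by (rule that)
qed

text \<open>
  The Laplace transforms of a Laplace kernel at the point \<open>- cnj w\<close> are negative powers of \<open>z - cnj w\<close>. The
  condition on \<open>m\<close> is what makes that kernel square integrable.
\<close>

lemma test_building_block_in_span:
  assumes w: "w \<in> \<bbbU>" and m: "m \<ge> a + 2"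
  obtains f c where "f \<in> L2 half_line"
    "\<And>z. z \<in> \<bbbU> \<Longrightarrow> of_real (Im z) ^ a / (z - cnj w) ^ m = (\<Sum>k\<le>a. c k * laguerre_transform k f z)"
proof -
  have w': "Im (- cnj w) > 0" using w by (simp add: upper_half_plane_iff)
  \<comment> \<open>The order \<open>m - a - 2\<close> makes \<open>laplace a f\<close> a multiple of \<open>(z - cnj w) powi (- m)\<close>.\<close>
  define f where "f = laplace_kernel (m - a - 2) (- cnj w)"
  have f: "f \<in> L2 half_line" unfolding f_def by (rule laplace_kernel_L2[OF w'])
  obtain c where c: "\<And>z. z \<in> \<bbbU> \<Longrightarrow> of_real (Im z) ^ a * laplace a f z = (\<Sum>k\<le>a. c k * laguerre_transform k f z)"
    using Im_power_laplace_in_span[OF f, of a] by blast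
  define d where "d = (- \<i>) ^ m / fact (m - 1)"
  have "of_real (Im z) ^ a / (z - cnj w) ^ m = (\<Sum>k\<le>a. (d * c k) * laguerre_transform k f z)" if z: "z \<in> \<bbbU>" for z
  proof -
    have Imz: "Im z > 0" using z by (simp add: upper_half_plane_iff)
    have "laplace a f z = laplace (m - 2) (laplace_kernel 0 (- cnj w)) z"
      using laplace_kernel_shift[OF Imz, of a "m - a - 2" "- cnj w"] m by (simp add: f_def)
    also have "\<dots> = fact (m - 2 + 1) / (- \<i> * (z + - cnj w)) ^ (m - 2 + 2)"
      by (rule laplace_kernel_power[OF w' Imz])
    also have "m - 2 + 1 = m - 1" using m by simp
    also have "m - 2 + 2 = m" using m by simp
    finally have l: "laplace a f z = fact (m - 1) / ((- \<i>) ^ m * (z - cnj w) ^ m)" by (simp add: power_mult_distrib[symmetric])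
    have "of_real (Im z) ^ a / (z - cnj w) ^ m = d * (of_real (Im z) ^ a * laplace a f z)"
      unfolding l d_def by simp
    also have "\<dots> = (\<Sum>k\<le>a. (d * c k) * laguerre_transform k f z)"
      unfolding c[OF z] by (simp add: sum_distrib_left mult.assoc)
    finally show ?thesis .
  qed
  with f show ?thesis by (rule that)
qed

definition orthogonal_to :: "(complex \<Rightarrow> complex) \<Rightarrow> (complex \<Rightarrow> complex) \<Rightarrow> bool"
  where "orthogonal_to G u \<longleftrightarrow> u \<in> L2 half_plane \<and> l2_inner half_plane u G = 0"

lemma orthogonal_to_lin:
  assumes "G \<in> L2 half_plane" "orthogonal_to G u" "orthogonal_to G v"
  shows "orthogonal_to G (\<lambda>z. a * u z + b * v z)"
  using assms l2_inner_lin_left[of u "lebesgue_on \<bbbU>" v G a b] L2_add[OF L2_scale L2_scale, of u "lebesgue_on \<bbbU>" v a b]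
  by (simp add: orthogonal_to_def)

lemma orthogonal_to_sum:
  assumes G: "G \<in> L2 half_plane" and u: "\<And>i. i \<in> I \<Longrightarrow> orthogonal_to G (u i)"
  shows "orthogonal_to G (\<lambda>z. \<Sum>i\<in>I. c i * u i z)"
proof -
  have L: "(\<lambda>z. c i * u i z) \<in> L2 half_plane" if "i \<in> I" for i
    using u[OF that] by (intro L2_scale) (simp add: orthogonal_to_def)
  have "l2_inner half_plane (\<lambda>z. \<Sum>i\<in>I. c i * u i z) G = (\<Sum>i\<in>I. l2_inner half_plane (\<lambda>z. c i * u i z) G)"
    by (rule l2_inner_sum_left[OF _ G]) (rule L)
  also have "\<dots> = 0"
    by (intro sum.neutral ballI) (use u in \<open>simp add: l2_inner_scale_left orthogonal_to_def\<close>)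
  finally have e: "l2_inner half_plane (\<lambda>z. \<Sum>i\<in>I. c i * u i z) G = 0" .
  have "(\<lambda>z. \<Sum>i\<in>I. c i * u i z) \<in> L2 half_plane" by (rule L2_sum) (rule L)
  with e show ?thesis unfolding orthogonal_to_def by (intro conjI)
qed

lemma orthogonal_to_cong:
  assumes "orthogonal_to G u" "\<And>z. z \<in> \<bbbU> \<Longrightarrow> v z = u z"
  shows "orthogonal_to G v"
  using assms L2_cong[of "lebesgue_on \<bbbU>" v u] l2_inner_cong[of "lebesgue_on \<bbbU>" v u G G]
  by (auto simp: orthogonal_to_def)

text \<open>
  Powers of \<open>cnj z - w\<close> are removed one by one through
  \<open>cnj z - w = (z - cnj w) - 2 i (Im z + Im w)\<close>. Each step keeps \<open>j + p \<le> n\<close> and \<open>m \<ge> j + p + 2\<close>.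
\<close>

lemma orthogonal_to_test:
  assumes G: "G \<in> L2 half_plane" and w: "w \<in> \<bbbU>"
    and orth: "\<And>k f. k \<le> n \<Longrightarrow> f \<in> L2 half_line \<Longrightarrow> l2_inner half_plane (laguerre_transform k f) G = 0"
  shows "j + p \<le> n \<Longrightarrow> m \<ge> j + p + 2 \<Longrightarrow>
    orthogonal_to G (\<lambda>z. of_real (Im z) ^ j * (cnj z - w) ^ p / (z - cnj w) ^ m)"
proof (induction p arbitrary: j m)
  case 0
  obtain f c where f: "f \<in> L2 half_line"
    and c: "\<And>z. z \<in> \<bbbU> \<Longrightarrow> of_real (Im z) ^ j / (z - cnj w) ^ m = (\<Sum>k\<le>j. c k * laguerre_transform k f z)"
    using test_building_block_in_span[OF w, of j m] 0 by auto
  have "orthogonal_to G (\<lambda>z. \<Sum>k\<le>j. c k * laguerre_transform k f z)"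
    by (rule orthogonal_to_sum[OF G]) (use orth f 0 in \<open>auto simp: orthogonal_to_def laguerre_transform_L2\<close>)
  then show ?case by (rule orthogonal_to_cong) (simp add: c)
next
  case (Suc p)
  define T where "T j m z = of_real (Im z) ^ j * (cnj z - w) ^ p / (z - cnj w) ^ m" for j m z
  have 1: "orthogonal_to G (T j (m - 1))" unfolding T_def by (rule Suc.IH) (use Suc.prems in auto)
  have 2: "orthogonal_to G (T (Suc j) m)" unfolding T_def by (rule Suc.IH) (use Suc.prems in auto)
  have 3: "orthogonal_to G (T j m)" unfolding T_def by (rule Suc.IH) (use Suc.prems in auto)
  have "orthogonal_to G (\<lambda>z. 1 * (1 * T j (m - 1) z + (- 2 * \<i>) * T (Suc j) m z) + (- 2 * \<i> * of_real (Im w)) * T j m z)"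
    by (intro orthogonal_to_lin G 1 2 3)
  then show ?case
  proof (rule orthogonal_to_cong)
    fix z assume z: "z \<in> \<bbbU>"
    have n: "z - cnj w \<noteq> 0" using z w by (auto simp: upper_half_plane_iff complex_eq_iff)
    have cz: "cnj z - w = (z - cnj w) - 2 * \<i> * of_real (Im z) - 2 * \<i> * of_real (Im w)"
      by (simp add: complex_eq_iff)
    have m: "(z - cnj w) ^ m = (z - cnj w) * (z - cnj w) ^ (m - 1)"
      using Suc.prems by (cases m) auto
    have a: "S * (X - 2 * \<i> * s - 2 * \<i> * v) * A / (X * Y) = 1 * (1 * (S * A / Y) + (- 2 * \<i>) * (s * S * A / (X * Y))) + (- 2 * \<i> * v) * (S * A / (X * Y))"
      if "X \<noteq> 0" "Y \<noteq> 0" for X Y S A s v :: complex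
      using that by (simp add: field_simps)
    have "of_real (Im z) ^ j * (cnj z - w) ^ Suc p / (z - cnj w) ^ m =
      of_real (Im z) ^ j * (cnj z - w) * (cnj z - w) ^ p / ((z - cnj w) * (z - cnj w) ^ (m - 1))"
      unfolding m by simp
    also have "\<dots> = of_real (Im z) ^ j * ((z - cnj w) - 2 * \<i> * of_real (Im z) - 2 * \<i> * of_real (Im w)) * (cnj z - w) ^ p / ((z - cnj w) * (z - cnj w) ^ (m - 1))"
      unfolding cz[symmetric] ..
    also have "\<dots> = 1 * (1 * T j (m - 1) z + (- 2 * \<i>) * T (Suc j) m z) + (- 2 * \<i> * of_real (Im w)) * T j m z"
      unfolding T_def m power_Suc by (rule a) (use n in auto)
    finally show "of_real (Im z) ^ j * (cnj z - w) ^ Suc p / (z - cnj w) ^ m =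
      1 * (1 * T j (m - 1) z + (- 2 * \<i>) * T (Suc j) m z) + (- 2 * \<i> * of_real (Im w)) * T j m z" .
  qed
qed

text \<open>
  Orthogonality of the ranges makes the sum of the projections onto them the projection onto their
  sum; the remainder vanishes by \<open>bergman_uniqueness\<close>.
\<close>

theorem poly_bergman_decomposition:
  assumes F: "F \<in> poly_bergman N"
  obtains f where "\<And>k. f k \<in> L2 half_line" "\<And>z. z \<in> \<bbbU> \<Longrightarrow> F z = (\<Sum>k<N. laguerre_transform k (f k) z)"
proof (cases N)
  case 0
  then show ?thesis using F that[of "\<lambda>_ _. 0"] by (auto simp: poly_bergman_iff polyanalytic_sum_def L2_zero)
next
  case (Suc n)
  have FL: "F \<in> L2 half_plane" and Fp: "polyanalytic_sum (Suc n) F"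
    using F by (auto simp: poly_bergman_iff Suc)
  have "\<exists>f. f \<in> L2 half_line \<and> (\<forall>g\<in>L2 half_line. l2_inner half_plane (\<lambda>z. F z - laguerre_transform k f z) (laguerre_transform k g) = 0)" for k
  proof (rule isometry_projection[of half_line "laguerre_transform k" "lebesgue_on \<bbbU>" F])
    show "laguerre_transform k f \<in> L2 half_plane" if "f \<in> L2 half_line" for f
      by (rule laguerre_transform_L2[OF that])
    show "laguerre_transform k (\<lambda>x. a * f x + b * g x) z = a * laguerre_transform k f z + b * laguerre_transform k g z"
      if "f \<in> L2 half_line" "g \<in> L2 half_line" "z \<in> space half_plane" for f g a b z
      using that by (intro laguerre_transform_linear) (auto simp: upper_half_plane_iff)
    show "l2_sq half_plane (laguerre_transform k f) = l2_sq half_line f" if f: "f \<in> L2 half_line" for f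
    proof -
      have "complex_of_real (l2_sq half_plane (laguerre_transform k f)) = of_real (l2_sq half_line f)"
        unfolding l2_inner_self[symmetric] laguerre_transform_orthonormal[OF f f] by simp
      then show ?thesis by (simp only: of_real_eq_iff)
    qed
  qed (use FL in blast)+
  then obtain f where f: "\<And>k. f k \<in> L2 half_line"
    and proj: "\<And>k g. g \<in> L2 half_line \<Longrightarrow> l2_inner half_plane (\<lambda>z. F z - laguerre_transform k (f k) z) (laguerre_transform k g) = 0"
    by metis
  define S where "S z = (\<Sum>k<Suc n. laguerre_transform k (f k) z)" for z
  have SL: "S \<in> L2 half_plane" unfolding S_def by (intro L2_sum laguerre_transform_L2 f)
  have Sp: "polyanalytic_sum (Suc n) S"
    unfolding S_def by (intro polyanalytic_sum_sum laguerre_transform_polyanalytic_sum f) auto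
  define G where "G z = F z - S z" for z
  have GL: "G \<in> L2 half_plane" unfolding G_def by (intro L2_diff FL SL)
  have Gp: "polyanalytic_sum (Suc n) G"
    using polyanalytic_sum_lin[OF Fp Sp, of 1 "-1"] by (simp add: G_def[abs_def])
  have orth: "l2_inner half_plane (laguerre_transform j g) G = 0" if j: "j \<le> n" and g: "g \<in> L2 half_line" for j g
  proof -
    note TL = laguerre_transform_L2
    have "l2_inner half_plane S (laguerre_transform j g) =
      (\<Sum>k<Suc n. l2_inner half_plane (laguerre_transform k (f k)) (laguerre_transform j g))"
      unfolding S_def by (rule l2_inner_sum_left) (intro TL f g)+
    also have "\<dots> = (\<Sum>k<Suc n. if k = j then l2_inner half_line (f j) g else 0)"
      by (intro sum.cong refl) (auto simp: laguerre_transform_orthonormal[OF f g])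
    also have "\<dots> = l2_inner half_plane (laguerre_transform j (f j)) (laguerre_transform j g)"
      using j by (simp add: laguerre_transform_orthonormal[OF f g] del: sum.lessThan_Suc)
    finally have "l2_inner half_plane G (laguerre_transform j g) = l2_inner half_plane (\<lambda>z. F z - laguerre_transform j (f j) z) (laguerre_transform j g)"
      unfolding G_def l2_inner_diff_left[OF FL SL TL[OF g]] l2_inner_diff_left[OF FL TL[OF f] TL[OF g]] by simp
    then have "l2_inner half_plane G (laguerre_transform j g) = 0" using proj[OF g] by simp
    then show ?thesis by (subst l2_inner_commute) simp
  qed
  obtain \<phi> where \<phi>: "\<And>k. \<phi> k holomorphic_on \<bbbU>" and G: "\<And>z. z \<in> \<bbbU> \<Longrightarrow> G z = (\<Sum>k\<le>n. of_real (Im z) ^ k * \<phi> k z)"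
    using Gp unfolding polyanalytic_sum_def lessThan_Suc_atMost by blast
  have "G w = 0" if w: "w \<in> \<bbbU>" for w
  proof -
    have t: "orthogonal_to G (bergman_test n w j)" if "j \<le> n" for j
      unfolding bergman_test_def[abs_def] by (rule orthogonal_to_test[OF GL w orth]) (use that in auto)
    show ?thesis
    proof (rule bergman_uniqueness[where n=n and \<phi>=\<phi>, OF \<phi> G GL w])
      fix j assume j: "j \<le> n"
      show "bergman_test n w j \<in> L2 half_plane" using t[OF j] by (simp add: orthogonal_to_def)
      show "l2_inner half_plane G (bergman_test n w j) = 0"
        using t[OF j] by (subst l2_inner_commute) (simp add: orthogonal_to_def)
    qed
  qed
  note G0 = this
  show ?thesis
  proof (rule that[of f])
    show "F z = (\<Sum>k<N. laguerre_transform k (f k) z)" if "z \<in> \<bbbU>" for z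
      using G0[OF that] unfolding G_def S_def Suc by (simp only: right_minus_eq)
  qed (rule f)
qed

text \<open>
  The range of order \<open>n\<close> is orthogonal to the ranges of smaller order, which make up the polyanalytic
  Bergman space of order \<open>n\<close>. Conversely, a member of the true space has vanishing components of smaller order.
\<close>

theorem theorem1:
  fixes n :: nat
  shows "unitary_L2 (lebesgue_on {0<..}) (lebesgue_on \<bbbU>) (true_poly_bergman n)
           (normalized_true_Ber n)"
  unfolding unitary_L2_def
proof (intro conjI ballI allI impI)
  note TL = laguerre_transform_L2
  have inner_eq: "l2_inner half_plane (normalized_true_Ber n f) G = l2_inner half_plane (laguerre_transform n f) G"
    if "f \<in> L2 half_line" for f G
    by (rule l2_inner_cong) (auto simp: normalized_true_Ber_eq[OF that])
  have psum_cong: "polyanalytic_sum N F" if "polyanalytic_sum N F'" "\<And>z. z \<in> \<bbbU> \<Longrightarrow> F z = F' z" for N F F'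
    using that by (simp add: polyanalytic_sum_def)
  {
    fix f assume f: "f \<in> L2 half_line"
    have "normalized_true_Ber n f \<in> L2 half_plane"
      using L2_cong[of "lebesgue_on \<bbbU>" "normalized_true_Ber n f" "laguerre_transform n f"] TL[OF f, of n]
      by (simp add: normalized_true_Ber_eq[OF f])
    moreover have "polyanalytic_sum (Suc n) (normalized_true_Ber n f)"
      by (rule psum_cong[OF laguerre_transform_polyanalytic_sum[OF f order_refl] normalized_true_Ber_eq[OF f]])
    moreover have "l2_inner half_plane (normalized_true_Ber n f) G = 0" if G: "G \<in> poly_bergman n" for G
    proof -
      obtain g where g: "\<And>k. g k \<in> L2 half_line" and Gg: "\<And>z. z \<in> \<bbbU> \<Longrightarrow> G z = (\<Sum>k<n. laguerre_transform k (g k) z)"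
        using poly_bergman_decomposition[OF G] by blast
      have "l2_inner half_plane G (laguerre_transform n f) =
         l2_inner half_plane (\<lambda>z. \<Sum>k<n. laguerre_transform k (g k) z) (laguerre_transform n f)"
        by (rule l2_inner_cong) (auto simp: Gg)
      also have "\<dots> = (\<Sum>k<n. l2_inner half_plane (laguerre_transform k (g k)) (laguerre_transform n f))"
        by (rule l2_inner_sum_left) (intro TL g f)+
      also have "\<dots> = 0" by (intro sum.neutral) (auto simp: laguerre_transform_orthonormal[OF g f])
      finally have "l2_inner half_plane (laguerre_transform n f) G = 0"
        by (subst l2_inner_commute) simp
      then show ?thesis using inner_eq[OF f] by simp
    qed
    ultimately show "normalized_true_Ber n f \<in> true_poly_bergman n"
      by (simp add: true_poly_bergman_def poly_bergman_iff)
  }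
  {
    fix f g z assume "f \<in> L2 half_line" "g \<in> L2 half_line" "AE x in half_line. f x = g x"
    then have [measurable]: "f \<in> borel_measurable half_line" "g \<in> borel_measurable half_line"
      and ae: "AE x in half_line. f x = g x" by (auto simp: L2_def)
    have "Ber f = Ber g"
    proof (rule ext)
      fix w
      have km: "(\<lambda>t. exp (\<i> * w * of_real t)) \<in> borel_measurable half_line"
        "(\<lambda>t. complex_of_real (t powr (1/2))) \<in> borel_measurable half_line"
        by (rule half_line_measurable; measurable)+
      show "Ber f w = Ber g w"
        unfolding Ber_def
      proof (rule integral_cong_AE)
        show "AE t in half_line. of_real (t powr (1/2)) * f t * exp (\<i> * w * of_real t) = of_real (t powr (1/2)) * g t * exp (\<i> * w * of_real t)"
          using ae by eventually_elim simp
      qed (use km in measurable)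
    qed
    then show "normalized_true_Ber n f z = normalized_true_Ber n g z"
      by (simp add: normalized_true_Ber_def true_Ber_def)
  }
  {
    fix f g a b z assume f: "f \<in> L2 half_line" and g: "g \<in> L2 half_line" and "z \<in> space half_plane"
    then have z: "z \<in> \<bbbU>" by simp
    have fg: "(\<lambda>x. a * f x + b * g x) \<in> L2 half_line" by (rule L2_add[OF L2_scale[OF f] L2_scale[OF g]])
    show "normalized_true_Ber n (\<lambda>x. a * f x + b * g x) z = a * normalized_true_Ber n f z + b * normalized_true_Ber n g z"
      unfolding normalized_true_Ber_eq[OF fg z] normalized_true_Ber_eq[OF f z] normalized_true_Ber_eq[OF g z]
      by (rule laguerre_transform_linear[OF f g]) (use z in \<open>simp add: upper_half_plane_iff\<close>)
  }
  {
    fix f g assume f: "f \<in> L2 half_line" and g: "g \<in> L2 half_line"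
    have "l2_inner half_plane (normalized_true_Ber n f) (normalized_true_Ber n g) =
      l2_inner half_plane (laguerre_transform n f) (laguerre_transform n g)"
      by (rule l2_inner_cong) (auto simp: normalized_true_Ber_eq[OF f] normalized_true_Ber_eq[OF g])
    then show "l2_inner half_plane (normalized_true_Ber n f) (normalized_true_Ber n g) = l2_inner half_line f g"
      unfolding laguerre_transform_orthonormal[OF f g] by simp
  }
  {
    fix F assume "F \<in> true_poly_bergman n"
    then have F: "F \<in> poly_bergman (Suc n)" and orth: "\<And>G. G \<in> poly_bergman n \<Longrightarrow> l2_inner half_plane F G = 0"
      by (auto simp: true_poly_bergman_def)
    obtain f where f: "\<And>k. f k \<in> L2 half_line" and Ff: "\<And>z. z \<in> \<bbbU> \<Longrightarrow> F z = (\<Sum>k<Suc n. laguerre_transform k (f k) z)"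
      using poly_bergman_decomposition[OF F] by blast
    \<comment> \<open>\<open>F\<close> is orthogonal to its own component of order \<open>k < n\<close>, whose squared norm is thus zero.\<close>
    have zero: "AE t in half_line. f k t = 0" if k: "k < n" for k
    proof -
      have "laguerre_transform k (f k) \<in> poly_bergman n"
        unfolding poly_bergman_iff using TL[OF f] laguerre_transform_polyanalytic_sum[OF f, of k "n - 1"] k by auto
      then have "0 = l2_inner half_plane F (laguerre_transform k (f k))" using orth by simp
      also have "\<dots> = l2_inner half_plane (\<lambda>z. \<Sum>j<Suc n. laguerre_transform j (f j) z) (laguerre_transform k (f k))"
        by (rule l2_inner_cong) (auto simp: Ff)
      also have "\<dots> = (\<Sum>j<Suc n. l2_inner half_plane (laguerre_transform j (f j)) (laguerre_transform k (f k)))"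
        by (rule l2_inner_sum_left) (intro TL f)+
      also have "\<dots> = (\<Sum>j<Suc n. if j = k then l2_inner half_line (f k) (f k) else 0)"
        by (intro sum.cong refl) (auto simp: laguerre_transform_orthonormal[OF f f])
      also have "\<dots> = of_real (l2_sq half_line (f k))" using k by (simp add: l2_inner_self del: sum.lessThan_Suc)
      finally have "(LINT t|half_line. (cmod (f k t))\<^sup>2) = 0" by (simp add: l2_sq_def)
      then have "AE t in half_line. (cmod (f k t))\<^sup>2 = 0"
        using integral_nonneg_eq_0_iff_AE[OF L2_square_integrable[OF f[of k]]] by simp
      then show ?thesis by eventually_elim simp
    qed
    have "laguerre_transform k (f k) z = 0" if k: "k < n" for k z
    proof -
      have m: "(\<lambda>t. laguerre_kernel k z t * f k t) \<in> borel_measurable half_line"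
        using half_line_measurable[OF laguerre_kernel_measurable, of k z] f[of k] by (auto simp: L2_def)
      have "(LINT t|half_line. laguerre_kernel k z t * f k t) = (LINT t|half_line. 0)"
        by (rule integral_cong_AE[OF m]) (use zero[OF k] in \<open>auto elim!: eventually_mono\<close>)
      then show ?thesis by (simp add: laguerre_transform_def)
    qed
    then have "F z = laguerre_transform n (f n) z" if "z \<in> \<bbbU>" for z using Ff[OF that] by simp
    then show "\<exists>f\<in>L2 half_line. \<forall>z\<in>space half_plane. normalized_true_Ber n f z = F z"
      using f[of n] normalized_true_Ber_eq[OF f[of n]] by (intro bexI[of _ "f n"]) auto
  }
qed

end
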